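(* Let $N \ge 1$, $L \ge 2$ be integers with $N$ even, and let $\beta \in \{\pm 1\}$. Then for every integer $n \ge 1$ the $n$-th Frobenius-Schur indicator of the regular representation of $A = A_{NL}^{+\beta}$ (that is, $A_{NL}^{\alpha\beta}$ with $\alpha = +1$) is given by \begin{align*} \nu_n(A) &= \gcd(N,n)\gcd(L,n) \\ &\quad + [\,b_2(n)-1 \ge 0\,] \cdot L\gcd(N,n) \\ &\quad + [\,b_2(n)-1 \ge b_2(N)\,] \cdot L \gcd(N,n) \\ &\quad + [\,b_2(n)-1 \ge b_2(N) \text{ and } b_2(n)-1 \ge b_2(L)\,] \cdot \varepsilon'_{NL}(n) \gcd(N,n)\gcd(L,n) \end{align*} where \[ \varepsilon'_{NL}(n) = (-1)^{[b_2(n)=1]} \beta^{[b_2(n)-1 = b_2(L)]}. \]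
   Context: For a positive integer $m$, $b_2(m)$ is the largest integer $i \ge 0$ such that $2^i$ divides $m$. The Iverson bracket $[P]$ equals $1$ if the condition $P$ holds and $0$ otherwise. Suzuki's Hopf algebra $A_{NL}^{\alpha\beta}$ ($N\ge 1$, $L \ge 2$, $\alpha,\beta \in \{\pm1\}$) over $\mathbb{C}$ is generated as an algebra by $x_{ij}$ ($i,j \in \mathbb{Z}_2$) with defining relations: $x_{00}^2 = x_{11}^2$; $x_{01}^2 = x_{10}^2$; $x_{00}^{2N} + \alpha x_{01}^{2N} = 1$; $x_{ij}x_{kl} = 0$ whenever $i-j \ne k-l$ in $\mathbb{Z}_2$; $x_{00}x_{11}x_{00}\cdots = x_{11}x_{00}x_{11}\cdots$ (alternating products with $L$ factors on each side); $x_{01}x_{10}x_{01}\cdots = \beta\, x_{10}x_{01}x_{10}\cdots$ (alternating products with $L$ factors on each side). The coalgebra structure is $\Delta(x_{ij}) = x_{i0}\otimes x_{0j} + x_{i1} \otimes x_{1j}$, $\varepsilon(x_{ij}) = \delta_{ij}$, and the antipode is $S(x_{ij}) = x_{ji}^{4N-1}$. It is semisimple of dimension $4NL$. For a finite-dimensional semisimple Hopf algebra $H$ over $\mathbb{C}$, $\nu_n(H) = \chi_H(\Lambda_{(1)} \Lambda_{(2)} \cdots \Lambda_{(n)})$, where $\Lambda \in H$ is the integral with $\varepsilon(\Lambda) = 1$, Sweedler notation is used for the iterated comultiplication, and $\chi_H$ is the character of the (left) regular representation. *)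

theory Defs
  imports
    "HOL-Algebra.QuotRing"
    "HOL-Algebra.Module"
    "HOL-Computational_Algebra.Primes"
    "HOL-Library.Poly_Mapping"
    "HOL-Library.Z2"
    Complex_Main
begin

hide_const (open) Multiset.mult Poly_Mapping.map

section \<open>Complex algebras\<close>

text \<open>
  A (not necessarily commutative) complex algebra is carried by the record type of
  \<^theory>\<open>HOL-Algebra.Module\<close>, which has both a ring multiplication and scalars.
\<close>

abbreviation mon :: "'m \<Rightarrow> 'm \<Rightarrow>\<^sub>0 complex" where
  "mon w \<equiv> Poly_Mapping.single w 1"

definition monoid_algebra ::
    "('m, 'x) monoid_scheme \<Rightarrow> (complex, 'm \<Rightarrow>\<^sub>0 complex) module" where
  "monoid_algebra M =
    \<lparr>carrier = {p. Poly_Mapping.keys p \<subseteq> carrier M},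
     mult = (\<lambda>p q. \<Sum>u\<in>Poly_Mapping.keys p. \<Sum>v\<in>Poly_Mapping.keys q.
              Poly_Mapping.single (u \<otimes>\<^bsub>M\<^esub> v)
                (Poly_Mapping.lookup p u * Poly_Mapping.lookup q v)),
     one = mon \<one>\<^bsub>M\<^esub>,
     zero = 0,
     add = (+),
     smult = (\<lambda>c. Poly_Mapping.map ((*) c))\<rparr>"

definition free_algebra :: "(complex, 'g list \<Rightarrow>\<^sub>0 complex) module" where
  "free_algebra = monoid_algebra \<lparr>carrier = UNIV, mult = (@), one = []\<rparr>"

text \<open>
  The quotient of an algebra by a subspace; the operations are the ones of
  \<^const>\<open>FactRing\<close>, extended by scalar multiplication of cosets.
\<close>

definition quotient_algebra ::
    "(complex, 'a, 'x) module_scheme \<Rightarrow> 'a set \<Rightarrow> (complex, 'a set) module" where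
  "quotient_algebra R I =
    \<lparr>carrier = carrier (R Quot I),
     mult = mult (R Quot I),
     one = one (R Quot I),
     zero = zero (R Quot I),
     add = add (R Quot I),
     smult = (\<lambda>c X. \<Union>x\<in>X. I +>\<^bsub>R\<^esub> (c \<odot>\<^bsub>R\<^esub> x))\<rparr>"

text \<open>
  \<open>lin_ext V \<phi>\<close> extends \<open>\<phi>\<close> linearly to formal complex combinations of arguments of
  \<open>\<phi>\<close>, and \<open>descend f X\<close> is the common value on the coset \<open>X\<close> of a map \<open>f\<close> that is
  constant on cosets.
\<close>

definition lin_ext ::
    "(complex, 'a, 'x) module_scheme \<Rightarrow> ('w \<Rightarrow> 'a) \<Rightarrow> ('w \<Rightarrow>\<^sub>0 complex) \<Rightarrow> 'a" where
  "lin_ext V \<phi> p =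
    (\<Oplus>\<^bsub>V\<^esub>w\<in>Poly_Mapping.keys p. Poly_Mapping.lookup p w \<odot>\<^bsub>V\<^esub> \<phi> w)"

definition descend :: "('a \<Rightarrow> 'b) \<Rightarrow> 'a set \<Rightarrow> 'b" where
  "descend f X = the_elem (f ` X)"

definition list_mult :: "('a, 'x) monoid_scheme \<Rightarrow> 'a list \<Rightarrow> 'a" where
  "list_mult M xs = foldr (mult M) xs \<one>\<^bsub>M\<^esub>"


section \<open>Tensor powers\<close>

text \<open>
  \<open>H\<^sup>\<otimes>\<^sup>n\<close> is the space of formal combinations of \<open>n\<close>-tuples of elements of \<open>H\<close>, modulo
  the span of the multilinearity relations; the list \<open>[a\<^sub>1, \<dots>, a\<^sub>n]\<close> stands for
  \<open>a\<^sub>1 \<otimes> \<dots> \<otimes> a\<^sub>n\<close>. The product is componentwise.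
\<close>

type_synonym 'a tensor = "('a list \<Rightarrow>\<^sub>0 complex) set"

definition formal_tensors ::
    "(complex, 'a, 'x) module_scheme \<Rightarrow> nat \<Rightarrow> (complex, 'a list \<Rightarrow>\<^sub>0 complex) module" where
  "formal_tensors H n = monoid_algebra
    \<lparr>carrier = {w. length w = n \<and> set w \<subseteq> carrier H},
     mult = map2 (mult H),
     one = replicate n \<one>\<^bsub>H\<^esub>\<rparr>"

inductive_set null_tensors ::
    "(complex, 'a, 'x) module_scheme \<Rightarrow> nat \<Rightarrow> 'a tensor"
  for H :: "(complex, 'a, 'x) module_scheme" and n :: nat where
  zero: "0 \<in> null_tensors H n"
| plus: "p \<in> null_tensors H n \<Longrightarrow> q \<in> null_tensors H n \<Longrightarrow> p + q \<in> null_tensors H n"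
| scale: "p \<in> null_tensors H n \<Longrightarrow> Poly_Mapping.map ((*) c) p \<in> null_tensors H n"
| additive: "\<lbrakk>set u \<subseteq> carrier H; set v \<subseteq> carrier H; length u + 1 + length v = n;
      a \<in> carrier H; b \<in> carrier H\<rbrakk> \<Longrightarrow>
    mon (u @ (a \<oplus>\<^bsub>H\<^esub> b) # v) - mon (u @ a # v) - mon (u @ b # v) \<in> null_tensors H n"
| homogeneous: "\<lbrakk>set u \<subseteq> carrier H; set v \<subseteq> carrier H; length u + 1 + length v = n;
      a \<in> carrier H\<rbrakk> \<Longrightarrow>
    mon (u @ (c \<odot>\<^bsub>H\<^esub> a) # v) - Poly_Mapping.single (u @ a # v) c \<in> null_tensors H n"

definition tensor_power ::
    "(complex, 'a, 'x) module_scheme \<Rightarrow> nat \<Rightarrow> (complex, 'a tensor) module" where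
  "tensor_power H n = quotient_algebra (formal_tensors H n) (null_tensors H n)"

definition tensor_class ::
    "(complex, 'a, 'x) module_scheme \<Rightarrow> nat \<Rightarrow> ('a list \<Rightarrow>\<^sub>0 complex) \<Rightarrow> 'a tensor" where
  "tensor_class H n t = null_tensors H n +>\<^bsub>formal_tensors H n\<^esub> t"

definition pure_tensor ::
    "(complex, 'a, 'x) module_scheme \<Rightarrow> 'a list \<Rightarrow> 'a tensor" where
  "pure_tensor H w = tensor_class H (length w) (mon w)"


section \<open>Frobenius-Schur indicators of the regular representation\<close>

text \<open>
  The record carries the structure maps only; the Hopf algebra axioms are not imposed on it,
  and the definitions below are meaningful for finite-dimensional semisimple Hopf algebras.
\<close>

record 'a hopf = "(complex, 'a) module" +
  comult :: "'a \<Rightarrow> 'a tensor"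
  counit :: "'a \<Rightarrow> complex"
  antipode :: "'a \<Rightarrow> 'a"

text \<open>
  \<open>comult_first H n\<close> is the linear map \<open>\<Delta> \<otimes> id \<otimes> \<dots> \<otimes> id\<close> from \<open>H\<^sup>\<otimes>\<^sup>n\<close> to \<open>H\<^sup>\<otimes>\<^sup>n\<^sup>+\<^sup>1\<close>, for
  \<open>n \<ge> 1\<close>. The product of \<^const>\<open>free_algebra\<close> concatenates tuples, so it juxtaposes
  formal tensors.
\<close>

definition comult_first :: "('a, 'x) hopf_scheme \<Rightarrow> nat \<Rightarrow> 'a tensor \<Rightarrow> 'a tensor" where
  "comult_first H n =
    descend (lin_ext (tensor_power H (n + 1))
      (\<lambda>w. \<Union>t\<in>comult H (hd w).
             tensor_class H (n + 1) (t \<otimes>\<^bsub>free_algebra\<^esub> mon (tl w))))"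

text \<open>
  \<open>iter_comult H n h\<close> is \<open>h\<^sub>(\<^sub>1\<^sub>) \<otimes> \<dots> \<otimes> h\<^sub>(\<^sub>n\<^sub>)\<close>, with the usual convention \<open>\<epsilon>(h)\<close> for
  \<open>n = 0\<close>.
\<close>

fun iter_comult :: "('a, 'x) hopf_scheme \<Rightarrow> nat \<Rightarrow> 'a \<Rightarrow> 'a tensor" where
  "iter_comult H 0 h = tensor_class H 0 (Poly_Mapping.single [] (counit H h))"
| "iter_comult H (Suc 0) h = pure_tensor H [h]"
| "iter_comult H (Suc (Suc n)) h = comult_first H (Suc n) (iter_comult H (Suc n) h)"

definition sweedler_power :: "('a, 'x) hopf_scheme \<Rightarrow> nat \<Rightarrow> 'a \<Rightarrow> 'a" where
  "sweedler_power H n h = descend (lin_ext H (list_mult H)) (iter_comult H n h)"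

text \<open>
  Integrals of a semisimple Hopf algebra are two-sided, and the two-sided condition makes the
  normalized one unique.
\<close>

definition normalized_integral :: "('a, 'x) hopf_scheme \<Rightarrow> 'a" where
  "normalized_integral H = (THE \<Lambda>. \<Lambda> \<in> carrier H \<and>
    (\<forall>h\<in>carrier H. h \<otimes>\<^bsub>H\<^esub> \<Lambda> = counit H h \<odot>\<^bsub>H\<^esub> \<Lambda> \<and> \<Lambda> \<otimes>\<^bsub>H\<^esub> h = counit H h \<odot>\<^bsub>H\<^esub> \<Lambda>) \<and>
    counit H \<Lambda> = 1)"

definition coordinates_wrt ::
    "(complex, 'a, 'x) module_scheme \<Rightarrow> 'a set \<Rightarrow> 'a \<Rightarrow> ('a \<Rightarrow> complex) \<Rightarrow> bool" where
  "coordinates_wrt V B v c \<longleftrightarrow>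
    (\<forall>b. b \<notin> B \<longrightarrow> c b = 0) \<and> v = (\<Oplus>\<^bsub>V\<^esub>b\<in>B. c b \<odot>\<^bsub>V\<^esub> b)"

definition finite_basis :: "(complex, 'a, 'x) module_scheme \<Rightarrow> 'a set \<Rightarrow> bool" where
  "finite_basis V B \<longleftrightarrow>
    finite B \<and> B \<subseteq> carrier V \<and> (\<forall>v\<in>carrier V. \<exists>!c. coordinates_wrt V B v c)"

definition endo_trace :: "(complex, 'a, 'x) module_scheme \<Rightarrow> ('a \<Rightarrow> 'a) \<Rightarrow> complex" where
  "endo_trace V f =
    (let B = SOME B. finite_basis V B
     in \<Sum>b\<in>B. (THE c. coordinates_wrt V B (f b) c) b)"

definition regular_character :: "(complex, 'a, 'x) module_scheme \<Rightarrow> 'a \<Rightarrow> complex" where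
  "regular_character H h = endo_trace H (\<lambda>x. h \<otimes>\<^bsub>H\<^esub> x)"

definition fs_indicator :: "('a, 'x) hopf_scheme \<Rightarrow> nat \<Rightarrow> complex" where
  "fs_indicator H n = regular_character H (sweedler_power H n (normalized_integral H))"


section \<open>Suzuki's Hopf algebras\<close>

type_synonym gen = "bit \<times> bit"
type_synonym suzuki_elem = "(gen list \<Rightarrow>\<^sub>0 complex) set"

definition alternating :: "'a \<Rightarrow> 'a \<Rightarrow> nat \<Rightarrow> 'a list" where
  "alternating a b L = map (\<lambda>k. if even k then a else b) [0..<L]"

text \<open>A defining relation \<open>p = q\<close> is entered as the element \<open>p - q\<close>.\<close>

definition suzuki_relations ::
    "nat \<Rightarrow> nat \<Rightarrow> complex \<Rightarrow> complex \<Rightarrow> (gen list \<Rightarrow>\<^sub>0 complex) set" where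
  "suzuki_relations N L \<alpha> \<beta> =
    {mon [(0, 0), (0, 0)] - mon [(1, 1), (1, 1)],
     mon [(0, 1), (0, 1)] - mon [(1, 0), (1, 0)],
     mon (replicate (2 * N) (0, 0)) + Poly_Mapping.single (replicate (2 * N) (0, 1)) \<alpha> - mon [],
     mon (alternating (0, 0) (1, 1) L) - mon (alternating (1, 1) (0, 0) L),
     mon (alternating (0, 1) (1, 0) L) - Poly_Mapping.single (alternating (1, 0) (0, 1) L) \<beta>}
    \<union> {mon [(i, j), (k, l)] | i j k l. i - j \<noteq> k - l}"

definition suzuki_ideal ::
    "nat \<Rightarrow> nat \<Rightarrow> complex \<Rightarrow> complex \<Rightarrow> (gen list \<Rightarrow>\<^sub>0 complex) set" where
  "suzuki_ideal N L \<alpha> \<beta> = Idl\<^bsub>free_algebra\<^esub> (suzuki_relations N L \<alpha> \<beta>)"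

definition suzuki_algebra ::
    "nat \<Rightarrow> nat \<Rightarrow> complex \<Rightarrow> complex \<Rightarrow> (complex, suzuki_elem) module" where
  "suzuki_algebra N L \<alpha> \<beta> = quotient_algebra free_algebra (suzuki_ideal N L \<alpha> \<beta>)"

definition suzuki_gen ::
    "nat \<Rightarrow> nat \<Rightarrow> complex \<Rightarrow> complex \<Rightarrow> bit \<Rightarrow> bit \<Rightarrow> suzuki_elem" where
  "suzuki_gen N L \<alpha> \<beta> i j = suzuki_ideal N L \<alpha> \<beta> +>\<^bsub>free_algebra\<^esub> mon [(i, j)]"

text \<open>
  The structure maps are the algebra homomorphisms \<open>\<Delta>\<close>, \<open>\<epsilon>\<close> and the
  algebra antihomomorphism \<open>S\<close> with the prescribed values on the generators: each is
  extended to words multiplicatively (for \<open>S\<close> with the word reversed), then linearly, and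
  descended to the quotient.
\<close>

definition suzuki_comult ::
    "nat \<Rightarrow> nat \<Rightarrow> complex \<Rightarrow> complex \<Rightarrow> suzuki_elem \<Rightarrow> suzuki_elem tensor" where
  "suzuki_comult N L \<alpha> \<beta> =
    (let A = suzuki_algebra N L \<alpha> \<beta>; x = suzuki_gen N L \<alpha> \<beta>; T = tensor_power A 2
     in descend (lin_ext T (\<lambda>w. list_mult T
          (map (\<lambda>(i, j). pure_tensor A [x i 0, x 0 j] \<oplus>\<^bsub>T\<^esub> pure_tensor A [x i 1, x 1 j]) w))))"

definition suzuki_counit ::
    "nat \<Rightarrow> nat \<Rightarrow> complex \<Rightarrow> complex \<Rightarrow> suzuki_elem \<Rightarrow> complex" where
  "suzuki_counit N L \<alpha> \<beta> =
    descend (\<lambda>p. \<Sum>w\<in>Poly_Mapping.keys p.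
      Poly_Mapping.lookup p w * (\<Prod>(i, j)\<leftarrow>w. if i = j then 1 else 0))"

definition suzuki_antipode ::
    "nat \<Rightarrow> nat \<Rightarrow> complex \<Rightarrow> complex \<Rightarrow> suzuki_elem \<Rightarrow> suzuki_elem" where
  "suzuki_antipode N L \<alpha> \<beta> =
    (let A = suzuki_algebra N L \<alpha> \<beta>; x = suzuki_gen N L \<alpha> \<beta>
     in descend (lin_ext A (\<lambda>w. list_mult A
          (map (\<lambda>(i, j). x j i [^]\<^bsub>A\<^esub> (4 * N - 1)) (rev w)))))"

definition suzuki_hopf ::
    "nat \<Rightarrow> nat \<Rightarrow> complex \<Rightarrow> complex \<Rightarrow> suzuki_elem hopf" where
  "suzuki_hopf N L \<alpha> \<beta> = module.extend (suzuki_algebra N L \<alpha> \<beta>)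
    (hopf.fields (suzuki_comult N L \<alpha> \<beta>) (suzuki_counit N L \<alpha> \<beta>) (suzuki_antipode N L \<alpha> \<beta>))"


section \<open>Notation for the closed formula\<close>

text \<open>
  The 2-adic valuation is integer-valued here, so that \<open>b2 n - 1\<close> is not truncated when
  \<open>n\<close> is odd.
\<close>

definition b2 :: "nat \<Rightarrow> int" where
  "b2 m = int (multiplicity 2 m)"

definition suzuki_sign :: "nat \<Rightarrow> complex \<Rightarrow> nat \<Rightarrow> complex" where
  "suzuki_sign L \<beta> n = (- 1) ^ of_bool (b2 n = 1) * \<beta> ^ of_bool (b2 n - 1 = b2 L)"

end

theory Submission
  imports Defs
begin

text \<open>
  The words of parity \<open>c\<close>, those in the \<open>x\<^sub>i\<^sub>j\<close> with \<open>j - i = c\<close>, span a group algebra for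
  \<open>c = 0\<close> and a group algebra twisted by \<open>\<beta>\<close> for \<open>c = 1\<close>, and \<open>A\<close> is the direct sum of the two.
  Both groups have order \<open>2NL\<close>: with \<open>g = x\<^sub>0\<^sub>c\<close> and \<open>q = x\<^sub>0\<^sub>c x\<^sub>1\<^sub>,\<^sub>1\<^sub>+\<^sub>c g\<^sup>-\<^sup>2\<close> one has
  \<open>g\<^sup>2\<^sup>N = 1\<close>, \<open>g q g\<^sup>-\<^sup>1 = q\<^sup>-\<^sup>1\<close> and \<open>q\<^sup>L = 1\<close> or \<open>\<beta>\<close>. Hence a word is determined by its parity,
  its length modulo \<open>2N\<close> and an alternating sum of its row indices modulo \<open>L\<close>, up to a power of \<open>\<beta>\<close>.
  The regular character is \<open>2NL\<close> times the coefficient of the two unit elements, and the integral is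
  the average of the group of parity 0.

  The iterated coproduct of \<open>x\<^sub>i\<^sub>,\<^sub>i\<close>, for a sequence \<open>i\<close> of row indices, is the sum of
  \<open>x\<^sub>i\<^sub>,\<^sub>i\<^sub>+\<^sub>k\<^sub>1 \<otimes> x\<^sub>i\<^sub>+\<^sub>k\<^sub>1\<^sub>,\<^sub>i\<^sub>+\<^sub>k\<^sub>2 \<otimes> \<dots>\<close>; multiplying out kills all terms except the \<open>n\<close>-th power of
  \<open>x\<^sub>i\<^sub>,\<^sub>i\<close> and, for even \<open>n\<close>, the power \<open>n/2\<close> of \<open>x\<^sub>i\<^sub>,\<^sub>i\<^sub>+\<^sub>1 x\<^sub>i\<^sub>+\<^sub>1\<^sub>,\<^sub>i\<close>. Splitting both according to the
  parity of the length of \<open>i\<close> gives the four terms of the formula, each of which counts solutions of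
  linear congruences.
\<close>

section \<open>Complex vector spaces and algebras\<close>

text \<open>Neither q nor g^-1 is given by the generators: g is invertible only within the component
  of its parity, whose unit is the word g^(2N), and 1 is the sum of the two such units. This shapes
  the normal forms. They are words (g h)^a g^j with j > 0, exponents are enlarged by multiples of 2N
  before anything is cancelled, and the empty word, which belongs to both parities at once, is
  treated apart.

  The two groups are never constructed. Spanning is obtained by rewriting words. Independence comes
  from explicit coefficient functionals on the free algebra: they vanish on the ideal because
  exchanging the two sides of a relation inside any word respects them. Normal forms and functionals
  together are a dual family, and this is all that a trace requires.

  Every map out of a quotient is given on representatives, so each of \<open>coeff\<close>,
  \<open>eps\<close>, \<open>Delta\<close> and the maps on tensor powers comes with a proof that it
  kills the ideal in question.

  The evenness of N enters through the sign: it makes (-1)^[b_2(n) = 1] equal to 1 whenever the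
  bracket in front of it is nonzero.\<close>

locale complex_space = abelian_group V for V :: "(complex, 'a, 'x) module_scheme" (structure) +
  assumes smult_closed [simp, intro]: "v \<in> carrier V \<Longrightarrow> c \<odot> v \<in> carrier V"
    and smult_add_left: "v \<in> carrier V \<Longrightarrow> (c + d) \<odot> v = c \<odot> v \<oplus> d \<odot> v"
    and smult_add_right: "\<lbrakk>v \<in> carrier V; w \<in> carrier V\<rbrakk> \<Longrightarrow> c \<odot> (v \<oplus> w) = c \<odot> v \<oplus> c \<odot> w"
    and smult_smult: "v \<in> carrier V \<Longrightarrow> c \<odot> (d \<odot> v) = (c * d) \<odot> v"
    and smult_one [simp]: "v \<in> carrier V \<Longrightarrow> 1 \<odot> v = v"
begin

lemma smult_zero_left [simp]: "v \<in> carrier V \<Longrightarrow> 0 \<odot> v = \<zero>"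
  using smult_add_left[of v 0 0] add.l_cancel_one[of "0 \<odot> v" "0 \<odot> v"] by simp

lemma smult_zero_right [simp]: "c \<odot> \<zero> = \<zero>"
  using smult_add_right[of \<zero> \<zero> c] add.l_cancel_one[of "c \<odot> \<zero>" "c \<odot> \<zero>"] by simp

lemma minus_eq_smult: "v \<in> carrier V \<Longrightarrow> \<ominus> v = (- 1) \<odot> v"
  using smult_add_left[of v "- 1" 1] by (intro minus_equality) auto

lemma smult_finsum:
  "f \<in> S \<rightarrow> carrier V \<Longrightarrow> c \<odot> (\<Oplus>x\<in>S. f x) = (\<Oplus>x\<in>S. c \<odot> f x)"
proof (induction S rule: infinite_finite_induct)
  case (insert x S)
  then show ?case by (simp add: smult_add_right Pi_iff)
qed (auto simp: finsum_infinite)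

end

locale complex_algebra = complex_space V + ring V
    for V :: "(complex, 'a, 'x) module_scheme" (structure) +
  assumes smult_mult_left: "\<lbrakk>x \<in> carrier V; y \<in> carrier V\<rbrakk> \<Longrightarrow> (c \<odot> x) \<otimes> y = c \<odot> (x \<otimes> y)"
    and smult_mult_right: "\<lbrakk>x \<in> carrier V; y \<in> carrier V\<rbrakk> \<Longrightarrow> x \<otimes> (c \<odot> y) = c \<odot> (x \<otimes> y)"

lemma (in ring) list_mult_closed [simp, intro]: "set xs \<subseteq> carrier R \<Longrightarrow> list_mult R xs \<in> carrier R"
  by (induction xs) (auto simp: list_mult_def)

lemma (in ring) list_mult_append:
  "\<lbrakk>set xs \<subseteq> carrier R; set ys \<subseteq> carrier R\<rbrakk> \<Longrightarrow>
    list_mult R (xs @ ys) = list_mult R xs \<otimes> list_mult R ys"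
proof (induction xs)
  case Nil
  then show ?case using list_mult_closed by (simp add: list_mult_def)
next
  case (Cons x xs)
  then show ?case
    using list_mult_closed[of xs] list_mult_closed[of ys] by (simp add: list_mult_def m_assoc)
qed

lemma list_mult_Nil [simp]: "list_mult M [] = \<one>\<^bsub>M\<^esub>"
  by (simp add: list_mult_def)

lemma list_mult_Cons [simp]: "list_mult M (x # xs) = x \<otimes>\<^bsub>M\<^esub> list_mult M xs"
  by (simp add: list_mult_def)

text \<open>The one-dimensional space, serving as the target that turns linear functionals into
  instances of \<open>linear_map\<close>.\<close>

definition complex_numbers :: "(complex, complex) module" where
  "complex_numbers = \<lparr>carrier = UNIV, mult = (*), one = 1, zero = 0, add = (+), smult = (*)\<rparr>"

lemma complex_numbers_simps [simp]:
  "carrier complex_numbers = UNIV" "add complex_numbers = (+)" "zero complex_numbers = 0"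
  "smult complex_numbers = (*)"
  by (simp_all add: complex_numbers_def)

lemma complex_space_complex_numbers: "complex_space complex_numbers"
proof -
  have "abelian_group complex_numbers"
  proof (rule abelian_groupI)
    fix x :: complex
    show "\<exists>y\<in>carrier complex_numbers. y \<oplus>\<^bsub>complex_numbers\<^esub> x = \<zero>\<^bsub>complex_numbers\<^esub>"
      by (rule bexI[of _ "- x"]) auto
  qed auto
  then show ?thesis
    by (auto simp: complex_space_def complex_space_axioms_def algebra_simps)
qed

lemma finsum_complex_numbers [simp]: "finsum complex_numbers f S = sum f S"
proof -
  interpret C: complex_space complex_numbers by (rule complex_space_complex_numbers)
  show ?thesis
    by (induction S rule: infinite_finite_induct) (auto simp: C.finsum_infinite)
qed

subsection \<open>Linear maps\<close>

locale linear_map = V: complex_space V + W: complex_space W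
    for V :: "(complex, 'a, 'x) module_scheme" (structure)
    and W :: "(complex, 'b, 'y) module_scheme" (structure) and f :: "'a \<Rightarrow> 'b" +
  assumes map_closed [simp, intro]: "v \<in> carrier V \<Longrightarrow> f v \<in> carrier W"
    and map_add: "\<lbrakk>v \<in> carrier V; w \<in> carrier V\<rbrakk> \<Longrightarrow> f (v \<oplus>\<^bsub>V\<^esub> w) = f v \<oplus>\<^bsub>W\<^esub> f w"
    and map_smult: "v \<in> carrier V \<Longrightarrow> f (c \<odot>\<^bsub>V\<^esub> v) = c \<odot>\<^bsub>W\<^esub> f v"
begin

lemma map_zero [simp]: "f \<zero>\<^bsub>V\<^esub> = \<zero>\<^bsub>W\<^esub>"
  using map_smult[of "\<zero>\<^bsub>V\<^esub>" 0] by simp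

lemma map_minus: "v \<in> carrier V \<Longrightarrow> w \<in> carrier V \<Longrightarrow> f (v \<ominus>\<^bsub>V\<^esub> w) = f v \<ominus>\<^bsub>W\<^esub> f w"
  by (simp add: a_minus_def map_add map_smult V.minus_eq_smult W.minus_eq_smult)

lemma map_finsum:
  "g \<in> S \<rightarrow> carrier V \<Longrightarrow> f (finsum V g S) = finsum W (\<lambda>x. f (g x)) S"
proof (induction S rule: infinite_finite_induct)
  case (insert x S)
  then show ?case by (simp add: map_add Pi_iff)
qed (auto simp: V.finsum_infinite W.finsum_infinite)

end

lemma linear_map_compose:
  assumes "linear_map U V g" "linear_map V W f"
  shows "linear_map U W (\<lambda>x. f (g x))"
proof -
  interpret g: linear_map U V g by fact
  interpret f: linear_map V W f by fact
  show ?thesis by unfold_locales (auto simp: g.map_add f.map_add g.map_smult f.map_smult)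
qed

subsection \<open>Coordinates and traces\<close>

lemma coordinates_wrt_linear:
  assumes "linear_map V complex_numbers d" "coordinates_wrt V B v c" "B \<subseteq> carrier V"
  shows "d v = (\<Sum>b\<in>B. c b * d b)"
proof -
  interpret d: linear_map V complex_numbers d by fact
  have "d v = d (\<Oplus>\<^bsub>V\<^esub>b\<in>B. c b \<odot>\<^bsub>V\<^esub> b)"
    using assms(2) by (simp add: coordinates_wrt_def)
  also have "\<dots> = finsum complex_numbers (\<lambda>b. d (c b \<odot>\<^bsub>V\<^esub> b)) B"
    using assms(3) by (intro d.map_finsum) auto
  also have "\<dots> = (\<Sum>b\<in>B. c b * d b)"
    using assms(3) by (auto simp: d.map_smult intro!: sum.cong)
  finally show ?thesis .
qed

context complex_space
begin

definition coordinate :: "'a set \<Rightarrow> 'a \<Rightarrow> 'a \<Rightarrow> complex" where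
  "coordinate B v = (THE c. coordinates_wrt V B v c)"

lemma coordinates_wrt_coordinate:
  assumes "finite_basis V B" "v \<in> carrier V"
  shows "coordinates_wrt V B v (coordinate B v)"
  unfolding coordinate_def
  by (rule theI'[of "coordinates_wrt V B v"]) (use assms in \<open>simp add: finite_basis_def\<close>)

lemma coordinate_eqI:
  assumes "finite_basis V B" "v \<in> carrier V" "coordinates_wrt V B v c"
  shows "coordinate B v = c"
  using assms coordinates_wrt_coordinate[OF assms(1,2)] by (auto simp: finite_basis_def)

lemma linear_map_coordinate:
  assumes B: "finite_basis V B"
  shows "linear_map V complex_numbers (\<lambda>v. coordinate B v b)"
proof -
  have sub: "B \<subseteq> carrier V" using B by (simp add: finite_basis_def)
  have add: "coordinate B (v \<oplus> w) = (\<lambda>b. coordinate B v b + coordinate B w b)"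
    if vw: "v \<in> carrier V" "w \<in> carrier V" for v w
  proof (rule coordinate_eqI[OF B])
    have "v \<oplus> w = (\<Oplus>b\<in>B. coordinate B v b \<odot> b) \<oplus> (\<Oplus>b\<in>B. coordinate B w b \<odot> b)"
      using coordinates_wrt_coordinate[OF B vw(1)] coordinates_wrt_coordinate[OF B vw(2)]
      by (simp add: coordinates_wrt_def)
    also have "\<dots> = (\<Oplus>b\<in>B. coordinate B v b \<odot> b \<oplus> coordinate B w b \<odot> b)"
      using sub by (intro finsum_addf[symmetric]) auto
    also have "\<dots> = (\<Oplus>b\<in>B. (coordinate B v b + coordinate B w b) \<odot> b)"
      using sub by (intro finsum_cong') (auto simp: smult_add_left)
    finally show "coordinates_wrt V B (v \<oplus> w) (\<lambda>b. coordinate B v b + coordinate B w b)"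
      using coordinates_wrt_coordinate[OF B vw(1)] coordinates_wrt_coordinate[OF B vw(2)]
      by (auto simp: coordinates_wrt_def)
  qed (use vw in auto)
  have smult: "coordinate B (k \<odot> v) = (\<lambda>b. k * coordinate B v b)" if v: "v \<in> carrier V" for v k
  proof (rule coordinate_eqI[OF B])
    have "k \<odot> v = k \<odot> (\<Oplus>b\<in>B. coordinate B v b \<odot> b)"
      using coordinates_wrt_coordinate[OF B v] by (simp add: coordinates_wrt_def)
    also have "\<dots> = (\<Oplus>b\<in>B. k \<odot> (coordinate B v b \<odot> b))"
      using sub by (intro smult_finsum) auto
    also have "\<dots> = (\<Oplus>b\<in>B. (k * coordinate B v b) \<odot> b)"
      using sub by (intro finsum_cong') (auto simp: smult_smult)
    finally show "coordinates_wrt V B (k \<odot> v) (\<lambda>b. k * coordinate B v b)"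
      using coordinates_wrt_coordinate[OF B v] by (auto simp: coordinates_wrt_def)
  qed (use v in auto)
  show ?thesis
    by (intro linear_map.intro linear_map_axioms.intro complex_space_axioms
        complex_space_complex_numbers) (auto simp: add smult)
qed

text \<open>Basis independence of the trace, in the form used later: expand each vector b of the
  chosen basis as the sum of \<open>d i b\<close> times \<open>e i\<close>, exchange the two sums,
  and recognise the inner one as \<open>d i\<close> applied to the expansion of
  \<open>f (e i)\<close> in that basis.\<close>

lemma endo_trace_dual_family:
  fixes e :: "'i \<Rightarrow> 'a" and d :: "'i \<Rightarrow> 'a \<Rightarrow> complex"
  assumes f: "linear_map V V f" and fin: "finite I"
    and e: "\<And>i. i \<in> I \<Longrightarrow> e i \<in> carrier V"
    and d: "\<And>i. i \<in> I \<Longrightarrow> linear_map V complex_numbers (d i)"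
    and dual: "\<And>i j. \<lbrakk>i \<in> I; j \<in> I\<rbrakk> \<Longrightarrow> d i (e j) = of_bool (i = j)"
    and span: "\<And>v. v \<in> carrier V \<Longrightarrow> v = (\<Oplus>i\<in>I. d i v \<odot> e i)"
  shows "endo_trace V f = (\<Sum>i\<in>I. d i (f (e i)))"
proof -
  interpret f: linear_map V V f by fact
  have inj: "inj_on e I"
  proof (rule inj_onI)
    fix i j assume "i \<in> I" "j \<in> I" "e i = e j"
    then show "i = j" using dual[of i j] dual[of i i] by (auto split: if_splits)
  qed
  let ?B = "e ` I"
  define c where "c v b = (if b \<in> ?B then d (the_inv_into I e b) v else 0)" for v b
  have c_e: "c v (e i) = d i v" if "i \<in> I" for v i
    using that inj by (simp add: c_def the_inv_into_f_f)
  have sum_B: "(\<Oplus>b\<in>?B. g b \<odot> b) = (\<Oplus>i\<in>I. g (e i) \<odot> e i)" for g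
    using inj e by (intro finsum_reindex) auto
  have coords: "coordinates_wrt V ?B v (c v)" if v: "v \<in> carrier V" for v
  proof -
    have "v = (\<Oplus>i\<in>I. d i v \<odot> e i)" by (rule span[OF v])
    also have "\<dots> = (\<Oplus>i\<in>I. c v (e i) \<odot> e i)"
      using e by (intro finsum_cong') (auto simp: c_e)
    also have "\<dots> = (\<Oplus>b\<in>?B. c v b \<odot> b)" by (rule sum_B[symmetric])
    finally show ?thesis by (auto simp: coordinates_wrt_def c_def)
  qed
  have unique: "g = c v" if g: "coordinates_wrt V ?B v g" for v g
  proof (rule ext)
    fix b
    show "g b = c v b"
    proof (cases "b \<in> ?B")
      case True
      then obtain i where i: "i \<in> I" "b = e i" by auto
      have "d i v = (\<Sum>b\<in>?B. g b * d i b)"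
        using coordinates_wrt_linear[OF d[OF i(1)] g] e by auto
      also have "\<dots> = (\<Sum>j\<in>I. g (e j) * d i (e j))"
        using inj by (simp add: sum.reindex)
      also have "\<dots> = (\<Sum>j\<in>I. if i = j then g (e j) else 0)"
        by (intro sum.cong) (auto simp: dual i)
      also have "\<dots> = g (e i)" using fin i by simp
      finally show ?thesis by (simp add: i c_e)
    next
      case False
      then show ?thesis using g by (auto simp: c_def coordinates_wrt_def)
    qed
  qed
  have B: "finite_basis V ?B"
    unfolding finite_basis_def using fin e by (auto intro!: ex1I coords unique)
  \<comment> \<open>\<open>endo_trace\<close> selects its basis by \<open>SOME\<close>. The basis
    just exhibited only guarantees that the selected set is a basis; nothing else is known about
    it.\<close>
  define D where "D = (SOME D. finite_basis V D)"
  have D: "finite_basis V D" unfolding D_def using B by (rule someI)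
  then have D_carrier: "D \<subseteq> carrier V" by (simp add: finite_basis_def)
  have "coordinate D (f b) b = (\<Sum>i\<in>I. coordinate D (f (e i)) b * d i b)" if b: "b \<in> D" for b
  proof -
    interpret l: linear_map V complex_numbers "\<lambda>v. coordinate D (f v) b"
      by (rule linear_map_compose[OF f linear_map_coordinate[OF D]])
    have "coordinate D (f b) b = coordinate D (f (\<Oplus>i\<in>I. d i b \<odot> e i)) b"
      using span[of b] b D_carrier by auto
    also have "\<dots> = (\<Sum>i\<in>I. coordinate D (f (d i b \<odot> e i)) b)"
      by (subst l.map_finsum) (use e in auto)
    also have "\<dots> = (\<Sum>i\<in>I. coordinate D (f (e i)) b * d i b)"
      using e l.map_smult by (intro sum.cong) auto
    finally show ?thesis .
  qed
  then have "endo_trace V f = (\<Sum>b\<in>D. \<Sum>i\<in>I. coordinate D (f (e i)) b * d i b)"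
    unfolding endo_trace_def Let_def D_def[symmetric] coordinate_def[symmetric] by (intro sum.cong) auto
  also have "\<dots> = (\<Sum>i\<in>I. \<Sum>b\<in>D. coordinate D (f (e i)) b * d i b)"
    by (rule sum.swap)
  also have "\<dots> = (\<Sum>i\<in>I. d i (f (e i)))"
  proof (rule sum.cong)
    fix i assume "i \<in> I"
    then show "(\<Sum>b\<in>D. coordinate D (f (e i)) b * d i b) = d i (f (e i))"
      using coordinates_wrt_linear[OF d coordinates_wrt_coordinate[OF D] D_carrier] e by simp
  qed simp
  finally show ?thesis .
qed

end

subsection \<open>Monoid algebras\<close>

abbreviation keys where "keys \<equiv> Poly_Mapping.keys"
abbreviation lookup where "lookup \<equiv> Poly_Mapping.lookup"
abbreviation single where "single \<equiv> Poly_Mapping.single"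

abbreviation scal :: "complex \<Rightarrow> ('m \<Rightarrow>\<^sub>0 complex) \<Rightarrow> 'm \<Rightarrow>\<^sub>0 complex" where
  "scal c \<equiv> Poly_Mapping.map ((*) c)"

lemma poly_mapping_map_times [simp]:
  "lookup (scal c p) k = c * lookup p k"
  by (simp add: Poly_Mapping.map.rep_eq when_def)

lemma poly_mapping_sum_single:
  assumes "finite S" "keys p \<subseteq> S"
  shows "p = (\<Sum>k\<in>S. single k (lookup p k))"
proof (rule poly_mapping_eqI)
  fix k
  have "lookup (\<Sum>k\<in>S. single k (lookup p k)) k =
      (\<Sum>j\<in>S. if j = k then lookup p k else 0)"
    by (auto simp: lookup_sum lookup_single when_def intro!: sum.cong)
  also have "\<dots> = lookup p k"
    using assms by (auto simp: in_keys_iff)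
  finally show "lookup p k =
      lookup (\<Sum>k\<in>S. single k (lookup p k)) k" ..
qed

text \<open>Reduces identities that are linear in p to monomials while keeping track of the support,
  which plays the role of the carrier. Associativity, ideal closure and statements about cosets are
  all checked on words in this way.\<close>

lemma poly_mapping_span_induct [consumes 1, case_names zero add single]:
  fixes p :: "'m \<Rightarrow>\<^sub>0 complex"
  assumes "keys p \<subseteq> S"
    and "P 0"
    and add: "\<And>p q. \<lbrakk>keys p \<subseteq> S; keys q \<subseteq> S; P p; P q\<rbrakk> \<Longrightarrow> P (p + q)"
    and single: "\<And>u c. u \<in> S \<Longrightarrow> P (single u c)"
  shows "P p"
proof -
  have "keys (\<Sum>k\<in>K. single k (lookup p k)) \<subseteq> S \<and>
      P (\<Sum>k\<in>K. single k (lookup p k))"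
    if "finite K" "K \<subseteq> S" for K
    using that
  proof (induction K rule: finite_induct)
    case empty
    then show ?case using assms(2) by simp
  next
    case (insert k K)
    have "keys (single k (lookup p k) +
        (\<Sum>k\<in>K. single k (lookup p k))) \<subseteq> S"
      by (rule order_trans[OF keys_add]) (use insert in \<open>auto split: if_splits\<close>)
    then show ?case using insert by (auto intro!: add single split: if_splits)
  qed
  from this[OF finite_keys assms(1)] show ?thesis
    using poly_mapping_sum_single[of "keys p" p] by simp
qed

lemma monoid_algebra_simps [simp]:
  "carrier (monoid_algebra M) = {p. keys p \<subseteq> carrier M}"
  "add (monoid_algebra M) = (+)" "zero (monoid_algebra M) = 0"
  "one (monoid_algebra M) = mon \<one>\<^bsub>M\<^esub>"
  "smult (monoid_algebra M) = scal"
  by (simp_all add: monoid_algebra_def)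

text \<open>The product sums over the supports, which change under addition. Over a common finite
  superset the index sets agree and distributivity holds termwise.\<close>

lemma monoid_algebra_mult_superset:
  assumes "finite S" "keys p \<subseteq> S" "finite T" "keys q \<subseteq> T"
  shows "p \<otimes>\<^bsub>monoid_algebra M\<^esub> q = (\<Sum>u\<in>S. \<Sum>v\<in>T.
    single (u \<otimes>\<^bsub>M\<^esub> v) (lookup p u * lookup q v))"
proof -
  have "p \<otimes>\<^bsub>monoid_algebra M\<^esub> q = (\<Sum>u\<in>S. \<Sum>v\<in>keys q.
    single (u \<otimes>\<^bsub>M\<^esub> v) (lookup p u * lookup q v))"
    unfolding monoid_algebra_def using assms
    by (auto intro!: sum.mono_neutral_left simp: in_keys_iff)
  also have "\<dots> = (\<Sum>u\<in>S. \<Sum>v\<in>T.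
    single (u \<otimes>\<^bsub>M\<^esub> v) (lookup p u * lookup q v))"
    using assms by (intro sum.cong refl sum.mono_neutral_left) (auto simp: in_keys_iff)
  finally show ?thesis .
qed

lemma monoid_algebra_distrib_right:
  "(p + q) \<otimes>\<^bsub>monoid_algebra M\<^esub> r = p \<otimes>\<^bsub>monoid_algebra M\<^esub> r + q \<otimes>\<^bsub>monoid_algebra M\<^esub> r"
proof -
  let ?S = "keys p \<union> keys q"
  have "keys (p + q) \<subseteq> ?S" by (rule keys_add)
  then show ?thesis
    using monoid_algebra_mult_superset[of ?S "p + q" "keys r" r M]
      monoid_algebra_mult_superset[of ?S p "keys r" r M]
      monoid_algebra_mult_superset[of ?S q "keys r" r M]
    by (simp add: lookup_add distrib_right single_add sum.distrib)
qed

lemma monoid_algebra_distrib_left: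
  "r \<otimes>\<^bsub>monoid_algebra M\<^esub> (p + q) = r \<otimes>\<^bsub>monoid_algebra M\<^esub> p + r \<otimes>\<^bsub>monoid_algebra M\<^esub> q"
proof -
  let ?S = "keys p \<union> keys q"
  have "keys (p + q) \<subseteq> ?S" by (rule keys_add)
  then show ?thesis
    using monoid_algebra_mult_superset[of "keys r" r ?S "p + q" M]
      monoid_algebra_mult_superset[of "keys r" r ?S p M]
      monoid_algebra_mult_superset[of "keys r" r ?S q M]
    by (simp add: lookup_add distrib_left single_add sum.distrib)
qed

lemma monoid_algebra_mult_single [simp]:
  "single u a \<otimes>\<^bsub>monoid_algebra M\<^esub> single v b =
    single (u \<otimes>\<^bsub>M\<^esub> v) (a * b)"
  by (subst monoid_algebra_mult_superset[of "{u}" _ "{v}"]) auto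

lemma monoid_algebra_mult_zero [simp]:
  "0 \<otimes>\<^bsub>monoid_algebra M\<^esub> p = 0" "p \<otimes>\<^bsub>monoid_algebra M\<^esub> 0 = 0"
  by (simp_all add: monoid_algebra_def)

lemma map_times_add:
  "scal c (p + q) = scal c p + scal c q"
  by (rule poly_mapping_eqI) (simp add: lookup_add distrib_left)

lemma map_times_zero [simp]: "scal c 0 = 0"
  by (rule poly_mapping_eqI) simp

lemma map_times_minus:
  "scal c (p - q) = scal c p - scal c q"
  by (rule poly_mapping_eqI) (simp add: lookup_minus right_diff_distrib)

lemma map_times_single [simp]:
  "scal c (single u a) = single u (c * a)"
  by (rule poly_mapping_eqI) (simp add: lookup_single when_def)

lemma keys_map_times: "keys (scal c p) \<subseteq> keys p"
  by (auto simp: in_keys_iff)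

lemma monoid_algebra_mult_closed:
  assumes "monoid M" "keys p \<subseteq> carrier M" "keys q \<subseteq> carrier M"
  shows "keys (p \<otimes>\<^bsub>monoid_algebra M\<^esub> q) \<subseteq> carrier M"
proof -
  interpret M: monoid M by fact
  have sum_closed: "keys (\<Sum>x\<in>A. f x) \<subseteq> carrier M"
    if "\<And>x. x \<in> A \<Longrightarrow> keys (f x) \<subseteq> carrier M" for A and f :: "'c \<Rightarrow> 'a \<Rightarrow>\<^sub>0 complex"
    using that
  proof (induction A rule: infinite_finite_induct)
    case (insert x A)
    then have "keys (f x) \<union> keys (sum f A) \<subseteq> carrier M" by auto
    then have "keys (f x + sum f A) \<subseteq> carrier M" by (rule order_trans[OF keys_add])
    then show ?case using insert.hyps by simp
  qed auto
  show ?thesis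
    unfolding monoid_algebra_def monoid.simps partial_object.simps
    by (intro sum_closed) (use assms(2,3) in \<open>auto split: if_splits\<close>)
qed

theorem complex_algebra_monoid_algebra:
  assumes "monoid M"
  shows "complex_algebra (monoid_algebra M)"
proof -
  interpret M: monoid M by fact
  let ?A = "monoid_algebra M"
  have "abelian_group ?A"
  proof (rule abelian_groupI)
    fix p :: "'a \<Rightarrow>\<^sub>0 complex" assume "p \<in> carrier ?A"
    then show "\<exists>q\<in>carrier ?A. q \<oplus>\<^bsub>?A\<^esub> p = \<zero>\<^bsub>?A\<^esub>"
      by (intro bexI[of _ "- p"]) auto
  next
    fix p q :: "'a \<Rightarrow>\<^sub>0 complex" assume "p \<in> carrier ?A" "q \<in> carrier ?A"
    then show "p \<oplus>\<^bsub>?A\<^esub> q \<in> carrier ?A"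
      using keys_add[of p q] by auto
  qed (auto simp: add_ac)
  moreover have "monoid ?A"
  proof (rule monoidI)
    fix p q r :: "'a \<Rightarrow>\<^sub>0 complex" assume pqr: "p \<in> carrier ?A" "q \<in> carrier ?A" "r \<in> carrier ?A"
    show "p \<otimes>\<^bsub>?A\<^esub> q \<in> carrier ?A"
      using monoid_algebra_mult_closed[OF assms, of p q] pqr by simp
    from pqr have "keys p \<subseteq> carrier M" "keys q \<subseteq> carrier M"
      "keys r \<subseteq> carrier M" by auto
    then show "p \<otimes>\<^bsub>?A\<^esub> q \<otimes>\<^bsub>?A\<^esub> r = p \<otimes>\<^bsub>?A\<^esub> (q \<otimes>\<^bsub>?A\<^esub> r)"
    proof (induction p rule: poly_mapping_span_induct)
      case (single u c)
      from single(2) show ?case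
      proof (induction q rule: poly_mapping_span_induct)
        case s2: (single v d)
        from single(3) show ?case
        proof (induction r rule: poly_mapping_span_induct)
          case s3: (single w e)
          then show ?case using single(1) s2(1) by (simp add: M.m_assoc mult.assoc)
        qed (simp_all add: monoid_algebra_distrib_left)
      qed (simp_all add: monoid_algebra_distrib_left monoid_algebra_distrib_right)
    qed (simp_all add: monoid_algebra_distrib_left monoid_algebra_distrib_right)
  next
    fix p :: "'a \<Rightarrow>\<^sub>0 complex" assume "p \<in> carrier ?A"
    then have p: "keys p \<subseteq> carrier M" by simp
    then show "\<one>\<^bsub>?A\<^esub> \<otimes>\<^bsub>?A\<^esub> p = p"
      by (induction p rule: poly_mapping_span_induct) (simp_all add: monoid_algebra_distrib_left)
    from p show "p \<otimes>\<^bsub>?A\<^esub> \<one>\<^bsub>?A\<^esub> = p"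
      by (induction p rule: poly_mapping_span_induct) (simp_all add: monoid_algebra_distrib_right)
  qed simp
  ultimately have "ring ?A"
    by (rule ringI) (simp_all add: monoid_algebra_distrib_left monoid_algebra_distrib_right)
  moreover have "complex_space_axioms ?A"
    by unfold_locales
      (auto simp: map_times_add lookup_add distrib_right intro!: poly_mapping_eqI
        dest!: subsetD[OF keys_map_times])
  moreover have "complex_algebra_axioms ?A"
  proof
    fix p q c assume "p \<in> carrier ?A" "q \<in> carrier ?A"
    then have "keys p \<subseteq> carrier M" "keys q \<subseteq> carrier M" by auto
    then have "scal c p \<otimes>\<^bsub>?A\<^esub> q = scal c (p \<otimes>\<^bsub>?A\<^esub> q)
      \<and> p \<otimes>\<^bsub>?A\<^esub> scal c q = scal c (p \<otimes>\<^bsub>?A\<^esub> q)"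
    proof (induction p rule: poly_mapping_span_induct)
      case (single u a)
      from single(2) show ?case
        by (induction q rule: poly_mapping_span_induct)
          (simp_all add: monoid_algebra_distrib_left map_times_add, simp add: mult_ac)
    qed (simp_all add: monoid_algebra_distrib_right map_times_add)
    then show "c \<odot>\<^bsub>?A\<^esub> p \<otimes>\<^bsub>?A\<^esub> q = c \<odot>\<^bsub>?A\<^esub> (p \<otimes>\<^bsub>?A\<^esub> q)"
      "p \<otimes>\<^bsub>?A\<^esub> (c \<odot>\<^bsub>?A\<^esub> q) = c \<odot>\<^bsub>?A\<^esub> (p \<otimes>\<^bsub>?A\<^esub> q)" by simp_all
  qed
  ultimately show ?thesis
    by (simp add: complex_algebra_def complex_space_def ring.is_abelian_group)
qed

lemma complex_space_minus_monoid_algebra: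
  assumes "monoid M" "keys p \<subseteq> carrier M" "keys q \<subseteq> carrier M"
  shows "p \<ominus>\<^bsub>monoid_algebra M\<^esub> q = p - q"
proof -
  interpret A: complex_algebra "monoid_algebra M"
    using assms(1) by (rule complex_algebra_monoid_algebra)
  have "\<ominus>\<^bsub>monoid_algebra M\<^esub> q = - q"
    using assms(3) by (intro A.minus_equality) auto
  then show ?thesis by (simp add: a_minus_def)
qed

subsection \<open>Linear extension\<close>

context complex_space
begin

lemma lin_ext_superset:
  assumes "finite S" "keys p \<subseteq> S" "\<And>w. w \<in> S \<Longrightarrow> \<phi> w \<in> carrier V"
  shows "lin_ext V \<phi> p = (\<Oplus>w\<in>S. lookup p w \<odot> \<phi> w)"
  unfolding lin_ext_def
  by (rule add.finprod_mono_neutral_cong_left) (use assms in \<open>auto simp: in_keys_iff\<close>)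

lemma lin_ext_single [simp]:
  assumes "\<phi> w \<in> carrier V"
  shows "lin_ext V \<phi> (single w c) = c \<odot> \<phi> w"
  by (subst lin_ext_superset[of "{w}"]) (use assms in auto)

lemma lin_ext_closed:
  assumes "\<And>w. w \<in> keys p \<Longrightarrow> \<phi> w \<in> carrier V"
  shows "lin_ext V \<phi> p \<in> carrier V"
  unfolding lin_ext_def using assms by (intro finsum_closed) auto

lemma linear_map_lin_ext:
  assumes "monoid M" and \<phi>: "\<And>w. w \<in> carrier M \<Longrightarrow> \<phi> w \<in> carrier V"
  shows "linear_map (monoid_algebra M) V (lin_ext V \<phi>)"
proof -
  interpret A: complex_algebra "monoid_algebra M"
    using assms(1) by (rule complex_algebra_monoid_algebra)
  show ?thesis
  proof
    fix p assume "p \<in> carrier (monoid_algebra M)"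
    then show "lin_ext V \<phi> p \<in> carrier V" by (auto intro!: lin_ext_closed \<phi>)
  next
    fix p q assume p: "p \<in> carrier (monoid_algebra M)" and q: "q \<in> carrier (monoid_algebra M)"
    let ?S = "keys p \<union> keys q"
    have S: "finite ?S" "\<And>w. w \<in> ?S \<Longrightarrow> \<phi> w \<in> carrier V"
      using p q by (auto intro!: \<phi>)
    have "lin_ext V \<phi> (p + q) = (\<Oplus>w\<in>?S. lookup (p + q) w \<odot> \<phi> w)"
      using S keys_add[of p q] by (intro lin_ext_superset) auto
    also have "\<dots> = (\<Oplus>w\<in>?S. lookup p w \<odot> \<phi> w \<oplus> lookup q w \<odot> \<phi> w)"
      using S by (intro finsum_cong') (auto simp: lookup_add smult_add_left)
    also have "\<dots> = (\<Oplus>w\<in>?S. lookup p w \<odot> \<phi> w) \<oplus>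
        (\<Oplus>w\<in>?S. lookup q w \<odot> \<phi> w)"
      using S by (intro finsum_addf) auto
    also have "\<dots> = lin_ext V \<phi> p \<oplus> lin_ext V \<phi> q"
      using S lin_ext_superset[of ?S p \<phi>] lin_ext_superset[of ?S q \<phi>] by simp
    finally show "lin_ext V \<phi> (p \<oplus>\<^bsub>monoid_algebra M\<^esub> q) = lin_ext V \<phi> p \<oplus> lin_ext V \<phi> q" by simp
  next
    fix p c assume p: "p \<in> carrier (monoid_algebra M)"
    let ?S = "keys p"
    have S: "finite ?S" "\<And>w. w \<in> ?S \<Longrightarrow> \<phi> w \<in> carrier V"
      using p by (auto intro!: \<phi>)
    have "lin_ext V \<phi> (scal c p) =
        (\<Oplus>w\<in>?S. lookup (scal c p) w \<odot> \<phi> w)"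
      using S keys_map_times[of c p] by (intro lin_ext_superset) auto
    also have "\<dots> = (\<Oplus>w\<in>?S. c \<odot> (lookup p w \<odot> \<phi> w))"
      using S by (intro finsum_cong') (auto simp: smult_smult)
    also have "\<dots> = c \<odot> lin_ext V \<phi> p"
      unfolding lin_ext_def using S by (intro smult_finsum[symmetric]) auto
    finally show "lin_ext V \<phi> (c \<odot>\<^bsub>monoid_algebra M\<^esub> p) = c \<odot> lin_ext V \<phi> p" by simp
  qed
qed

end

lemma (in complex_algebra) lin_ext_mult:
  assumes "monoid M" and \<phi>: "\<And>w. w \<in> carrier M \<Longrightarrow> \<phi> w \<in> carrier V"
    and mult: "\<And>u v. \<lbrakk>u \<in> carrier M; v \<in> carrier M\<rbrakk> \<Longrightarrow> \<phi> (u \<otimes>\<^bsub>M\<^esub> v) = \<phi> u \<otimes> \<phi> v"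
    and p: "keys p \<subseteq> carrier M" and q: "keys q \<subseteq> carrier M"
  shows "lin_ext V \<phi> (p \<otimes>\<^bsub>monoid_algebra M\<^esub> q) = lin_ext V \<phi> p \<otimes> lin_ext V \<phi> q"
proof -
  interpret M: monoid M by fact
  interpret l: linear_map "monoid_algebra M" V "lin_ext V \<phi>"
    using assms(1,2) by (rule linear_map_lin_ext)
  have lin_add: "lin_ext V \<phi> (p + q) = lin_ext V \<phi> p \<oplus> lin_ext V \<phi> q"
    if "keys p \<subseteq> carrier M" "keys q \<subseteq> carrier M" for p q
    using l.map_add[of p q] that by simp
  have cl: "lin_ext V \<phi> p \<in> carrier V" if "keys p \<subseteq> carrier M" for p
    using l.map_closed[of p] that by simp
  have z: "lin_ext V \<phi> 0 = \<zero>" using l.map_zero by simp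
  note mc = monoid_algebra_mult_closed[OF assms(1)]
  show ?thesis using p q
  proof (induction p rule: poly_mapping_span_induct)
    case zero
    then show ?case by (simp add: z cl)
  next
    case (add p p')
    then show ?case by (simp add: monoid_algebra_distrib_right lin_add mc cl l_distr)
  next
    case (single u c)
    from single(2) show ?case
    proof (induction q rule: poly_mapping_span_induct)
      case zero
      then show ?case using single(1) by (simp add: z cl \<phi>)
    next
      case (add q q')
      then show ?case using single(1)
        by (simp add: monoid_algebra_distrib_left lin_add mc cl r_distr \<phi>)
    next
      case s2: (single v d)
      then show ?case using single(1)
        by (simp add: \<phi> mult smult_mult_left smult_mult_right smult_smult mult.commute)
    qed
  qed
qed

subsection \<open>Quotient algebras\<close>

lemma quotient_algebra_simps [simp]:
  "carrier (quotient_algebra R I) = carrier (R Quot I)"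
  "mult (quotient_algebra R I) = mult (R Quot I)"
  "one (quotient_algebra R I) = one (R Quot I)"
  "zero (quotient_algebra R I) = zero (R Quot I)"
  "add (quotient_algebra R I) = add (R Quot I)"
  "smult (quotient_algebra R I) = (\<lambda>c X. \<Union>x\<in>X. I +>\<^bsub>R\<^esub> (c \<odot>\<^bsub>R\<^esub> x))"
  by (simp_all add: quotient_algebra_def)

text \<open>\<open>R Quot I\<close> and \<open>quotient_algebra R I\<close> are records of different
  types with the same ring operations, so the ring axioms have to be carried over. The Hopf record
  needs the same transfer.\<close>

lemma ring_more_cong:
  assumes "ring R" "carrier S = carrier R" "mult S = mult R" "one S = one R"
    "zero S = zero R" "add S = add R"
  shows "ring S"
proof -
  interpret R: ring R by fact
  show ?thesis
  proof (rule ringI)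
    show "abelian_group S"
      by (rule abelian_groupI) (use assms R.l_neg in \<open>auto simp: R.a_assoc intro: R.a_comm\<close>)
    show "monoid S" by (rule monoidI) (use assms in \<open>auto simp: R.m_assoc\<close>)
  qed (use assms in \<open>auto simp: R.l_distr R.r_distr\<close>)
qed

locale algebra_ideal = R: complex_algebra R + ideal I R
    for I :: "'a set" and R :: "(complex, 'a, 'x) module_scheme" (structure)
begin

abbreviation Q where "Q \<equiv> quotient_algebra R I"

text \<open>Scaling by c is multiplication by c times the unit, so a ring ideal is automatically a
  subspace.\<close>

lemma ideal_smult: "x \<in> I \<Longrightarrow> c \<odot> x \<in> I"
  using R.smult_mult_left[of \<one> x c] I_l_closed[of x "c \<odot> \<one>"] a_Hcarr[of x] by simp

lemma carrier_quotient: "carrier Q = (\<lambda>x. I +> x) ` carrier R"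
  by (auto simp: FactRing_simps)

lemma coset_eq_iff:
  "\<lbrakk>x \<in> carrier R; y \<in> carrier R\<rbrakk> \<Longrightarrow> I +> x = I +> y \<longleftrightarrow> x \<ominus> y \<in> I"
  using R.quotient_eq_iff_same_a_r_cos[OF ideal_axioms] by simp

text \<open>The scalar action is a union over all representatives. All members of the union are the
  same coset and the index set is nonempty, so it collapses.\<close>

lemma smult_coset:
  assumes "x \<in> carrier R"
  shows "c \<odot>\<^bsub>Q\<^esub> (I +> x) = I +> (c \<odot> x)"
proof -
  have "I +> (c \<odot> y) = I +> (c \<odot> x)" if y: "y \<in> I +> x" for y
  proof -
    obtain h where h: "h \<in> I" "y = h \<oplus> x" using y by (auto simp: a_r_coset_def r_coset_def)
    then have hc: "h \<in> carrier R" by (simp add: a_Hcarr)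
    have "c \<odot> y = c \<odot> h \<oplus> c \<odot> x" using h hc assms by (simp add: R.smult_add_right)
    then have "c \<odot> y \<in> I +> (c \<odot> x)"
      using ideal_smult[OF h(1)] by (auto simp: a_r_coset_def r_coset_def)
    then show ?thesis
      using assms by (intro a_repr_independence'[symmetric]) auto
  qed
  then have "(\<Union>y\<in>I +> x. I +> (c \<odot> y)) = (\<Union>y\<in>I +> x. I +> (c \<odot> x))"
    by (rule SUP_cong[OF refl])
  moreover have "I +> x \<noteq> {}" using assms a_rcos_self by blast
  ultimately show ?thesis by (simp only: quotient_algebra_simps UN_constant if_False)
qed

lemma add_coset:
  "\<lbrakk>x \<in> carrier R; y \<in> carrier R\<rbrakk> \<Longrightarrow> (I +> x) \<oplus>\<^bsub>Q\<^esub> (I +> y) = I +> (x \<oplus> y)"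
  by (simp add: FactRing_def a_rcos_sum)

lemma mult_coset:
  "\<lbrakk>x \<in> carrier R; y \<in> carrier R\<rbrakk> \<Longrightarrow> (I +> x) \<otimes>\<^bsub>Q\<^esub> (I +> y) = I +> (x \<otimes> y)"
  by (simp add: FactRing_def rcoset_mult_add)

lemma one_coset: "\<one>\<^bsub>Q\<^esub> = I +> \<one>"
  by (simp add: FactRing_def)

sublocale quotient: complex_algebra Q
proof -
  have ring: "ring Q"
    by (rule ring_more_cong[OF quotient_is_ring]) simp_all
  moreover have "complex_space_axioms Q"
    by unfold_locales
      (auto simp: carrier_quotient smult_coset add_coset R.smult_add_left R.smult_add_right
        R.smult_smult simp del: quotient_algebra_simps)
  moreover have "complex_algebra_axioms Q"
    by unfold_locales
      (auto simp: carrier_quotient smult_coset mult_coset R.smult_mult_left R.smult_mult_right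
        simp del: quotient_algebra_simps)
  ultimately show "complex_algebra Q"
    by (simp add: complex_algebra_def complex_space_def ring.is_abelian_group)
qed

lemma linear_map_coset: "linear_map R Q (\<lambda>x. I +> x)"
  by unfold_locales
    (auto simp: carrier_quotient smult_coset add_coset simp del: quotient_algebra_simps)

lemma descend_coset:
  assumes f: "linear_map R W f" and ker: "\<And>x. x \<in> I \<Longrightarrow> f x = \<zero>\<^bsub>W\<^esub>" and x: "x \<in> carrier R"
  shows "descend f (I +> x) = f x"
proof -
  interpret f: linear_map R W f by fact
  have "f y = f x" if y: "y \<in> I +> x" for y
  proof -
    obtain h where h: "h \<in> I" "y = h \<oplus> x" using y by (auto simp: a_r_coset_def r_coset_def)
    then have hc: "h \<in> carrier R" by (simp add: a_Hcarr)
    then show ?thesis using h x ker[OF h(1)] by (simp add: f.map_add)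
  qed
  moreover have "x \<in> I +> x" using x a_rcos_self by blast
  ultimately have "f ` (I +> x) = {f x}" by blast
  then show ?thesis by (simp add: descend_def)
qed

lemma linear_map_descend:
  assumes f: "linear_map R W f" and ker: "\<And>x. x \<in> I \<Longrightarrow> f x = \<zero>\<^bsub>W\<^esub>"
  shows "linear_map Q W (descend f)"
proof -
  interpret f: linear_map R W f by fact
  note desc = descend_coset[OF f ker]
  show ?thesis
  proof
    fix X assume "X \<in> carrier Q"
    then obtain x where x: "X = I +> x" "x \<in> carrier R" unfolding carrier_quotient by auto
    then show "descend f X \<in> carrier W" by (simp add: desc)
    fix c
    show "descend f (c \<odot>\<^bsub>Q\<^esub> X) = c \<odot>\<^bsub>W\<^esub> descend f X"
      unfolding x(1) smult_coset[OF x(2)] using x(2) by (simp add: desc f.map_smult)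
    fix Y assume "Y \<in> carrier Q"
    then obtain y where y: "Y = I +> y" "y \<in> carrier R" unfolding carrier_quotient by auto
    then show "descend f (X \<oplus>\<^bsub>Q\<^esub> Y) = descend f X \<oplus>\<^bsub>W\<^esub> descend f Y"
      unfolding x(1) y(1) add_coset[OF x(2) y(2)] using x(2) y(2) by (simp add: desc f.map_add)
  qed
qed

end

section \<open>Tensor powers of an algebra\<close>

abbreviation tuple_monoid ::
    "(complex, 'a, 'x) module_scheme \<Rightarrow> nat \<Rightarrow> 'a list monoid" where
  "tuple_monoid H n \<equiv>
    \<lparr>carrier = {w. length w = n \<and> set w \<subseteq> carrier H}, mult = map2 (mult H),
     one = replicate n \<one>\<^bsub>H\<^esub>\<rparr>"

lemma monoid_algebra_mult_diff:
  "(p - q) \<otimes>\<^bsub>monoid_algebra M\<^esub> r = p \<otimes>\<^bsub>monoid_algebra M\<^esub> r - q \<otimes>\<^bsub>monoid_algebra M\<^esub> r"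
  "r \<otimes>\<^bsub>monoid_algebra M\<^esub> (p - q) = r \<otimes>\<^bsub>monoid_algebra M\<^esub> p - r \<otimes>\<^bsub>monoid_algebra M\<^esub> q"
  using monoid_algebra_distrib_right[where p = "p - q" and q = q and M = M and r = r]
    monoid_algebra_distrib_left[where p = "p - q" and q = q and M = M and r = r]
  by (simp_all add: algebra_simps)

lemma null_tensors_single:
  "mon w - mon w' - mon w'' \<in> null_tensors H n \<Longrightarrow>
    single w c - single w' c - single w'' c \<in> null_tensors H n"
  using null_tensors.scale[of "mon w - mon w' - mon w''" H n c] by (simp add: map_times_minus)

lemma null_tensors_single2:
  "mon w - single w' d \<in> null_tensors H n \<Longrightarrow>
    single w c - single w' (c * d) \<in> null_tensors H n"
  using null_tensors.scale[of "mon w - single w' d" H n c] by (simp add: map_times_minus)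

lemma null_tensors_minus: "p \<in> null_tensors H n \<Longrightarrow> - p \<in> null_tensors H n"
proof -
  assume p: "p \<in> null_tensors H n"
  have "- p = scal (- 1) p" by (rule poly_mapping_eqI) simp
  then show ?thesis using null_tensors.scale[OF p, of "- 1"] by simp
qed

lemma formal_tensors_simps:
  "formal_tensors H n = monoid_algebra (tuple_monoid H n)"
  by (simp add: formal_tensors_def)

lemma split_at_length:
  assumes "length w = Suc (length u + length v)"
  obtains u' x v' where "w = u' @ x # v'" "length u' = length u" "length v' = length v"
proof (rule that[of "take (length u) w" "w ! length u" "drop (Suc (length u)) w"])
  show "w = take (length u) w @ w ! length u # drop (Suc (length u)) w"
    using assms by (intro id_take_nth_drop) simp
qed (use assms in auto)

lemma null_tensors_more_mono:
  assumes "carrier H = carrier K" "add H = add K" "smult H = smult K"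
  shows "null_tensors H n \<subseteq> null_tensors K n"
proof
  show "p \<in> null_tensors H n \<Longrightarrow> p \<in> null_tensors K n" for p
    by (induction rule: null_tensors.induct) (auto intro: null_tensors.intros simp: assms)
qed

lemma null_tensors_more_cong:
  assumes "carrier H = carrier K" "add H = add K" "smult H = smult K"
  shows "null_tensors H n = null_tensors K n"
  using assms by (intro equalityI null_tensors_more_mono) simp_all

lemma tensor_power_more_cong:
  assumes "carrier H = carrier K" "add H = add K" "smult H = smult K" "mult H = mult K" "one H = one K"
  shows "tensor_power H n = tensor_power K n" "tensor_class H n = tensor_class K n"
    "pure_tensor H = pure_tensor K"
proof -
  have "formal_tensors H n = formal_tensors K n" for n
    by (simp add: formal_tensors_def assms)
  then show "tensor_power H n = tensor_power K n" "tensor_class H n = tensor_class K n"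
    "pure_tensor H = pure_tensor K"
    using null_tensors_more_cong[OF assms(1-3)]
    by (auto simp: tensor_power_def tensor_class_def pure_tensor_def fun_eq_iff)
qed

text \<open>A slot is addressed by splitting the tuple as u, a, v. This is the shape in which the
  generators of \<open>null_tensors\<close> are given, so a multilinear map kills them
  directly.\<close>

definition multilinear ::
    "(complex, 'a, 'x) module_scheme \<Rightarrow> nat \<Rightarrow> (complex, 'b, 'y) module_scheme \<Rightarrow>
      ('a list \<Rightarrow> 'b) \<Rightarrow> bool" where
  "multilinear H n W \<phi> \<longleftrightarrow>
    (\<forall>w. length w = n \<longrightarrow> set w \<subseteq> carrier H \<longrightarrow> \<phi> w \<in> carrier W) \<and>
    (\<forall>u v a b. set u \<subseteq> carrier H \<longrightarrow> set v \<subseteq> carrier H \<longrightarrow> length u + 1 + length v = n \<longrightarrow>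
      a \<in> carrier H \<longrightarrow> b \<in> carrier H \<longrightarrow>
      \<phi> (u @ (a \<oplus>\<^bsub>H\<^esub> b) # v) = \<phi> (u @ a # v) \<oplus>\<^bsub>W\<^esub> \<phi> (u @ b # v)) \<and>
    (\<forall>u v a c. set u \<subseteq> carrier H \<longrightarrow> set v \<subseteq> carrier H \<longrightarrow> length u + 1 + length v = n \<longrightarrow>
      a \<in> carrier H \<longrightarrow> \<phi> (u @ (c \<odot>\<^bsub>H\<^esub> a) # v) = c \<odot>\<^bsub>W\<^esub> \<phi> (u @ a # v))"

context complex_algebra
begin

lemma monoid_tuple_monoid: "monoid (tuple_monoid V n)"
proof (rule monoidI)
  fix x y z assume "x \<in> carrier (tuple_monoid V n)" "y \<in> carrier (tuple_monoid V n)"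
    "z \<in> carrier (tuple_monoid V n)"
  then show "x \<otimes>\<^bsub>tuple_monoid V n\<^esub> y \<otimes>\<^bsub>tuple_monoid V n\<^esub> z =
      x \<otimes>\<^bsub>tuple_monoid V n\<^esub> (y \<otimes>\<^bsub>tuple_monoid V n\<^esub> z)"
    by (auto intro!: nth_equalityI m_assoc simp: subset_iff)
next
  fix x y assume "x \<in> carrier (tuple_monoid V n)" "y \<in> carrier (tuple_monoid V n)"
  then show "x \<otimes>\<^bsub>tuple_monoid V n\<^esub> y \<in> carrier (tuple_monoid V n)"
    by (auto dest: set_zip_leftD set_zip_rightD)
next
  fix x assume x: "x \<in> carrier (tuple_monoid V n)"
  show "\<one>\<^bsub>tuple_monoid V n\<^esub> \<otimes>\<^bsub>tuple_monoid V n\<^esub> x = x"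
    using x by (auto intro!: nth_equalityI simp: subset_iff)
  show "x \<otimes>\<^bsub>tuple_monoid V n\<^esub> \<one>\<^bsub>tuple_monoid V n\<^esub> = x"
    using x by (auto intro!: nth_equalityI simp: subset_iff)
qed auto

lemma complex_algebra_formal_tensors: "complex_algebra (formal_tensors V n)"
  unfolding formal_tensors_simps
  by (rule complex_algebra_monoid_algebra) (rule monoid_tuple_monoid)

lemma carrier_formal_tensors:
  "carrier (formal_tensors V n) =
    {p. keys p \<subseteq> {w. length w = n \<and> set w \<subseteq> carrier V}}"
  by (simp add: formal_tensors_simps)

lemma null_tensors_keys:
  "p \<in> null_tensors V n \<Longrightarrow> keys p \<subseteq> {w. length w = n \<and> set w \<subseteq> carrier V}"
proof (induction rule: null_tensors.induct)
  case (plus p q)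
  then show ?case using keys_add[of p q] by blast
next
  case (scale p c)
  then show ?case using keys_map_times[of c p] by blast
next
  case (additive u v a b)
  then have "keys (mon (u @ (a \<oplus> b) # v) - mon (u @ a # v) - mon (u @ b # v)) \<subseteq>
      {u @ (a \<oplus> b) # v, u @ a # v, u @ b # v}"
    by (intro order_trans[OF keys_diff]) (auto dest!: subsetD[OF keys_diff])
  moreover have "{u @ (a \<oplus> b) # v, u @ a # v, u @ b # v} \<subseteq> {w. length w = n \<and> set w \<subseteq> carrier V}"
    using additive by auto
  ultimately show ?case by (rule order_trans)
next
  case (homogeneous u v a c)
  then have "keys (mon (u @ (c \<odot> a) # v) - single (u @ a # v) c) \<subseteq>
      {u @ (c \<odot> a) # v, u @ a # v}"
    by (intro order_trans[OF keys_diff]) (auto split: if_splits)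
  moreover have "{u @ (c \<odot> a) # v, u @ a # v} \<subseteq> {w. length w = n \<and> set w \<subseteq> carrier V}"
    using homogeneous by auto
  ultimately show ?case by (rule order_trans)
qed auto

lemma formal_tensors_single:
  "\<lbrakk>length w = n; set w \<subseteq> carrier V\<rbrakk> \<Longrightarrow> single w c \<in> carrier (formal_tensors V n)"
  by (simp add: carrier_formal_tensors)

lemma null_tensors_carrier: "p \<in> null_tensors V n \<Longrightarrow> p \<in> carrier (formal_tensors V n)"
  using null_tensors_keys by (simp add: carrier_formal_tensors)

text \<open>Multiplying by a tuple acts slot by slot, and multiplication by a fixed x is linear in
  the distinguished slot. A generating relation therefore goes to a relation of the same shape, up
  to the scalar d. This is the core of \<open>null_tensors\<close> being an ideal.\<close>

lemma null_tensors_mult_single: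
  assumes "p \<in> null_tensors V n" "length w = n" "set w \<subseteq> carrier V"
  shows "p \<otimes>\<^bsub>formal_tensors V n\<^esub> single w d \<in> null_tensors V n"
    and "single w d \<otimes>\<^bsub>formal_tensors V n\<^esub> p \<in> null_tensors V n"
proof -
  interpret A: complex_algebra "formal_tensors V n" by (rule complex_algebra_formal_tensors)
  have map2_closed: "set (map2 (\<otimes>) u u') \<subseteq> carrier V"
    if "set u \<subseteq> carrier V" "set u' \<subseteq> carrier V" for u u'
    using that by (auto dest: set_zip_leftD set_zip_rightD)
  have w: "single w d \<in> carrier (formal_tensors V n)"
    using assms(2,3) by (auto simp: carrier_formal_tensors)
  have "p \<otimes>\<^bsub>formal_tensors V n\<^esub> single w d \<in> null_tensors V n \<and>
      single w d \<otimes>\<^bsub>formal_tensors V n\<^esub> p \<in> null_tensors V n"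
    using assms(1)
  proof (induction rule: null_tensors.induct)
    case zero
    then show ?case by (simp add: formal_tensors_simps null_tensors.zero)
  next
    case (plus p q)
    then show ?case
      by (simp add: formal_tensors_simps monoid_algebra_distrib_left monoid_algebra_distrib_right
          null_tensors.plus)
  next
    case (scale p c)
    have p: "p \<in> carrier (formal_tensors V n)"
      using null_tensors_keys[OF scale(1)] by (simp add: carrier_formal_tensors)
    have smult: "c \<odot>\<^bsub>formal_tensors V n\<^esub> q = scal c q" for q
      by (simp add: formal_tensors_simps)
    show ?case
      using A.smult_mult_left[OF p w, of c] A.smult_mult_right[OF w p, of c] scale(2)
      by (simp add: smult null_tensors.scale)
  next
    case (additive u v a b)
    obtain u' x v' where w': "w = u' @ x # v'" "length u' = length u" "length v' = length v"
      using assms(2) additive by (metis Suc_eq_plus1 add.commute add_Suc_right split_at_length)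
    have "mon (map2 (\<otimes>) u u' @ (a \<otimes> x \<oplus> b \<otimes> x) # map2 (\<otimes>) v v') -
        mon (map2 (\<otimes>) u u' @ (a \<otimes> x) # map2 (\<otimes>) v v') -
        mon (map2 (\<otimes>) u u' @ (b \<otimes> x) # map2 (\<otimes>) v v') \<in> null_tensors V n"
      using additive assms(3) w' by (intro null_tensors.additive map2_closed) auto
    moreover have "mon (map2 (\<otimes>) u' u @ (x \<otimes> a \<oplus> x \<otimes> b) # map2 (\<otimes>) v' v) -
        mon (map2 (\<otimes>) u' u @ (x \<otimes> a) # map2 (\<otimes>) v' v) -
        mon (map2 (\<otimes>) u' u @ (x \<otimes> b) # map2 (\<otimes>) v' v) \<in> null_tensors V n"
      using additive assms(3) w' by (intro null_tensors.additive map2_closed) auto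
    ultimately show ?case
      using additive assms(3) w'
      by (auto simp: formal_tensors_simps monoid_algebra_mult_diff l_distr r_distr
          intro!: null_tensors_single)
  next
    case (homogeneous u v a c)
    obtain u' x v' where w': "w = u' @ x # v'" "length u' = length u" "length v' = length v"
      using assms(2) homogeneous by (metis Suc_eq_plus1 add.commute add_Suc_right split_at_length)
    have "mon (map2 (\<otimes>) u u' @ (c \<odot> (a \<otimes> x)) # map2 (\<otimes>) v v') -
        single (map2 (\<otimes>) u u' @ (a \<otimes> x) # map2 (\<otimes>) v v') c \<in> null_tensors V n"
      using homogeneous assms(3) w' by (intro null_tensors.homogeneous map2_closed) auto
    moreover have "mon (map2 (\<otimes>) u' u @ (c \<odot> (x \<otimes> a)) # map2 (\<otimes>) v' v) -
        single (map2 (\<otimes>) u' u @ (x \<otimes> a) # map2 (\<otimes>) v' v) c \<in> null_tensors V n"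
      using homogeneous assms(3) w' by (intro null_tensors.homogeneous map2_closed) auto
    ultimately show ?case
      using homogeneous assms(3) w' null_tensors_single2[where c = d and d = c]
      by (auto simp: formal_tensors_simps monoid_algebra_mult_diff smult_mult_left smult_mult_right
          mult.commute[of c d])
  qed
  then show "p \<otimes>\<^bsub>formal_tensors V n\<^esub> single w d \<in> null_tensors V n"
    and "single w d \<otimes>\<^bsub>formal_tensors V n\<^esub> p \<in> null_tensors V n" by auto
qed

lemma algebra_ideal_null_tensors: "algebra_ideal (null_tensors V n) (formal_tensors V n)"
proof -
  interpret A: complex_algebra "formal_tensors V n" by (rule complex_algebra_formal_tensors)
  have "ideal (null_tensors V n) (formal_tensors V n)"
  proof (rule idealI[OF A.ring_axioms])
    show "subgroup (null_tensors V n) (add_monoid (formal_tensors V n))"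
    proof (rule A.add.subgroupI)
      fix p assume p: "p \<in> null_tensors V n"
      have "\<ominus>\<^bsub>formal_tensors V n\<^esub> p = - p"
        using null_tensors_carrier[OF p] by (intro A.minus_equality) (auto simp: formal_tensors_simps)
      then show "\<ominus>\<^bsub>formal_tensors V n\<^esub> p \<in> null_tensors V n"
        using null_tensors_minus[OF p] by simp
    next
      fix p q assume "p \<in> null_tensors V n" "q \<in> null_tensors V n"
      then show "p \<oplus>\<^bsub>formal_tensors V n\<^esub> q \<in> null_tensors V n"
        by (simp add: formal_tensors_simps null_tensors.plus)
    qed (use null_tensors.zero[of V n] null_tensors_carrier[of _ n] in auto)
  next
    fix p q assume p: "p \<in> null_tensors V n" and q: "q \<in> carrier (formal_tensors V n)"
    from q have "keys q \<subseteq> {w. length w = n \<and> set w \<subseteq> carrier V}"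
      by (simp add: carrier_formal_tensors)
    then have "q \<otimes>\<^bsub>formal_tensors V n\<^esub> p \<in> null_tensors V n \<and>
        p \<otimes>\<^bsub>formal_tensors V n\<^esub> q \<in> null_tensors V n"
    proof (induction q rule: poly_mapping_span_induct)
      case zero
      show ?case by (simp add: formal_tensors_simps null_tensors.zero)
    next
      case (add q q')
      then show ?case
        by (simp add: formal_tensors_simps monoid_algebra_distrib_left monoid_algebra_distrib_right
            null_tensors.plus)
    next
      case (single w c)
      then show ?case using null_tensors_mult_single[OF p, of w c] by auto
    qed
    then show "q \<otimes>\<^bsub>formal_tensors V n\<^esub> p \<in> null_tensors V n"
      "p \<otimes>\<^bsub>formal_tensors V n\<^esub> q \<in> null_tensors V n" by auto
  qed
  then show ?thesis by (simp add: algebra_ideal_def A.complex_algebra_axioms)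
qed

context
  fixes n :: nat
begin

interpretation T: algebra_ideal "null_tensors V n" "formal_tensors V n"
  by (rule algebra_ideal_null_tensors)

lemma complex_algebra_tensor_power: "complex_algebra (tensor_power V n)"
  unfolding tensor_power_def by (rule T.quotient.complex_algebra_axioms)

lemma linear_map_tensor_class: "linear_map (formal_tensors V n) (tensor_power V n) (tensor_class V n)"
  unfolding tensor_power_def tensor_class_def by (rule T.linear_map_coset)

lemma tensor_class_mult:
  assumes "p \<in> carrier (formal_tensors V n)" "q \<in> carrier (formal_tensors V n)"
  shows "tensor_class V n p \<otimes>\<^bsub>tensor_power V n\<^esub> tensor_class V n q =
    tensor_class V n (p \<otimes>\<^bsub>formal_tensors V n\<^esub> q)"
  unfolding tensor_power_def tensor_class_def using assms by (rule T.mult_coset)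

lemma tensor_class_eqI:
  assumes "p \<in> carrier (formal_tensors V n)" "q \<in> carrier (formal_tensors V n)"
    "p - q \<in> null_tensors V n"
  shows "tensor_class V n p = tensor_class V n q"
proof -
  have "p \<ominus>\<^bsub>formal_tensors V n\<^esub> q = p - q"
    using complex_space_minus_monoid_algebra[OF monoid_tuple_monoid, of p n q] assms(1,2)
    by (simp add: formal_tensors_simps)
  then show ?thesis
    unfolding tensor_class_def using T.coset_eq_iff[OF assms(1,2)] assms(3) by simp
qed

lemma carrier_tensor_power:
  "carrier (tensor_power V n) = tensor_class V n ` carrier (formal_tensors V n)"
  unfolding tensor_power_def tensor_class_def by (rule T.carrier_quotient)

lemma one_tensor_power: "\<one>\<^bsub>tensor_power V n\<^esub> = pure_tensor V (replicate n \<one>)"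
  unfolding tensor_power_def pure_tensor_def tensor_class_def T.one_coset
  by (simp add: formal_tensors_simps)

end

lemma pure_tensor_closed [intro]:
  "\<lbrakk>length w = n; set w \<subseteq> carrier V\<rbrakk> \<Longrightarrow> pure_tensor V w \<in> carrier (tensor_power V n)"
  by (auto simp: pure_tensor_def carrier_tensor_power carrier_formal_tensors)

lemma pure_tensor_mult:
  assumes "length u = n" "length v = n" "set u \<subseteq> carrier V" "set v \<subseteq> carrier V"
  shows "pure_tensor V u \<otimes>\<^bsub>tensor_power V n\<^esub> pure_tensor V v = pure_tensor V (map2 (\<otimes>) u v)"
  using assms tensor_class_mult[of "mon u" n "mon v"]
  by (simp add: pure_tensor_def carrier_formal_tensors) (simp add: formal_tensors_simps)

lemma multilinear_pure_tensor: "multilinear V n (tensor_power V n) (pure_tensor V)"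
proof -
  interpret c: linear_map "formal_tensors V n" "tensor_power V n" "tensor_class V n"
    by (rule linear_map_tensor_class)
  note single = formal_tensors_single
  have "pure_tensor V (u @ (a \<oplus> b) # v) =
      pure_tensor V (u @ a # v) \<oplus>\<^bsub>tensor_power V n\<^esub> pure_tensor V (u @ b # v)"
    if A: "set u \<subseteq> carrier V" "set v \<subseteq> carrier V" "length u + 1 + length v = n"
      "a \<in> carrier V" "b \<in> carrier V" for u v a b
  proof -
    have len: "length (u @ a # v) = n" "length (u @ b # v) = n" "length (u @ (a \<oplus> b) # v) = n"
      using A(3) by auto
    have sum: "mon (u @ a # v) \<oplus>\<^bsub>formal_tensors V n\<^esub> mon (u @ b # v) = mon (u @ a # v) + mon (u @ b # v)"
      by (simp add: formal_tensors_simps)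
    have "tensor_class V n (mon (u @ (a \<oplus> b) # v)) =
        tensor_class V n (mon (u @ a # v) + mon (u @ b # v))"
      unfolding sum[symmetric]
      by (rule tensor_class_eqI, rule single, use A in simp, use A in simp,
          rule c.V.a_closed; (rule single)?; (unfold sum)?)
        (use A null_tensors.additive[OF A] in \<open>simp_all add: algebra_simps\<close>)
    then show ?thesis
      using c.map_add[OF single single, of "u @ a # v" "u @ b # v" 1 1] A len
      unfolding pure_tensor_def len sum by simp
  qed
  moreover have "pure_tensor V (u @ (c \<odot> a) # v) = c \<odot>\<^bsub>tensor_power V n\<^esub> pure_tensor V (u @ a # v)"
    if A: "set u \<subseteq> carrier V" "set v \<subseteq> carrier V" "length u + 1 + length v = n"
      "a \<in> carrier V" for u v a c
  proof -
    have len: "length (u @ a # v) = n" "length (u @ (c \<odot> a) # v) = n"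
      using A(3) by auto
    have "tensor_class V n (mon (u @ (c \<odot> a) # v)) =
        tensor_class V n (single (u @ a # v) c)"
      using A null_tensors.homogeneous[OF A, of c] by (intro tensor_class_eqI single) auto
    moreover have "c \<odot>\<^bsub>formal_tensors V n\<^esub> mon (u @ a # v) = single (u @ a # v) c"
      by (simp add: formal_tensors_simps)
    ultimately show ?thesis
      using c.map_smult[OF single, of "u @ a # v" c 1] A len
      unfolding pure_tensor_def len by simp
  qed
  ultimately show ?thesis unfolding multilinear_def by blast
qed

lemma multilinear_lin_ext_null:
  assumes W: "complex_space W" and \<phi>: "multilinear V n W \<phi>" and p: "p \<in> null_tensors V n"
  shows "lin_ext W \<phi> p = \<zero>\<^bsub>W\<^esub>"
proof -
  interpret W: complex_space W by fact
  interpret l: linear_map "formal_tensors V n" W "lin_ext W \<phi>"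
    unfolding formal_tensors_simps
    by (rule W.linear_map_lin_ext[OF monoid_tuple_monoid]) (use \<phi> in \<open>simp add: multilinear_def\<close>)
  have cl: "\<phi> w \<in> carrier W" if "length w = n" "set w \<subseteq> carrier V" for w
    using \<phi> that by (simp add: multilinear_def)
  note car = null_tensors_carrier
  have diff: "lin_ext W \<phi> (q - r) = lin_ext W \<phi> q \<ominus>\<^bsub>W\<^esub> lin_ext W \<phi> r"
    if "q \<in> carrier (formal_tensors V n)" "r \<in> carrier (formal_tensors V n)" for q r
    using l.map_minus[OF that] complex_space_minus_monoid_algebra[OF monoid_tuple_monoid, of q n r] that
    by (simp add: formal_tensors_simps)
  have diff_carrier: "q - r \<in> carrier (formal_tensors V n)"
    if "q \<in> carrier (formal_tensors V n)" "r \<in> carrier (formal_tensors V n)" for q r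
    using that order_trans[OF keys_diff[of q r]] by (simp add: carrier_formal_tensors)
  note single = formal_tensors_single
  show ?thesis using p
  proof (induction rule: null_tensors.induct)
    case zero
    then show ?case using l.map_zero by (simp add: formal_tensors_simps)
  next
    case (plus p q)
    then show ?case using l.map_add[OF car car, of p q] by (simp add: formal_tensors_simps)
  next
    case (scale p c)
    then show ?case using l.map_smult[OF car, of p c] by (simp add: formal_tensors_simps)
  next
    case (additive u v a b)
    have "\<phi> (u @ (a \<oplus> b) # v) = \<phi> (u @ a # v) \<oplus>\<^bsub>W\<^esub> \<phi> (u @ b # v)"
      using \<phi> additive by (simp add: multilinear_def)
    moreover have "x \<oplus>\<^bsub>W\<^esub> y \<ominus>\<^bsub>W\<^esub> x \<ominus>\<^bsub>W\<^esub> y = \<zero>\<^bsub>W\<^esub>" if "x \<in> carrier W" "y \<in> carrier W" for x y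
      using that W.r_neg[of "x \<oplus>\<^bsub>W\<^esub> y"] by (simp add: a_minus_def W.minus_add W.a_assoc)
    ultimately show ?case
      using additive by (simp add: diff diff_carrier single cl)
  next
    case (homogeneous u v a c)
    have "\<phi> (u @ (c \<odot> a) # v) = c \<odot>\<^bsub>W\<^esub> \<phi> (u @ a # v)"
      using \<phi> homogeneous by (simp add: multilinear_def)
    then show ?case
      using homogeneous by (simp add: diff single cl a_minus_def W.r_neg)
  qed
qed

text \<open>The universal property of the tensor power.\<close>

lemma
  assumes W: "complex_space W" and \<phi>: "multilinear V n W \<phi>"
  shows linear_map_descend_multilinear: "linear_map (tensor_power V n) W (descend (lin_ext W \<phi>))"
    and descend_multilinear_pure: "\<lbrakk>length w = n; set w \<subseteq> carrier V\<rbrakk> \<Longrightarrow>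
      descend (lin_ext W \<phi>) (pure_tensor V w) = \<phi> w"
proof -
  interpret W: complex_space W by fact
  interpret T: algebra_ideal "null_tensors V n" "formal_tensors V n"
    by (rule algebra_ideal_null_tensors)
  have l: "linear_map (formal_tensors V n) W (lin_ext W \<phi>)"
    unfolding formal_tensors_simps
    by (rule W.linear_map_lin_ext[OF monoid_tuple_monoid]) (use \<phi> in \<open>simp add: multilinear_def\<close>)
  note ker = multilinear_lin_ext_null[OF W \<phi>]
  show "linear_map (tensor_power V n) W (descend (lin_ext W \<phi>))"
    unfolding tensor_power_def by (rule T.linear_map_descend[OF l ker])
  assume w: "length w = n" "set w \<subseteq> carrier V"
  then have "mon w \<in> carrier (formal_tensors V n)" by (simp add: carrier_formal_tensors)
  from T.descend_coset[OF l ker this]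
  show "descend (lin_ext W \<phi>) (pure_tensor V w) = \<phi> w"
    using w \<phi> by (simp add: pure_tensor_def tensor_class_def multilinear_def)
qed

lemma multilinear_list_mult: "multilinear V n V (list_mult V)"
  unfolding multilinear_def
  by (auto simp: list_mult_append l_distr r_distr smult_mult_left smult_mult_right)

end

section \<open>Iterated comultiplication\<close>

abbreviation "FA \<equiv> free_algebra"

abbreviation free_mult (infixl \<open>\<bullet>\<close> 70) where
  "p \<bullet> q \<equiv> p \<otimes>\<^bsub>free_algebra\<^esub> q"

lemma free_algebra_eq: "free_algebra = monoid_algebra \<lparr>carrier = UNIV, mult = (@), one = []\<rparr>"
  by (simp add: free_algebra_def)

lemma monoid_lists: "monoid \<lparr>carrier = UNIV, mult = (@), one = []\<rparr>"
  by (rule monoidI) auto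

lemma complex_algebra_free_algebra: "complex_algebra free_algebra"
  unfolding free_algebra_eq by (rule complex_algebra_monoid_algebra[OF monoid_lists])

lemma free_algebra_simps [simp]:
  "carrier free_algebra = UNIV" "add free_algebra = (+)" "zero free_algebra = 0"
  "one free_algebra = mon []" "smult free_algebra = scal"
  "single u a \<bullet> single v b = single (u @ v) (a * b)"
  by (simp_all add: free_algebra_eq)

lemma free_algebra_mult_distrib:
  "(p + q) \<bullet> r = p \<bullet> r + q \<bullet> r"
  "r \<bullet> (p + q) = r \<bullet> p + r \<bullet> q"
  "(p - q) \<bullet> r = p \<bullet> r - q \<bullet> r"
  "r \<bullet> (p - q) = r \<bullet> p - r \<bullet> q"
  "0 \<bullet> r = 0" "r \<bullet> 0 = 0"
  unfolding free_algebra_eq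
  by (rule monoid_algebra_distrib_right monoid_algebra_distrib_left monoid_algebra_mult_diff
      monoid_algebra_mult_zero)+

context complex_algebra
begin

lemma null_tensors_juxtapose:
  assumes "p \<in> null_tensors V m" "length v = k" "set v \<subseteq> carrier V"
  shows "p \<bullet> mon v \<in> null_tensors V (m + k)"
proof -
  interpret F: complex_algebra free_algebra by (rule complex_algebra_free_algebra)
  show ?thesis
    using assms(1)
  proof (induction rule: null_tensors.induct)
    case zero
    then show ?case by (simp add: free_algebra_mult_distrib null_tensors.zero)
  next
    case (plus p q)
    then show ?case by (simp add: free_algebra_mult_distrib null_tensors.plus)
  next
    case (scale p c)
    then show ?case
      using F.smult_mult_left[of p "mon v" c] by (simp add: null_tensors.scale)
  next
    case (additive u u' a b)
    then show ?case
      using assms null_tensors.additive[of u V "u' @ v" "m + k" a b]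
      by (auto simp: free_algebra_mult_distrib)
  next
    case (homogeneous u u' a c)
    then show ?case
      using assms null_tensors.homogeneous[of u V "u' @ v" "m + k" a c]
      by (auto simp: free_algebra_mult_distrib)
  qed
qed

text \<open>The linear map X to X \<otimes> v_1 \<otimes> ... \<otimes> v_k on an m-fold tensor
  power. It separates the coproduct of the first slot from the slots that are merely carried
  along.\<close>

definition juxtapose :: "nat \<Rightarrow> 'a list \<Rightarrow> 'a tensor \<Rightarrow> 'a tensor" where
  "juxtapose m v = descend (\<lambda>t. tensor_class V (m + length v) (t \<bullet> mon v))"

lemma formal_tensors_juxtapose:
  assumes "t \<in> carrier (formal_tensors V m)" "length v = k" "set v \<subseteq> carrier V"
  shows "t \<bullet> mon v \<in> carrier (formal_tensors V (m + k))"
proof -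
  have "keys t \<subseteq> {w. length w = m \<and> set w \<subseteq> carrier V}"
    using assms(1) by (simp add: carrier_formal_tensors)
  then show ?thesis
  proof (induction t rule: poly_mapping_span_induct)
    case zero
    show ?case by (simp add: free_algebra_mult_distrib carrier_formal_tensors)
  next
    case (add p q)
    then show ?case
      by (simp add: free_algebra_mult_distrib carrier_formal_tensors order_trans[OF keys_add])
  next
    case (single u c)
    then show ?case using assms by (simp add: carrier_formal_tensors)
  qed
qed

lemma
  assumes v: "set v \<subseteq> carrier V"
  shows linear_map_juxtapose:
      "linear_map (tensor_power V m) (tensor_power V (m + length v)) (juxtapose m v)"
    and juxtapose_class: "t \<in> carrier (formal_tensors V m) \<Longrightarrow>
      juxtapose m v (tensor_class V m t) = tensor_class V (m + length v) (t \<bullet> mon v)"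
proof -
  let ?T = "tensor_power V (m + length v)" and ?c = "tensor_class V (m + length v)"
  interpret F: complex_algebra free_algebra by (rule complex_algebra_free_algebra)
  interpret T: algebra_ideal "null_tensors V m" "formal_tensors V m"
    by (rule algebra_ideal_null_tensors)
  interpret c: linear_map "formal_tensors V (m + length v)" ?T
    ?c by (rule linear_map_tensor_class)
  note jux = formal_tensors_juxtapose[OF _ refl v]
  have lin: "linear_map (formal_tensors V m) (?T)
      (\<lambda>t. ?c (t \<bullet> mon v))"
  proof
    fix t s c assume t: "t \<in> carrier (formal_tensors V m)" and s: "s \<in> carrier (formal_tensors V m)"
    show "?c (t \<bullet> mon v) \<in> carrier (?T)"
      using jux[OF t] by auto
    show "?c ((t \<oplus>\<^bsub>formal_tensors V m\<^esub> s) \<bullet> mon v) =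
        ?c (t \<bullet> mon v) \<oplus>\<^bsub>?T\<^esub>
        ?c (s \<bullet> mon v)"
      using c.map_add[OF jux[OF t] jux[OF s]]
      by (simp add: formal_tensors_simps free_algebra_mult_distrib)
    show "?c ((c \<odot>\<^bsub>formal_tensors V m\<^esub> t) \<bullet> mon v) =
        c \<odot>\<^bsub>?T\<^esub> ?c (t \<bullet> mon v)"
      using c.map_smult[OF jux[OF t], of c] F.smult_mult_left[of t "mon v" c]
      by (simp add: formal_tensors_simps)
  qed
  have ker: "?c (p \<bullet> mon v) = \<zero>\<^bsub>?T\<^esub>"
    if "p \<in> null_tensors V m" for p
  proof -
    have "?c (p \<bullet> mon v) =
        ?c \<zero>\<^bsub>formal_tensors V (m + length v)\<^esub>"
      using null_tensors_juxtapose[OF that refl v] jux[of p] null_tensors_keys[OF that]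
      by (intro tensor_class_eqI) (auto simp: formal_tensors_simps)
    then show ?thesis using c.map_zero by simp
  qed
  show "linear_map (tensor_power V m) (?T) (juxtapose m v)"
    unfolding juxtapose_def tensor_power_def[of V m]
    by (rule T.linear_map_descend[OF lin ker])
  show "juxtapose m v (tensor_class V m t) = ?c (t \<bullet> mon v)"
    if "t \<in> carrier (formal_tensors V m)"
    unfolding juxtapose_def tensor_class_def[of V m] by (rule T.descend_coset[OF lin ker that])
qed

lemma juxtapose_pure:
  "\<lbrakk>set u \<subseteq> carrier V; length u = m; set v \<subseteq> carrier V\<rbrakk> \<Longrightarrow>
    juxtapose m v (pure_tensor V u) = pure_tensor V (u @ v)"
  using juxtapose_class[of v "mon u" m] by (simp add: pure_tensor_def carrier_formal_tensors)

text \<open>\<open>comult_first\<close> uses a union over the representatives of a coproduct. As for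
  scalars, every representative gives the same class, so the union is a single well-defined
  value.\<close>

lemma juxtapose_Union:
  assumes "set v \<subseteq> carrier V" "X \<in> carrier (tensor_power V m)"
  shows "(\<Union>t\<in>X. tensor_class V (m + length v) (t \<bullet> mon v)) = juxtapose m v X"
proof -
  interpret T: algebra_ideal "null_tensors V m" "formal_tensors V m"
    by (rule algebra_ideal_null_tensors)
  obtain t where t: "t \<in> carrier (formal_tensors V m)" and X: "X = tensor_class V m t"
    using assms(2) by (auto simp: carrier_tensor_power)
  have "tensor_class V (m + length v) (s \<bullet> mon v) = juxtapose m v X" if "s \<in> X" for s
  proof -
    have "s \<in> null_tensors V m +>\<^bsub>formal_tensors V m\<^esub> t" using that X by (simp add: tensor_class_def)
    then have "s \<in> carrier (formal_tensors V m)" "X = tensor_class V m s"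
      using T.a_elemrcos_carrier[OF t] T.a_repr_independence'[of s t] t
      by (auto simp: X tensor_class_def)
    then show ?thesis using juxtapose_class[OF assms(1)] by simp
  qed
  then have "(\<Union>t\<in>X. tensor_class V (m + length v) (t \<bullet> mon v)) = (\<Union>t\<in>X. juxtapose m v X)"
    by (intro SUP_cong refl)
  moreover have "X \<noteq> {}"
    using T.a_rcos_self[OF t] X by (auto simp: tensor_class_def)
  ultimately show ?thesis by simp
qed

text \<open>Here X is fixed and an entry of the juxtaposed tuple varies. On a monomial of X the
  claim is a generating relation with the prefix lengthened by that monomial.\<close>

lemma juxtapose_linear_slot:
  assumes X: "X \<in> carrier (tensor_power V m)"
    and A: "set u \<subseteq> carrier V" "set v \<subseteq> carrier V" "a \<in> carrier V" "b \<in> carrier V"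
    and n: "n = m + length (u @ a # v)"
  shows "juxtapose m (u @ (a \<oplus> b) # v) X =
      juxtapose m (u @ a # v) X \<oplus>\<^bsub>tensor_power V n\<^esub> juxtapose m (u @ b # v) X"
    and "juxtapose m (u @ (c \<odot> a) # v) X = c \<odot>\<^bsub>tensor_power V n\<^esub> juxtapose m (u @ a # v) X"
proof -
  interpret F: complex_algebra free_algebra by (rule complex_algebra_free_algebra)
  interpret c: linear_map "formal_tensors V n" "tensor_power V n" "tensor_class V n"
    by (rule linear_map_tensor_class)
  obtain t where t: "t \<in> carrier (formal_tensors V m)" and X: "X = tensor_class V m t"
    using X by (auto simp: carrier_tensor_power)
  have n': "m + length (u @ x # v) = n" for x by (simp add: n)
  have jux: "t \<bullet> mon (u @ x # v) \<in> carrier (formal_tensors V n)" if "x \<in> carrier V" for x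
    using formal_tensors_juxtapose[OF t refl, of "u @ x # v"] that A n' by simp
  have J: "juxtapose m (u @ x # v) X = tensor_class V n (t \<bullet> mon (u @ x # v))"
    if "x \<in> carrier V" for x
    using juxtapose_class[OF _ t, of "u @ x # v"] that A by (simp add: X n)
  have keys: "keys t \<subseteq> {w. length w = m \<and> set w \<subseteq> carrier V}"
    using t by (simp add: carrier_formal_tensors)
  have "t \<bullet> mon (u @ (a \<oplus> b) # v) - t \<bullet> mon (u @ a # v) -
      t \<bullet> mon (u @ b # v) \<in> null_tensors V n"
    using keys
  proof (induction t rule: poly_mapping_span_induct)
    case (add p q)
    from null_tensors.plus[OF add(3,4)] show ?case
      by (simp add: free_algebra_mult_distrib algebra_simps)
  next
    case (single w k)
    have "mon ((w @ u) @ (a \<oplus> b) # v) - mon ((w @ u) @ a # v) - mon ((w @ u) @ b # v) \<in> null_tensors V n"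
      using single A n by (intro null_tensors.additive) auto
    from null_tensors_single[OF this, of k] show ?case by simp
  qed (simp add: free_algebra_mult_distrib null_tensors.zero)
  then have "tensor_class V n (t \<bullet> mon (u @ (a \<oplus> b) # v)) =
      tensor_class V n (t \<bullet> mon (u @ a # v) \<oplus>\<^bsub>formal_tensors V n\<^esub>
        t \<bullet> mon (u @ b # v))"
    using A jux c.V.a_closed[OF jux jux, of a b]
    by (intro tensor_class_eqI) (simp_all add: formal_tensors_simps[of V n] algebra_simps)
  then show "juxtapose m (u @ (a \<oplus> b) # v) X =
      juxtapose m (u @ a # v) X \<oplus>\<^bsub>tensor_power V n\<^esub> juxtapose m (u @ b # v) X"
    using A jux by (simp add: J c.map_add)
  have "t \<bullet> mon (u @ (c \<odot> a) # v) -
      scal c (t \<bullet> mon (u @ a # v)) \<in> null_tensors V n"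
    using keys
  proof (induction t rule: poly_mapping_span_induct)
    case (add p q)
    from null_tensors.plus[OF add(3,4)] show ?case
      by (simp add: free_algebra_mult_distrib map_times_add add_diff_add)
  next
    case (single w k)
    have "mon ((w @ u) @ (c \<odot> a) # v) - single ((w @ u) @ a # v) c \<in> null_tensors V n"
      using single A n by (intro null_tensors.homogeneous) auto
    from null_tensors_single2[OF this, of k] show ?case by (simp add: mult.commute)
  qed (simp add: free_algebra_mult_distrib null_tensors.zero)
  then have "tensor_class V n (t \<bullet> mon (u @ (c \<odot> a) # v)) =
      tensor_class V n (c \<odot>\<^bsub>formal_tensors V n\<^esub> (t \<bullet> mon (u @ a # v)))"
    using A jux c.V.smult_closed[OF jux, of a c]
    by (intro tensor_class_eqI) (auto simp: formal_tensors_simps[of V n])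
  then show "juxtapose m (u @ (c \<odot> a) # v) X = c \<odot>\<^bsub>tensor_power V n\<^esub> juxtapose m (u @ a # v) X"
    using A jux by (simp add: J c.map_smult)
qed

end

locale comultiplicative = complex_algebra H for H :: "('a, 'x) hopf_scheme" (structure) +
  assumes linear_map_comult: "linear_map H (tensor_power H 2) (comult H)"
begin

sublocale comult: linear_map H "tensor_power H 2" "comult H"
  by (rule linear_map_comult)

lemma multilinear_comult_first:
  "multilinear H (Suc n) (tensor_power H (n + 2)) (\<lambda>w. juxtapose 2 (tl w) (comult H (hd w)))"
  (is "multilinear _ _ ?T ?\<phi>")
proof -
  have jux: "linear_map (tensor_power H 2) ?T (juxtapose 2 v)"
    if "set v \<subseteq> carrier H" "length v = n" for v
    using linear_map_juxtapose[OF that(1), of 2] that(2) by (simp add: add.commute)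
  have closed: "?\<phi> w \<in> carrier ?T" if w: "length w = Suc n" "set w \<subseteq> carrier H" for w
  proof (cases w)
    case (Cons x v)
    then interpret j: linear_map "tensor_power H 2" ?T "juxtapose 2 v"
      using w by (intro jux) auto
    show ?thesis using j.map_closed[of "comult H x"] comult.map_closed[of x] Cons w by simp
  qed (use w in auto)
  have additive: "?\<phi> (u @ (a \<oplus> b) # v) = ?\<phi> (u @ a # v) \<oplus>\<^bsub>?T\<^esub> ?\<phi> (u @ b # v)"
    and homogeneous: "?\<phi> (u @ (c \<odot> a) # v) = c \<odot>\<^bsub>?T\<^esub> ?\<phi> (u @ a # v)"
    if A: "set u \<subseteq> carrier H" "set v \<subseteq> carrier H" "length u + 1 + length v = Suc n"
      "a \<in> carrier H" "b \<in> carrier H" for u v a b c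
  proof -
    have "?\<phi> (u @ (a \<oplus> b) # v) = ?\<phi> (u @ a # v) \<oplus>\<^bsub>?T\<^esub> ?\<phi> (u @ b # v) \<and>
      ?\<phi> (u @ (c \<odot> a) # v) = c \<odot>\<^bsub>?T\<^esub> ?\<phi> (u @ a # v)"
    \<comment> \<open>For empty u the varying slot is the one that is comultiplied, and linearity
      comes from \<open>comult\<close>. Otherwise it is a carried slot.\<close>
    proof (cases u)
      case Nil
      then interpret j: linear_map "tensor_power H 2" ?T "juxtapose 2 v"
        using A by (intro jux) auto
      show ?thesis
        using Nil A by (simp add: comult.map_add comult.map_smult j.map_add j.map_smult)
    next
      case (Cons x u')
      have X: "comult H x \<in> carrier (tensor_power H 2)" using A Cons by auto
      show ?thesis
        using juxtapose_linear_slot(1)[OF X _ A(2,4,5), of u' "n + 2"]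
          juxtapose_linear_slot(2)[OF X _ A(2,4,5), of u' "n + 2" c] A Cons by simp
    qed
    then show "?\<phi> (u @ (a \<oplus> b) # v) = ?\<phi> (u @ a # v) \<oplus>\<^bsub>?T\<^esub> ?\<phi> (u @ b # v)"
      and "?\<phi> (u @ (c \<odot> a) # v) = c \<odot>\<^bsub>?T\<^esub> ?\<phi> (u @ a # v)" by auto
  qed
  show ?thesis
    unfolding multilinear_def
    by (intro conjI allI impI; (rule closed additive homogeneous[OF _ _ _ _ zero_closed]; assumption))
qed

lemma multilinear_cong:
  assumes "\<And>w. \<lbrakk>length w = n; set w \<subseteq> carrier H\<rbrakk> \<Longrightarrow> \<phi> w = \<psi> w" "multilinear H n W \<psi>"
  shows "multilinear H n W \<phi>"
  using assms(2) unfolding multilinear_def by (auto simp: assms(1))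

lemma
  shows linear_map_comult_first:
      "linear_map (tensor_power H (Suc n)) (tensor_power H (n + 2)) (comult_first H (Suc n))"
    and comult_first_pure: "\<lbrakk>h \<in> carrier H; set v \<subseteq> carrier H; length v = n\<rbrakk> \<Longrightarrow>
      comult_first H (Suc n) (pure_tensor H (h # v)) = juxtapose 2 v (comult H h)"
proof -
  interpret T: complex_algebra "tensor_power H (n + 2)" by (rule complex_algebra_tensor_power)
  let ?\<phi> = "\<lambda>w. \<Union>t\<in>comult H (hd w). tensor_class H (n + 2) (t \<bullet> mon (tl w))"
  have eq: "?\<phi> w = juxtapose 2 (tl w) (comult H (hd w))" if w: "length w = Suc n" "set w \<subseteq> carrier H" for w
  proof (cases w)
    case (Cons x v)
    then show ?thesis
      using juxtapose_Union[of v "comult H x" 2] w by (simp add: add.commute)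
  qed (use w in auto)
  have ml: "multilinear H (Suc n) (tensor_power H (n + 2)) ?\<phi>"
    by (rule multilinear_cong[OF eq multilinear_comult_first])
  have cf: "comult_first H (Suc n) = descend (lin_ext (tensor_power H (n + 2)) ?\<phi>)"
    by (simp add: comult_first_def)
  show "linear_map (tensor_power H (Suc n)) (tensor_power H (n + 2)) (comult_first H (Suc n))"
    unfolding cf by (rule linear_map_descend_multilinear[OF T.complex_space_axioms ml])
  show "comult_first H (Suc n) (pure_tensor H (h # v)) = juxtapose 2 v (comult H h)"
    if "h \<in> carrier H" "set v \<subseteq> carrier H" "length v = n"
    unfolding cf
    using descend_multilinear_pure[OF T.complex_space_axioms ml, of "h # v"] that eq[of "h # v"] by simp
qed

lemma linear_map_iter_comult: "linear_map H (tensor_power H (Suc n)) (iter_comult H (Suc n))"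
proof (induction n)
  case 0
  interpret T: complex_algebra "tensor_power H 1" by (rule complex_algebra_tensor_power)
  have ml: "multilinear H 1 (tensor_power H 1) (pure_tensor H)" by (rule multilinear_pure_tensor)
  have add: "pure_tensor H [a \<oplus> b] = pure_tensor H [a] \<oplus>\<^bsub>tensor_power H 1\<^esub> pure_tensor H [b]"
    if "a \<in> carrier H" "b \<in> carrier H" for a b
    using ml that unfolding multilinear_def
    by (metis append_Nil add_0 add_0_right empty_set empty_subsetI list.size(3))
  have smult: "pure_tensor H [c \<odot> a] = c \<odot>\<^bsub>tensor_power H 1\<^esub> pure_tensor H [a]"
    if "a \<in> carrier H" for a c
    using ml that unfolding multilinear_def
    by (metis append_Nil add_0 add_0_right empty_set empty_subsetI list.size(3))
  have eq: "iter_comult H (Suc 0) = (\<lambda>h. pure_tensor H [h])" by (simp add: fun_eq_iff)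
  show ?case
    unfolding eq One_nat_def[symmetric]
    by unfold_locales (use add smult in \<open>auto intro!: pure_tensor_closed\<close>)
next
  case (Suc n)
  have eq: "iter_comult H (Suc (Suc n)) = (\<lambda>h. comult_first H (Suc n) (iter_comult H (Suc n) h))"
    by (simp add: fun_eq_iff)
  show ?case
    unfolding eq using linear_map_compose[OF Suc linear_map_comult_first[of n]] by simp
qed

lemma
  shows linear_map_sweedler_mult:
      "linear_map (tensor_power H n) H (descend (lin_ext H (list_mult H)))"
    and sweedler_mult_pure: "\<lbrakk>length w = n; set w \<subseteq> carrier H\<rbrakk> \<Longrightarrow>
      descend (lin_ext H (list_mult H)) (pure_tensor H w) = list_mult H w"
  using linear_map_descend_multilinear[OF complex_space_axioms multilinear_list_mult]
    descend_multilinear_pure[OF complex_space_axioms multilinear_list_mult] by auto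

lemma linear_map_sweedler_power: "linear_map H H (sweedler_power H (Suc n))"
proof -
  have eq: "sweedler_power H (Suc n) =
      (\<lambda>h. descend (lin_ext H (list_mult H)) (iter_comult H (Suc n) h))"
    by (simp add: fun_eq_iff sweedler_power_def)
  show ?thesis
    unfolding eq by (rule linear_map_compose[OF linear_map_iter_comult linear_map_sweedler_mult])
qed

end

section \<open>Words and normal forms\<close>

text \<open>\<open>?J\<close> is the largest two-sided ideal inside the kernel of f; it is an ideal
  because words span the free algebra. Hence f vanishes on the generated ideal once it kills every
  relation placed between two arbitrary words, even if f is not multiplicative.\<close>

lemma genideal_free_algebra_zero:
  assumes f: "linear_map free_algebra W f"
    and S: "\<And>r u v. r \<in> S \<Longrightarrow> f ((mon u \<bullet> r) \<bullet> mon v) = \<zero>\<^bsub>W\<^esub>"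
    and p: "p \<in> Idl\<^bsub>FA\<^esub> S"
  shows "f p = \<zero>\<^bsub>W\<^esub>"
proof -
  interpret F: complex_algebra free_algebra by (rule complex_algebra_free_algebra)
  interpret f: linear_map free_algebra W f by fact
  let ?J = "{p. \<forall>u v. f ((mon u \<bullet> p) \<bullet> mon v) = \<zero>\<^bsub>W\<^esub>}"
  have fadd: "f (p + q) = f p \<oplus>\<^bsub>W\<^esub> f q" and fsm: "f (scal c p) = c \<odot>\<^bsub>W\<^esub> f p"
    and f0: "f 0 = \<zero>\<^bsub>W\<^esub>" for p q c
    using f.map_add[of p q] f.map_smult[of p c] f.map_zero by (simp_all del: f.map_zero)
  have m_assoc: "p \<bullet> q \<bullet> r = p \<bullet> (q \<bullet> r)"
    for p q r :: "'a list \<Rightarrow>\<^sub>0 complex"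
    by (rule F.m_assoc) simp_all
  have smult: "scal c p \<bullet> q = scal c (p \<bullet> q)"
    "p \<bullet> scal c q = scal c (p \<bullet> q)"
    for p q :: "'a list \<Rightarrow>\<^sub>0 complex" and c
    using F.smult_mult_left[of p q c] F.smult_mult_right[of p q c] by simp_all
  have single_eq: "single w c = scal c (mon w)" for w :: "'a list" and c
    by simp
  have "ideal ?J free_algebra"
  proof (rule idealI[OF F.ring_axioms])
    show "subgroup ?J (add_monoid free_algebra)"
    proof (rule F.add.subgroupI)
      have "\<zero>\<^bsub>FA\<^esub> \<in> ?J" by (simp add: free_algebra_mult_distrib f0)
      then show "?J \<noteq> {}" by blast
    next
      fix p assume p: "p \<in> ?J"
      have "\<ominus>\<^bsub>FA\<^esub> p = scal (- 1) p"
        using F.minus_eq_smult[of p] by simp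
      then show "\<ominus>\<^bsub>FA\<^esub> p \<in> ?J"
        using p by (simp add: smult fsm)
    qed (auto simp: free_algebra_mult_distrib fadd)
  next
    fix p r assume p: "p \<in> ?J"
    have "(r \<bullet> p \<in> ?J) \<and> (p \<bullet> r \<in> ?J)"
      using subset_UNIV[of "keys r"]
    proof (induction r rule: poly_mapping_span_induct)
      case zero
      show ?case by (simp add: free_algebra_mult_distrib f0)
    next
      case (add q r)
      then show ?case by (simp add: free_algebra_mult_distrib fadd)
    next
      case (single w c)
      have "f ((mon u \<bullet> (mon w \<bullet> p)) \<bullet> mon v) = \<zero>\<^bsub>W\<^esub>" for u v
      proof -
        have "mon u \<bullet> (mon w \<bullet> p) = mon (u @ w) \<bullet> p"
          using m_assoc[of "mon u" "mon w" p] by simp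
        then show ?thesis using p by simp
      qed
      moreover have "f ((mon u \<bullet> (p \<bullet> mon w)) \<bullet> mon v) = \<zero>\<^bsub>W\<^esub>" for u v
      proof -
        have "(mon u \<bullet> (p \<bullet> mon w)) \<bullet> mon v =
            (mon u \<bullet> p) \<bullet> mon (w @ v)"
          by (simp add: m_assoc)
        then show ?thesis using p by simp
      qed
      ultimately show ?case
        unfolding single_eq[of w c] by (simp add: smult fsm del: map_times_single Poly_Mapping.map_single)
    qed
    then show "r \<bullet> p \<in> ?J" "p \<bullet> r \<in> ?J" by blast+
  qed
  moreover have "S \<subseteq> ?J" using S by blast
  ultimately have "p \<in> ?J" using p unfolding genideal_def by blast
  then have "f ((mon [] \<bullet> p) \<bullet> mon []) = \<zero>\<^bsub>W\<^esub>" by blast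
  moreover have "(mon [] \<bullet> p) \<bullet> mon [] = p"
    using F.l_one[of p] F.r_one[of p] by simp
  ultimately show ?thesis by simp
qed

lemma alternating_0 [simp]: "alternating a b 0 = []"
  by (simp add: alternating_def)

lemma alternating_Suc [simp]: "alternating a b (Suc n) = a # alternating b a n"
proof -
  have "alternating a b (Suc n) = a # map (\<lambda>k. if even k then a else b) (map Suc [0..<n])"
    unfolding alternating_def upt_conv_Cons[OF zero_less_Suc] map_Suc_upt by simp
  then show ?thesis by (auto simp: alternating_def)
qed

lemma length_alternating [simp]: "length (alternating a b n) = n"
  by (simp add: alternating_def)

lemma map_alternating [simp]: "map f (alternating a b n) = alternating (f a) (f b) n"
  by (simp add: alternating_def)

lemma set_alternating: "set (alternating a b n) \<subseteq> {a, b}"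
  by (auto simp: alternating_def)

text \<open>
  In the group of the words of one parity, generated by \<open>g\<close> and \<open>h\<close> with \<open>g\<^sup>2 = h\<^sup>2\<close>, put
  \<open>q = g h g\<^sup>-\<^sup>2\<close>. Then \<open>h = q\<^sup>-\<^sup>1 g\<close> and \<open>g q g\<^sup>-\<^sup>1 = q\<^sup>-\<^sup>1\<close>, so a word with row indices \<open>x\<close> equals
  \<open>q ^ alt x\<close> times \<open>g ^ length x\<close>.
\<close>

fun alt :: "bit list \<Rightarrow> int" where
  "alt [] = 0"
| "alt (i # x) = - of_bool (i = 1) - alt x"

lemma alt_append: "alt (x @ y) = alt x + (- 1) ^ length x * alt y"
  by (induction x) auto

lemma alt_replicate_0 [simp]: "alt (replicate n 0) = 0"
  by (induction n) auto

text \<open>For n = L this is the exponent form of the two alternating relations: their sides differ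
  by q^L, that is, by the scalar 1 or \<beta>.\<close>

lemma alt_alternating: "alt (alternating 0 1 n) = alt (alternating 1 0 n) + int n"
  by (induction n) auto

text \<open>The empty word is pure of both parities, in accordance with 1 being the sum of the units
  of the two components.\<close>

definition pure :: "bit \<Rightarrow> gen list \<Rightarrow> bool" where
  "pure c w \<longleftrightarrow> (\<forall>(i, j)\<in>set w. j = i + c)"

lemma pure_simps [simp]:
  "pure c []" "pure c (x # w) \<longleftrightarrow> snd x = fst x + c \<and> pure c w"
  "pure c (v @ w) \<longleftrightarrow> pure c v \<and> pure c w"
  by (auto simp: pure_def)

lemma pure_replicate: "pure c (replicate n x) \<longleftrightarrow> n = 0 \<or> snd x = fst x + c"
  by (cases x) (auto simp: pure_def)

lemma pure_alternating: "n \<ge> 2 \<Longrightarrow> pure c (alternating x y n) \<longleftrightarrow> snd x = fst x + c \<and> snd y = fst y + c"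
proof (induction n rule: dec_induct)
  case base
  then show ?case by (simp add: numeral_2_eq_2)
next
  case (step n)
  have "pure c (alternating x y n) \<longleftrightarrow> pure c (alternating y x n)" if "n \<ge> 2" for n
  proof -
    have "set (alternating x y n) = {x, y} \<and> set (alternating y x n) = {x, y}"
      using that set_alternating[of x y n] set_alternating[of y x n]
      by (cases n; cases "n - 1") auto
    then show ?thesis by (simp add: pure_def)
  qed
  then show ?case using step by auto
qed

section \<open>Coefficient functionals on the free algebra that vanish on the ideal\<close>

locale suzuki =
  fixes N L :: nat and \<beta> :: complex
  assumes N: "N \<ge> 1" and L: "L \<ge> 2" and \<beta>: "\<beta> \<in> {1, - 1}"
begin

lemma \<beta>_square [simp]: "\<beta> * \<beta> = 1"
  using \<beta> by auto

text \<open>The scalar q^(L k) in parity c, namely \<beta>^k for c = 1. Since \<beta> is a sign,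
  only k modulo 2 matters, and negative k need no inverse.\<close>

definition twist :: "bit \<Rightarrow> int \<Rightarrow> complex" where
  "twist c k = (if c = 1 \<and> odd k then \<beta> else 1)"

lemma twist_add: "twist c (k + l) = twist c k * twist c l"
  by (auto simp: twist_def)

lemma twist_simps [simp]: "twist c 0 = 1" "twist 0 k = 1" "twist 1 1 = \<beta>" "twist 1 (- 1) = \<beta>"
  by (auto simp: twist_def)

lemma twist_square [simp]: "twist c k * twist c k = 1"
  by (auto simp: twist_def)

text \<open>The coefficient of \<open>q ^ a\<close> times \<open>g ^ m\<close> in a word, where \<open>q ^ L = \<beta>\<close> in parity 1.\<close>

definition word_coeff :: "bit \<Rightarrow> int \<Rightarrow> int \<Rightarrow> gen list \<Rightarrow> complex" where
  "word_coeff c m a w =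
    (if pure c w \<and> 2 * int N dvd int (length w) - m \<and> int L dvd alt (map fst w) - a
     then twist c ((alt (map fst w) - a) div int L) else 0)"

definition coeff :: "bit \<Rightarrow> int \<Rightarrow> int \<Rightarrow> (gen list \<Rightarrow>\<^sub>0 complex) \<Rightarrow> complex" where
  "coeff c m a = lin_ext complex_numbers (word_coeff c m a)"

lemma linear_map_coeff: "linear_map free_algebra complex_numbers (coeff c m a)"
  unfolding coeff_def free_algebra_eq
  by (rule complex_space.linear_map_lin_ext[OF complex_space_complex_numbers monoid_lists]) simp

lemma coeff_single [simp]: "coeff c m a (single w k) = k * word_coeff c m a w"
  unfolding coeff_def by (simp add: complex_space.lin_ext_single[OF complex_space_complex_numbers])

lemma coeff_add: "coeff c m a (p + q) = coeff c m a p + coeff c m a q"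
  and coeff_zero [simp]: "coeff c m a 0 = 0"
  and coeff_diff: "coeff c m a (p - q) = coeff c m a p - coeff c m a q"
proof -
  interpret linear_map free_algebra complex_numbers "coeff c m a" by (rule linear_map_coeff)
  have *: "coeff c m a (p + q) = coeff c m a p + coeff c m a q" for p q
    using map_add[of p q] by simp
  then show "coeff c m a (p + q) = coeff c m a p + coeff c m a q" .
  show "coeff c m a 0 = 0" using map_zero by (simp del: map_zero)
  show "coeff c m a (p - q) = coeff c m a p - coeff c m a q"
    using *[of "p - q" q] by simp
qed

text \<open>Replacing a subword moves the exponent of q by a multiple of L. The prefix u may reverse
  the sign of that multiple, since g inverts q, but \<open>twist\<close> does not notice
  signs.\<close>

lemma word_coeff_shift:
  assumes "pure c x \<longleftrightarrow> pure c y" "2 * int N dvd int (length x) - int (length y)"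
    "even (length x)\<longleftrightarrow> even (length y)"
    "pure c x \<Longrightarrow> alt (map fst x) = alt (map fst y) + int L * k"
  shows "word_coeff c m a (u @ x @ v) = twist c k * word_coeff c m a (u @ y @ v)"
proof (cases "pure c (u @ x @ v)")
  case True
  have sgn: "((- 1) ^ length x :: int) = (- 1) ^ length y"
    using assms(3) by (simp add: minus_one_power_iff)
  have alt: "alt (map fst (u @ x @ v)) = alt (map fst (u @ y @ v)) + int L * ((- 1) ^ length u * k)"
    using assms(4) True by (simp add: alt_append sgn algebra_simps)
  have "(2 * int N dvd int (length (u @ x @ v)) - m) = (2 * int N dvd int (length (u @ y @ v)) - m)"
    using dvd_add_right_iff[OF assms(2), of "int (length (u @ y @ v)) - m"] by (simp add: algebra_simps)
  moreover have "(int L dvd alt (map fst (u @ x @ v)) - a) = (int L dvd alt (map fst (u @ y @ v)) - a)"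
    unfolding alt by (metis add_diff_eq diff_add_eq dvd_add_times_triv_right_iff mult.commute)
  moreover have "(alt (map fst (u @ x @ v)) - a) div int L =
      (alt (map fst (u @ y @ v)) - a) div int L + (- 1) ^ length u * k"
  proof -
    have "alt (map fst (u @ x @ v)) - a = (alt (map fst (u @ y @ v)) - a) + int L * ((- 1) ^ length u * k)"
      unfolding alt by simp
    then show ?thesis
      using L div_mult_self2[of "int L" "alt (map fst (u @ y @ v)) - a" "(- 1) ^ length u * k"]
      by (simp only: add.commute)
  qed
  moreover have "twist c ((- 1) ^ length u * k) = twist c k"
    by (simp add: twist_def minus_one_power_iff)
  ultimately show ?thesis
    using True assms(1) by (simp add: word_coeff_def twist_add)
next
  case False
  then show ?thesis using assms(1) by (auto simp: word_coeff_def)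
qed

lemma word_coeff_squares:
  "word_coeff c m a (u @ [(0, d), (0, d)] @ v) = word_coeff c m a (u @ [(1, 1 + d), (1, 1 + d)] @ v)"
  by (subst word_coeff_shift[where k = 0 and y = "[(1, 1 + d), (1, 1 + d)]"]) auto

lemma word_coeff_alternating:
  "word_coeff c m a (u @ alternating (0, d) (1, 1 + d) L @ v) =
    twist d 1 * word_coeff c m a (u @ alternating (1, 1 + d) (0, d) L @ v)"
proof -
  have "word_coeff c m a (u @ alternating (0, d) (1, 1 + d) L @ v) =
      twist c 1 * word_coeff c m a (u @ alternating (1, 1 + d) (0, d) L @ v)"
    using L by (intro word_coeff_shift) (auto simp: alt_alternating pure_alternating)
  \<comment> \<open>The shift produces the scalar of the tested parity c. If c differs from the
    parity d of the letters, both coefficients vanish, so it may be exchanged for the scalar of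
    d.\<close>
  also have "\<dots> = twist d 1 * word_coeff c m a (u @ alternating (1, 1 + d) (0, d) L @ v)"
    using L by (cases "c = d") (auto simp: word_coeff_def pure_alternating)
  finally show ?thesis .
qed

text \<open>The relation with \<alpha> = 1: inserting g^(2N) of parity d keeps the coefficients of
  parity d and kills those of the other parity, so the two insertions together act as the
  identity.\<close>

lemma word_coeff_unit:
  "word_coeff c m a (u @ replicate (2 * N) (0, 0) @ v) + word_coeff c m a (u @ replicate (2 * N) (0, 1) @ v) =
    word_coeff c m a (u @ v)"
proof -
  have "word_coeff c m a (u @ replicate (2 * N) (0, d) @ v) = of_bool (c = d) * word_coeff c m a (u @ v)" for d
  proof (cases "c = d")
    case True
    then show ?thesis
      using word_coeff_shift[where c = c and x = "replicate (2 * N) (0, d)" and y = "[]" and k = 0]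
      by (simp add: pure_replicate)
  qed (use N in \<open>auto simp: word_coeff_def pure_replicate simp del: add_bit_eq_xor\<close>)
  then show ?thesis by (cases "c = 0") auto
qed

text \<open>The coefficients are well defined on A. Since they separate the normal forms, those are
  linearly independent, which no amount of rewriting would show.\<close>

lemma coeff_ideal:
  assumes "p \<in> suzuki_ideal N L 1 \<beta>"
  shows "coeff c m a p = 0"
proof -
  have rel: "coeff c m a ((mon u \<bullet> r) \<bullet> mon v) = 0"
    if "r \<in> suzuki_relations N L 1 \<beta>" for r u v
  proof -
    have mixed: "word_coeff c m a (u @ [(i, j), (k, l)] @ v) = 0" if "i - j \<noteq> k - l" for i j k l
      using that by (auto simp: word_coeff_def)
    show ?thesis
      using that unfolding suzuki_relations_def
      by (auto simp: free_algebra_mult_distrib coeff_add coeff_diff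
          word_coeff_squares[of _ _ _ _ 0, simplified] word_coeff_squares[of _ _ _ _ 1, simplified]
          word_coeff_alternating[of _ _ _ _ 0, simplified]
          word_coeff_alternating[of _ _ _ _ 1, simplified] word_coeff_unit[simplified] mixed[simplified])
  qed
  show ?thesis
    using genideal_free_algebra_zero[OF linear_map_coeff, where S = "suzuki_relations N L 1 \<beta>" and p = p]
      rel assms by (simp add: suzuki_ideal_def)
qed

end

section \<open>Rewriting words in two elements with equal squares\<close>

locale equal_squares = complex_algebra V for V :: "(complex, 'a, 'x) module_scheme" (structure) +
  fixes g h :: 'a
  assumes g [simp, intro]: "g \<in> carrier V" and h [simp, intro]: "h \<in> carrier V"
    and squares: "g \<otimes> g = h \<otimes> h"
begin

text \<open>The square of g is also the square of h, hence commutes with both.\<close>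

lemma even_pow_commutes: "g [^] (2 * j :: nat) \<otimes> h = h \<otimes> g [^] (2 * j)"
proof (induction j)
  case (Suc j)
  have "g [^] (2 * Suc j) = g [^] (2 * j) \<otimes> (g \<otimes> g)" by (simp add: m_assoc)
  then have "g [^] (2 * Suc j) \<otimes> h = g [^] (2 * j) \<otimes> (h \<otimes> h) \<otimes> h" using squares by simp
  also have "\<dots> = (g [^] (2 * j) \<otimes> h) \<otimes> (h \<otimes> h)" by (simp add: m_assoc)
  also have "\<dots> = h \<otimes> (g [^] (2 * j) \<otimes> (g \<otimes> g))" by (simp add: Suc squares m_assoc)
  finally show ?case by (simp add: m_assoc)
qed simp

text \<open>The product collapses from the middle: each inner pair x x is the common square, which
  commutes with g and h and can be moved out.\<close>

lemma list_mult_rev: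
  "set w \<subseteq> {g, h} \<Longrightarrow> list_mult V (w @ rev w) = g [^] (2 * length w)"
proof (induction w)
  case (Cons x w)
  then have x: "x = g \<or> x = h" and w: "set (w @ rev w) \<subseteq> carrier V" by auto
  have "list_mult V ((x # w) @ rev (x # w)) = x \<otimes> (list_mult V (w @ rev w) \<otimes> x)"
    using x w list_mult_append[of "w @ rev w" "[x]"] by auto
  also have "\<dots> = x \<otimes> (g [^] (2 * length w) \<otimes> x)" using Cons by simp
  also have "\<dots> = (x \<otimes> x) \<otimes> g [^] (2 * length w)"
    using x nat_pow_Suc2[of g "2 * length w"] by (auto simp: even_pow_commutes m_assoc)
  also have "x \<otimes> x = g [^] (2 :: nat)" using x squares by (auto simp: numeral_2_eq_2)
  finally show ?case by (simp add: nat_pow_mult)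
qed simp

end

text \<open>The two letters of one parity, with n = N. The power g^(2n) is only an idempotent fixing
  g and h, not the unit of V, which is why the period is stated on g and on h. As g^2 is central
  among these words, \<open>wrap\<close> is q^L = t with the inverses cleared.\<close>

locale square_pair = equal_squares V g h
    for V :: "(complex, 'a, 'x) module_scheme" (structure) and g h :: 'a +
  fixes n L :: nat and t :: complex
  assumes n: "n > 0" and period: "g [^] (2 * n) \<otimes> g = g"
    and period': "g [^] (2 * n) \<otimes> h = h"
    and wrap: "(g \<otimes> h) [^] L = t \<odot> g [^] (2 * L)" and L_pos: "L > 0" and t: "t * t = 1"
begin

text \<open>This is q^a g^(j + 2a), written without inverses.\<close>

definition W :: "nat \<Rightarrow> nat \<Rightarrow> 'a" where
  "W a j = (g \<otimes> h) [^] a \<otimes> g [^] j"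

lemma W_closed [simp, intro]: "W a j \<in> carrier V"
  by (simp add: W_def)

lemma W_g: "W a j \<otimes> g = W a (Suc j)"
  by (simp add: W_def m_assoc)

lemma W_h_odd: "W a (Suc (2 * j)) \<otimes> h = W (Suc a) (2 * j)"
proof -
  have "W a (Suc (2 * j)) \<otimes> h = (g \<otimes> h) [^] a \<otimes> (g \<otimes> g [^] (2 * j) \<otimes> h)"
    using nat_pow_Suc2[of g "2 * j"] by (simp add: W_def m_assoc)
  also have "\<dots> = (g \<otimes> h) [^] a \<otimes> (g \<otimes> (h \<otimes> g [^] (2 * j)))"
    by (simp add: m_assoc even_pow_commutes)
  finally show ?thesis by (simp add: W_def m_assoc)
qed

text \<open>Behind an even power of g the letter h meets the last factor h and undoes one g h, while
  behind an odd power it completes a new one. The exponent of g h must be positive here, so the case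
  of exponent 0 has to be prepared by wrapping around.\<close>

lemma W_h_even: "W (Suc a) (2 * j) \<otimes> h = W a (2 * j + 3)"
proof -
  have "W (Suc a) (2 * j) \<otimes> h = (g \<otimes> h) [^] a \<otimes> (g \<otimes> (h \<otimes> (h \<otimes> g [^] (2 * j))))"
    by (simp add: W_def m_assoc even_pow_commutes)
  also have "\<dots> = (g \<otimes> h) [^] a \<otimes> (g \<otimes> ((h \<otimes> h) \<otimes> g [^] (2 * j)))"
    by (simp add: m_assoc)
  also have "\<dots> = (g \<otimes> h) [^] a \<otimes> (g [^] (3::nat) \<otimes> g [^] (2 * j))"
    unfolding squares[symmetric] by (simp add: m_assoc numeral_3_eq_3)
  finally show ?thesis by (simp add: W_def nat_pow_mult add.commute)
qed

text \<open>Positivity of j is essential: g^(2n) fixes g but is not the unit, so exponent 0 cannot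
  be compared with exponent 2n.\<close>

lemma pow_period: "j > 0 \<Longrightarrow> g [^] (j + 2 * n * k) = g [^] j"
proof (induction k)
  case (Suc k)
  then obtain i where i: "j + 2 * n * k = Suc i" by (cases "j + 2 * n * k") auto
  have "j + 2 * n * Suc k = i + (2 * n + 1)" using i by simp
  then have "g [^] (j + 2 * n * Suc k) = g [^] (i + (2 * n + 1))" by (simp only:)
  also have "\<dots> = g [^] i \<otimes> (g [^] (2 * n) \<otimes> g)" by (simp add: m_assoc flip: nat_pow_mult)
  also have "\<dots> = g [^] Suc i" by (simp add: period)
  finally show ?case using Suc i by simp
qed simp

lemma pow_cong:
  assumes "i > 0" "j > 0" "i mod (2 * n) = j mod (2 * n)"
  shows "g [^] i = g [^] j"
proof -
  have *: "g [^] i = g [^] j" if "i > 0" "i \<le> j" "i mod (2 * n) = j mod (2 * n)" for i j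
  proof -
    have "2 * n dvd j - i" using that by (metis mod_eq_dvd_iff_nat)
    then obtain k where "j - i = 2 * n * k" by (auto elim: dvdE)
    then have "j = i + 2 * n * k" using that by simp
    then show ?thesis using pow_period[OF that(1)] by simp
  qed
  show ?thesis
  proof (cases "i \<le> j")
    case True
    then show ?thesis by (rule *[OF assms(1) _ assms(3)])
  next
    case False
    then have "j \<le> i" by simp
    from *[OF assms(2) this assms(3)[symmetric]] show ?thesis ..
  qed
qed

lemma W_cong:
  "\<lbrakk>i > 0; j > 0; i mod (2 * n) = j mod (2 * n)\<rbrakk> \<Longrightarrow> W a i = W a j"
  unfolding W_def by (simp add: pow_cong[of i j])

lemma W_wrap: "W (a + L * k) j = t ^ k \<odot> W a (j + 2 * L * k)"
proof (induction k arbitrary: j)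
  case (Suc k)
  have "W (a + L * Suc k) j = (g \<otimes> h) [^] (a + L * k) \<otimes> (t \<odot> g [^] (2 * L)) \<otimes> g [^] j"
    unfolding W_def wrap[symmetric] by (simp add: nat_pow_mult algebra_simps)
  also have "\<dots> = t \<odot> W (a + L * k) (2 * L + j)"
    by (simp add: W_def smult_mult_left smult_mult_right m_assoc flip: nat_pow_mult)
  finally show ?case using Suc[of "2 * L + j"] by (simp add: smult_smult algebra_simps)
qed simp

text \<open>Letters are appended on the right. A letter g raises j; a letter h raises or lowers a
  according to the parity of j. The invariant j > 0 keeps the periodicity of g available.\<close>

lemma list_mult_normal_form:
  assumes "set w \<subseteq> {g, h}" "w \<noteq> []"
  shows "\<exists>s a j. j > 0 \<and> list_mult V w = s \<odot> W a j"
  using assms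
proof (induction w rule: rev_induct)
  case (snoc x w)
  have carrier: "set w \<subseteq> carrier V" "x \<in> carrier V" using snoc.prems by auto
  have app: "list_mult V (w @ [x]) = list_mult V w \<otimes> x"
    using carrier by (simp add: list_mult_append)
  have h_step: "\<exists>s b k. k > 0 \<and> W a j \<otimes> h = s \<odot> W b k" if j: "j > 0" for a j
  proof (cases "even j")
    case True
    then obtain i where i: "j = 2 * i" by blast
    \<comment> \<open>If a is 0 there is no factor g h to undo. The exponent of g is padded by 2nL,
      a multiple of the period, and 2L of it is traded for L further factors g h by reading
      \<open>W_wrap\<close> backwards; n L \<ge> L makes the padding suffice.\<close>
    have nL: "n * L \<ge> L" using n by simp
    have pos: "j + 2 * n * L > 2 * L" using j nL by linarith
    have "W a j = W a (j + 2 * n * L)" using j by (intro W_cong) auto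
    also have "\<dots> = t \<odot> (t \<odot> W a ((j + 2 * n * L - 2 * L) + 2 * L))"
      using pos by (simp add: smult_smult t)
    also have "\<dots> = t \<odot> W (a + L) (j + 2 * n * L - 2 * L)"
      using W_wrap[of a 1 "j + 2 * n * L - 2 * L"] by simp
    also have "\<dots> = t \<odot> W (Suc (a + L - 1)) (2 * (i + n * L - L))"
      using L_pos by (simp add: i algebra_simps)
    finally have "W a j \<otimes> h = t \<odot> W (a + L - 1) (2 * (i + n * L - L) + 3)"
      by (simp add: smult_mult_left W_h_even)
    then show ?thesis by (intro exI[of _ t] exI[of _ "a + L - 1"] exI[of _ "2 * (i + n * L - L) + 3"]) auto
  next
    case False
    then obtain i where i: "j = Suc (2 * i)" by (metis oddE Suc_eq_plus1)
    \<comment> \<open>Without the extra period the remaining exponent would be 2i, which is 0 for j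
      = 1.\<close>
    have "Suc (2 * (i + n)) = j + 2 * n" by (simp add: i)
    then have "W a j = W a (Suc (2 * (i + n)))"
      using j by (intro W_cong) (simp_all only: mod_add_self2 zero_less_Suc)
    then have "W a j \<otimes> h = 1 \<odot> W (Suc a) (2 * (i + n))"
      by (simp only: W_h_odd W_closed smult_one)
    then show ?thesis using n by (intro exI[of _ 1] exI[of _ "Suc a"] exI[of _ "2 * (i + n)"]) auto
  qed
  show ?case
  proof (cases "w = []")
    case True
    have "\<exists>s a j. j > 0 \<and> g = s \<odot> W a j"
      by (intro exI[of _ 1] exI[of _ 0] exI[of _ "Suc 0"]) (simp add: W_def)
    moreover have "\<exists>s a j. j > 0 \<and> h = s \<odot> W a j"
    proof -
      \<comment> \<open>The one-letter word h is read as g^(2n) h, because starting from the empty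
        product would violate j > 0.\<close>
      have "\<exists>s b k. k > 0 \<and> W 0 (2 * n) \<otimes> h = s \<odot> W b k" using n by (intro h_step) simp
      moreover have "W 0 (2 * n) \<otimes> h = h" by (simp add: W_def period')
      ultimately show ?thesis by simp
    qed
    ultimately show ?thesis
      using True snoc.prems carrier by auto
  next
    case False
    then obtain s a j where IH: "j > 0" "list_mult V w = s \<odot> W a j" using snoc by auto
    then have eq: "list_mult V (w @ [x]) = s \<odot> (W a j \<otimes> x)"
      using carrier by (simp add: app smult_mult_left)
    from snoc.prems have "x = g \<or> x = h" by auto
    then show ?thesis
    proof
      assume "x = g"
      then show ?thesis using eq W_g IH by auto
    next
      assume "x = h"
      moreover obtain s' b k where "k > 0" "W a j \<otimes> h = s' \<odot> W b k"
        using h_step[OF IH(1)] by blast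
      ultimately show ?thesis
        using eq by (intro exI[of _ "s * s'"] exI[of _ b] exI[of _ k]) (simp add: smult_smult)
    qed
  qed
qed simp

lemma list_mult_bounded_normal_form:
  assumes "set w \<subseteq> {g, h}" "w \<noteq> []"
  shows "\<exists>s a j. a < L \<and> j > 0 \<and> list_mult V w = s \<odot> W a j"
proof -
  obtain s a j where w: "j > 0" "list_mult V w = s \<odot> W a j"
    using list_mult_normal_form[OF assms] by blast
  have "W a j = t ^ (a div L) \<odot> W (a mod L) (j + 2 * L * (a div L))"
    using W_wrap[of "a mod L" "a div L" j] by simp
  then show ?thesis
    using w L_pos
    by (intro exI[of _ "s * t ^ (a div L)"] exI[of _ "a mod L"] exI[of _ "j + 2 * L * (a div L)"])
      (simp add: smult_smult)
qed

end

lemma alternating_append_even: "even n \<Longrightarrow> alternating a b n @ alternating a b m = alternating a b (n + m)"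
  and alternating_append_odd: "odd n \<Longrightarrow> alternating a b n @ alternating b a m = alternating a b (n + m)"
  by (induction n arbitrary: a b) auto

lemma rev_alternating: "rev (alternating a b n) = (if even n then alternating b a n else alternating a b n)"
proof (induction n arbitrary: a b)
  case (Suc n)
  have "alternating b a n @ [a] = alternating b a n @ alternating a b 1" if "odd n" using that by simp
  then show ?case
    using alternating_append_odd[of n b a 1] alternating_append_even[of n a b 1] by (simp add: Suc)
qed simp

lemma alternating_double: "alternating a b (2 * n) = concat (replicate n [a, b])"
  by (induction n) auto

section \<open>Suzuki's relations on classes of words\<close>

context suzuki
begin

abbreviation F where "F \<equiv> free_algebra :: (complex, gen list \<Rightarrow>\<^sub>0 complex) module"
abbreviation I where "I \<equiv> suzuki_ideal N L 1 \<beta>"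
abbreviation A where "A \<equiv> suzuki_algebra N L 1 \<beta>"

abbreviation A_mult (infixl \<open>\<cdot>\<close> 70) where "x \<cdot> y \<equiv> x \<otimes>\<^bsub>A\<^esub> y"
abbreviation A_add (infixl \<open>\<boxplus>\<close> 65) where "x \<boxplus> y \<equiv> x \<oplus>\<^bsub>A\<^esub> y"
abbreviation A_smult (infixl \<open>\<star>\<close> 70) where "c \<star> x \<equiv> c \<odot>\<^bsub>A\<^esub> x"

sublocale I: algebra_ideal I F
proof -
  interpret F: complex_algebra F by (rule complex_algebra_free_algebra)
  have "ideal I F" unfolding suzuki_ideal_def by (rule F.genideal_ideal) simp
  then show "algebra_ideal I F" by (simp add: algebra_ideal_def F.complex_algebra_axioms)
qed

sublocale A: complex_algebra A
  unfolding suzuki_algebra_def by (rule I.quotient.complex_algebra_axioms)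

definition proj :: "(gen list \<Rightarrow>\<^sub>0 complex) \<Rightarrow> suzuki_elem" where
  "proj p = I +>\<^bsub>F\<^esub> p"

definition cls :: "gen list \<Rightarrow> suzuki_elem" where
  "cls w = proj (mon w)"

sublocale proj: linear_map F A proj
  unfolding suzuki_algebra_def proj_def by (rule I.linear_map_coset)

lemma carrier_A: "carrier A = range proj"
  unfolding suzuki_algebra_def proj_def using I.carrier_quotient by simp

lemma proj_closed [simp, intro]: "proj p \<in> carrier A"
  by (simp add: carrier_A)

lemma cls_closed [simp, intro]: "cls w \<in> carrier A"
  by (simp add: cls_def)

lemma proj_eqI: "p - q \<in> I \<Longrightarrow> proj p = proj q"
proof -
  have "p \<ominus>\<^bsub>F\<^esub> q = p - q"
    using complex_space_minus_monoid_algebra[OF monoid_lists, of p q] by (simp add: free_algebra_eq)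
  then show "p - q \<in> I \<Longrightarrow> proj p = proj q"
    using I.coset_eq_iff[of p q] by (simp add: proj_def)
qed

lemma proj_single: "proj (single w k) = k \<star> cls w"
  using proj.map_smult[of "mon w" k] by (simp add: cls_def)

lemma proj_add: "proj (p + q) = proj p \<boxplus> proj q"
  using proj.map_add[of p q] by simp

lemma proj_mult: "proj p \<cdot> proj q = proj (p \<bullet> q)"
  unfolding suzuki_algebra_def proj_def by (rule I.mult_coset) simp_all

lemma cls_append: "cls (u @ v) = cls u \<cdot> cls v"
  by (simp add: cls_def proj_mult)

lemma cls_Nil: "cls [] = \<one>\<^bsub>A\<^esub>"
  unfolding suzuki_algebra_def cls_def proj_def by (simp only: I.one_coset) simp

lemma cls_Cons: "cls (x # w) = cls [x] \<cdot> cls w"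
  using cls_append[of "[x]" w] by simp

lemma cls_list_mult: "cls w = list_mult A (map (\<lambda>x. cls [x]) w)"
proof (induction w)
  case (Cons x w)
  then show ?case unfolding cls_Cons[of x w] by simp
qed (simp add: cls_Nil)

lemma relation_in_ideal: "r \<in> suzuki_relations N L 1 \<beta> \<Longrightarrow> r \<in> I"
  unfolding suzuki_ideal_def using I.R.genideal_self[of "suzuki_relations N L 1 \<beta>"] by auto

lemma cls_squares: "cls [(0, c), (0, c)] = cls [(1, 1 + c), (1, 1 + c)]"
proof (cases "c = 0")
  case True
  then show ?thesis
    unfolding cls_def by (intro proj_eqI relation_in_ideal) (simp add: suzuki_relations_def)
next
  case False
  then show ?thesis
    unfolding cls_def by (intro proj_eqI relation_in_ideal) (simp add: suzuki_relations_def)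
qed

lemma cls_alternating:
  "cls (alternating (0, c) (1, 1 + c) L) = twist c 1 \<star> cls (alternating (1, 1 + c) (0, c) L)"
proof -
  have "proj (mon (alternating (0, c) (1, 1 + c) L)) =
      proj (single (alternating (1, 1 + c) (0, c) L) (twist c 1))"
    by (intro proj_eqI relation_in_ideal; cases "c = 0") (simp_all add: suzuki_relations_def)
  then show ?thesis by (simp add: cls_def[symmetric] proj_single)
qed

lemma cls_unit: "cls (replicate (2 * N) (0, 0)) \<boxplus> cls (replicate (2 * N) (0, 1)) = \<one>\<^bsub>A\<^esub>"
proof -
  have "proj (mon (replicate (2 * N) (0, 0)) + mon (replicate (2 * N) (0, 1))) = proj (mon [])"
    by (intro proj_eqI relation_in_ideal) (simp add: suzuki_relations_def)
  then show ?thesis by (simp add: cls_def[symmetric] proj_add cls_Nil)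
qed

lemma cls_mixed_pair: "i - j \<noteq> k - l \<Longrightarrow> cls [(i, j), (k, l)] = \<zero>\<^bsub>A\<^esub>"
proof -
  assume ne: "i - j \<noteq> k - l"
  have "proj (mon [(i, j), (k, l)]) = proj 0"
  proof (intro proj_eqI relation_in_ideal)
    have "mon [(i, j), (k, l)] \<in> suzuki_relations N L 1 \<beta>"
      unfolding suzuki_relations_def using ne by blast
    then show "mon [(i, j), (k, l)] - 0 \<in> suzuki_relations N L 1 \<beta>" by simp
  qed
  moreover have "proj 0 = \<zero>\<^bsub>A\<^esub>" using proj.map_zero by (simp del: proj.map_zero)
  ultimately show "cls [(i, j), (k, l)] = \<zero>\<^bsub>A\<^esub>" by (simp add: cls_def)
qed

lemma pure_ex_parity: "pure c [x] \<longleftrightarrow> c = snd x - fst x"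
  by (cases x) auto

text \<open>Such a word contains two neighbours of different parity, and their product is a defining
  relation.\<close>

lemma cls_not_pure: "(\<And>c. \<not> pure c w) \<Longrightarrow> cls w = \<zero>\<^bsub>A\<^esub>"
proof (induction w)
  case Nil
  then show ?case using Nil[of 0] by simp
next
  case (Cons x w)
  show ?case
  proof (cases "\<exists>c. pure c w")
    case True
    then obtain c where c: "pure c w" by blast
    obtain y w' where w: "w = y # w'"
      using Cons.prems[of "snd x - fst x"] c pure_ex_parity[of "snd x - fst x" x]
      by (cases w) auto
    have "fst x - snd x \<noteq> fst y - snd y"
      using Cons.prems[of c] c by (auto simp: w algebra_simps)
    then have "cls [x, y] = \<zero>\<^bsub>A\<^esub>"
      using cls_mixed_pair[of "fst x" "snd x" "fst y" "snd y"] by simp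
    then show ?thesis using cls_append[of "[x, y]" w'] by (simp add: w)
  next
    case False
    then show ?thesis using Cons.IH by (simp add: cls_Cons[of x w])
  qed
qed

declare add_bit_eq_xor [simp del]

definition word :: "bit \<Rightarrow> bit list \<Rightarrow> gen list" where
  "word c x = map (\<lambda>i. (i, i + c)) x"

lemma word_simps [simp]: "word c [] = []" "word c (i # x) = (i, i + c) # word c x"
  "word c (x @ y) = word c x @ word c y" "length (word c x) = length x" "map fst (word c x) = x"
  by (simp_all add: word_def comp_def)

lemma pure_word: "pure c' (word c x) \<longleftrightarrow> x = [] \<or> c = c'"
  by (induction x) auto

lemma pure_iff_word: "pure c w \<longleftrightarrow> w = word c (map fst w)"
  by (induction w) (auto simp: prod_eq_iff)

definition parity_unit :: "bit \<Rightarrow> suzuki_elem" where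
  "parity_unit c = cls (replicate (2 * N) (0, c))"

text \<open>Multiply 1 = e_0 + e_1 by the word: the unit of the other parity contributes only mixed
  products. For the empty word the claim would make one idempotent equal to 1.\<close>

lemma parity_unit_left: "x \<noteq> [] \<Longrightarrow> parity_unit c \<cdot> cls (word c x) = cls (word c x)"
proof -
  assume x: "x \<noteq> []"
  have zero: "parity_unit d \<cdot> cls (word c x) = \<zero>\<^bsub>A\<^esub>" if "d \<noteq> c" for d
    unfolding parity_unit_def cls_append[symmetric]
    using that x N by (intro cls_not_pure) (auto simp: pure_replicate pure_word)
  have "cls (word c x) = (parity_unit 0 \<boxplus> parity_unit 1) \<cdot> cls (word c x)"
    using cls_unit by (simp add: parity_unit_def)
  also have "\<dots> = parity_unit 0 \<cdot> cls (word c x) \<boxplus> parity_unit 1 \<cdot> cls (word c x)"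
    by (intro A.l_distr) (auto simp: parity_unit_def)
  also have "\<dots> = parity_unit c \<cdot> cls (word c x)"
    using zero[of 0] zero[of 1] by (cases "c = 0") (auto simp: parity_unit_def)
  finally show ?thesis ..
qed

lemma cls_replicate: "cls (replicate n x) = cls [x] [^]\<^bsub>A\<^esub> n"
proof (induction n)
  case (Suc n)
  have "replicate (Suc n) x = replicate n x @ [x]" by (simp add: replicate_append_same)
  then show ?case by (simp only: cls_append Suc A.nat_pow_Suc)
qed (simp add: cls_Nil)

lemma cls_letter: "cls [(i, i + c)] \<in> {cls [(0, c)], cls [(1, 1 + c)]}"
  by (cases "i = 0") auto

lemma cls_word_rev: "cls (word c x @ rev (word c x)) = cls [(0, c)] [^]\<^bsub>A\<^esub> (2 * length x)"
proof -
  interpret S: equal_squares A "cls [(0, c)]" "cls [(1, 1 + c)]"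
    by unfold_locales (use cls_squares[of c] in \<open>simp_all flip: cls_append\<close>)
  have "set (map (\<lambda>y. cls [y]) (word c x)) \<subseteq> {cls [(0, c)], cls [(1, 1 + c)]}"
    unfolding word_def using cls_letter by auto
  from S.list_mult_rev[OF this] show ?thesis
    by (simp only: cls_list_mult[of "word c x @ rev (word c x)"] map_append rev_map length_map word_simps)
qed

lemma square_pair_suzuki: "square_pair A (cls [(0, c)]) (cls [(1, 1 + c)]) N L (twist c 1)"
proof
  show "cls [(0, c)] \<cdot> cls [(0, c)] = cls [(1, 1 + c)] \<cdot> cls [(1, 1 + c)]"
    using cls_squares[of c] by (simp flip: cls_append)
  have e: "cls [(0, c)] [^]\<^bsub>A\<^esub> (2 * N) = parity_unit c"
    by (simp add: parity_unit_def cls_replicate)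
  show "cls [(0, c)] [^]\<^bsub>A\<^esub> (2 * N) \<cdot> cls [(0, c)] = cls [(0, c)]"
    using parity_unit_left[of "[0]" c] by (simp add: e)
  show "cls [(0, c)] [^]\<^bsub>A\<^esub> (2 * N) \<cdot> cls [(1, 1 + c)] = cls [(1, 1 + c)]"
    using parity_unit_left[of "[1]" c] by (simp add: e)
  let ?P = "alternating (0, c) (1, 1 + c) L" and ?P' = "alternating (1, 1 + c) (0, c) L"
  have "(cls [(0, c)] \<cdot> cls [(1, 1 + c)]) [^]\<^bsub>A\<^esub> k = cls (concat (replicate k [(0, c), (1, 1 + c)]))" for k
  proof (induction k)
    case (Suc k)
    have *: "concat (replicate (Suc k) [(0, c), (1, 1 + c)]) =
        concat (replicate k [(0, c), (1, 1 + c)]) @ ([(0, c)] @ [(1, 1 + c)])"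
      by (simp flip: replicate_append_same)
    show ?case unfolding * cls_append A.nat_pow_Suc Suc ..
  qed (simp add: cls_Nil)
  then have "(cls [(0, c)] \<cdot> cls [(1, 1 + c)]) [^]\<^bsub>A\<^esub> L = cls (alternating (0, c) (1, 1 + c) (L + L))"
    by (simp add: alternating_double mult_2[symmetric])
  \<comment> \<open>Of the alternating word of length 2L the first half is one side of the defining
    relation, and the second half is the reverse of the other side. Exchanging the first half leaves
    a word times its reverse, which collapses to g^(2L).\<close>
  also have "\<dots> = cls (?P @ rev ?P')"
    by (simp add: rev_alternating alternating_append_even alternating_append_odd)
  also have "\<dots> = twist c 1 \<star> cls (?P' @ rev ?P')"
    by (simp add: cls_append cls_alternating A.smult_mult_left)
  also have "?P' = word c (alternating 1 0 L)"
    by (simp add: word_def)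
  also have "cls (word c (alternating 1 0 L) @ rev (word c (alternating 1 0 L))) =
      cls [(0, c)] [^]\<^bsub>A\<^esub> (2 * L)"
    by (simp add: cls_word_rev)
  finally show "(cls [(0, c)] \<cdot> cls [(1, 1 + c)]) [^]\<^bsub>A\<^esub> L =
      twist c 1 \<star> cls [(0, c)] [^]\<^bsub>A\<^esub> (2 * L)" .
qed (use N L in auto)

end

section \<open>A basis, the regular character and the integral\<close>

text \<open>The Bezout coefficient u inverts s modulo M, so the only solution is the residue of - u
  k.\<close>

lemma coprime_dvd_linear_unique:
  fixes s k :: int
  assumes "M > 0" "coprime s (int M)"
  shows "\<exists>r<M. \<forall>m<M. int M dvd s * int m + k \<longleftrightarrow> m = r"
proof -
  obtain u v where uv: "u * s + v * int M = 1"
    using bezout_int[of s "int M"] assms(2) by (auto simp: coprime_iff_gcd_eq_1)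
  define r where "r = nat ((- u * k) mod int M)"
  have r: "int r = (- u * k) mod int M" "r < M"
    using assms(1) by (simp_all add: r_def nat_less_iff)
  have "int M dvd s * int m + k \<longleftrightarrow> m = r" if m: "m < M" for m
  proof -
    have us: "u * s = 1 - v * int M" using uv by simp
    have "coprime (int M) u"
    proof (rule coprimeI)
      fix w assume "w dvd int M" "w dvd u"
      then have "w dvd u * s + v * int M" by simp
      then show "is_unit w" unfolding uv .
    qed
    then have "int M dvd s * int m + k \<longleftrightarrow> int M dvd u * (s * int m + k)"
      by (rule coprime_dvd_mult_right_iff[symmetric])
    also have "u * (s * int m + k) = (int m - (- u * k)) + (- v * int m) * int M"
    proof -
      have "u * (s * int m + k) = (u * s) * int m + u * k" by (simp add: algebra_simps)
      then show ?thesis unfolding us by (simp add: algebra_simps)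
    qed
    also have "int M dvd \<dots> \<longleftrightarrow> int M dvd int m - (- u * k)"
      by (rule dvd_add_times_triv_right_iff)
    also have "\<dots> \<longleftrightarrow> int m mod int M = (- u * k) mod int M" by (simp add: mod_eq_dvd_iff)
    also have "\<dots> \<longleftrightarrow> m = r" unfolding r(1)[symmetric] using m by simp
    finally show ?thesis .
  qed
  then show ?thesis using r(2) by blast
qed

text \<open>Each of the g blocks of M consecutive integers contains exactly one solution.\<close>

lemma sum_coprime_dvd_linear:
  fixes s k :: int
  assumes "M > 0" "coprime s (int M)"
  shows "(\<Sum>m<g * M. of_bool (int M dvd s * int m + k)) = (of_nat g :: complex)"
proof (induction g)
  case (Suc g)
  have split: "(\<Sum>m<i + j. f m) = (\<Sum>m<i. f m) + (\<Sum>m<j. f (i + m))" for i j :: nat and f :: "nat \<Rightarrow> complex"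
    by (induction j) (simp_all add: add.assoc)
  have block: "(\<Sum>m<M. of_bool (int M dvd s * int (g * M + m) + k)) = (1 :: complex)"
  proof -
    obtain r where r: "r < M" "\<And>m. m < M \<Longrightarrow> int M dvd s * int m + k \<longleftrightarrow> m = r"
      using coprime_dvd_linear_unique[OF assms, of k] by blast
    have "int M dvd s * int (g * M + m) + k \<longleftrightarrow> m = r" if "m < M" for m
    proof -
      have "s * int (g * M + m) + k = (s * int m + k) + (s * int g) * int M"
        by (simp add: algebra_simps)
      then show ?thesis using r(2)[OF that] by (simp only: dvd_add_times_triv_right_iff)
    qed
    then have "(\<Sum>m<M. of_bool (int M dvd s * int (g * M + m) + k)) = (\<Sum>m<M. if m = r then 1 else (0 :: complex))"
      by (intro sum.cong) auto
    then show ?thesis using r(1) by simp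
  qed
  have "(\<Sum>m<Suc g * M. of_bool (int M dvd s * int m + k)) =
      (\<Sum>m<g * M. of_bool (int M dvd s * int m + k)) + (\<Sum>m<M. of_bool (int M dvd s * int (g * M + m) + k) :: complex)"
    using split[of "\<lambda>m. of_bool (int M dvd s * int m + k)" "g * M" M] by (simp add: add.commute)
  then show ?case using Suc block by simp
qed simp

lemma sum_of_bool_dvd:
  fixes s k :: int
  assumes "M > 0" "s = 1 \<or> s = - 1"
  shows "(\<Sum>m<M. of_bool (int M dvd s * int m + k)) = (1 :: complex)"
  using sum_coprime_dvd_linear[of M s k 1] assms by auto

lemma mod_add_right_cancel_nat:
  fixes x y b M :: nat
  assumes "(x + b) mod M = (y + b) mod M"
  shows "x mod M = y mod M"
proof -
  have "int (x + b) mod int M = int (y + b) mod int M"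
    using assms by (metis zmod_int)
  then have "int x mod int M = int y mod int M"
    by (simp add: mod_eq_dvd_iff)
  then show ?thesis by (metis of_nat_eq_iff zmod_int)
qed

section \<open>Normal forms and their dual coefficients\<close>

context suzuki
begin

text \<open>Each pair 0, 1 raises \<open>alt\<close> by one and the zeros do not change it, so this
  represents q^a g^m. The padding 2N(a + 1) fixes the length modulo 2N, prevents the natural
  subtraction from truncating, and leaves a positive number of zeros at the end.\<close>

definition normal_list :: "nat \<Rightarrow> nat \<Rightarrow> bit list" where
  "normal_list m a = concat (replicate a [0, 1]) @ replicate (m + 2 * N * (a + 1) - 2 * a) 0"

abbreviation bword where "bword c m a \<equiv> word c (normal_list m a)"

lemma double_le: "2 * a < 2 * N * (a + 1)"
  using N mult_le_mono1[of 1 N "2 * a"] by (simp add: algebra_simps)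

lemma length_normal_list: "length (normal_list m a) = m + 2 * N * (a + 1)"
proof -
  have "length (concat (replicate a [0, 1 :: bit])) = 2 * a" by (induction a) auto
  then show ?thesis using double_le[of a] by (simp add: normal_list_def)
qed

lemma normal_list_nonempty [simp]: "normal_list m a \<noteq> []"
  using length_normal_list[of m a] N by auto

lemma alt_normal_list: "alt (normal_list m a) = int a"
proof -
  have "alt (concat (replicate a [0, 1]) @ replicate j 0) = int a" for j
    by (induction a) (auto simp: alt_append)
  then show ?thesis by (simp add: normal_list_def)
qed

lemma word_coeff_word:
  "x \<noteq> [] \<Longrightarrow> word_coeff c' m a (word c x) =
    (if c = c' \<and> 2 * int N dvd int (length x) - m \<and> int L dvd alt x - a
     then twist c ((alt x - a) div int L) else 0)"
  by (auto simp: word_coeff_def pure_word)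

lemma int_dvd_diff_small:
  assumes "m < M" "m' < M" "int M dvd int m - int m'"
  shows "m = m'"
proof -
  have "int m mod int M = int m' mod int M" using assms(3) by (simp add: mod_eq_dvd_iff)
  then show ?thesis using assms by simp
qed

lemma word_coeff_bword:
  assumes "m < 2 * N" "a < L" "m' < 2 * N" "a' < L"
  shows "word_coeff c' (int m') (int a') (bword c m a) = of_bool (c = c' \<and> m = m' \<and> a = a')"
proof -
  have "2 * int N dvd int (length (normal_list m a)) - int m' \<longleftrightarrow> m = m'"
  proof -
    have "int (length (normal_list m a)) - int m' = int m - int m' + int (a + 1) * (2 * int N)"
      by (simp add: length_normal_list algebra_simps)
    then have "2 * int N dvd int (length (normal_list m a)) - int m' \<longleftrightarrow> 2 * int N dvd int m - int m'"
      by (simp only: dvd_add_times_triv_right_iff)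
    then show ?thesis
      using int_dvd_diff_small[of m "2 * N" m'] assms by auto
  qed
  moreover have "int L dvd int a - int a' \<longleftrightarrow> a = a'"
    using int_dvd_diff_small[of a L a'] assms by auto
  ultimately show ?thesis by (simp add: word_coeff_word alt_normal_list)
qed

definition acoeff :: "bit \<Rightarrow> nat \<Rightarrow> nat \<Rightarrow> suzuki_elem \<Rightarrow> complex" where
  "acoeff c m a = descend (coeff c (int m) (int a))"

lemma
  shows linear_map_acoeff: "linear_map A complex_numbers (acoeff c m a)"
    and acoeff_proj: "acoeff c m a (proj p) = coeff c (int m) (int a) p"
proof -
  have ker: "coeff c (int m) (int a) p = \<zero>\<^bsub>complex_numbers\<^esub>" if "p \<in> I" for p
    using coeff_ideal[OF that] by simp
  show "linear_map A complex_numbers (acoeff c m a)"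
    unfolding acoeff_def suzuki_algebra_def by (rule I.linear_map_descend[OF linear_map_coeff ker])
  show "acoeff c m a (proj p) = coeff c (int m) (int a) p"
    unfolding acoeff_def proj_def by (rule I.descend_coset[OF linear_map_coeff ker]) simp_all
qed

lemma acoeff_cls [simp]: "acoeff c m a (cls w) = word_coeff c (int m) (int a) w"
  by (simp add: cls_def acoeff_proj)

lemma acoeff_add: "\<lbrakk>x \<in> carrier A; y \<in> carrier A\<rbrakk> \<Longrightarrow> acoeff c m a (x \<boxplus> y) = acoeff c m a x + acoeff c m a y"
  and acoeff_smult: "x \<in> carrier A \<Longrightarrow> acoeff c m a (k \<star> x) = k * acoeff c m a x"
  and acoeff_finsum: "f \<in> S \<rightarrow> carrier A \<Longrightarrow> acoeff c m a (finsum A f S) = (\<Sum>s\<in>S. acoeff c m a (f s))"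
proof -
  interpret linear_map A complex_numbers "acoeff c m a" by (rule linear_map_acoeff)
  show "\<lbrakk>x \<in> carrier A; y \<in> carrier A\<rbrakk> \<Longrightarrow> acoeff c m a (x \<boxplus> y) = acoeff c m a x + acoeff c m a y"
    using map_add[of x y] by simp
  show "x \<in> carrier A \<Longrightarrow> acoeff c m a (k \<star> x) = k * acoeff c m a x"
    using map_smult[of x k] by simp
  show "f \<in> S \<rightarrow> carrier A \<Longrightarrow> acoeff c m a (finsum A f S) = (\<Sum>s\<in>S. acoeff c m a (f s))"
    using map_finsum[of f S] by simp
qed

text \<open>There are 4NL indices, the dimension of A.\<close>

definition Ix :: "(bit \<times> nat \<times> nat) set" where
  "Ix = {0, 1} \<times> {..<2 * N} \<times> {..<L}"

lemma finite_Ix [simp]: "finite Ix"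
  by (simp add: Ix_def)

abbreviation bcls :: "bit \<times> nat \<times> nat \<Rightarrow> suzuki_elem" where
  "bcls \<equiv> \<lambda>(c, m, a). cls (bword c m a)"

abbreviation bcoeff :: "bit \<times> nat \<times> nat \<Rightarrow> suzuki_elem \<Rightarrow> complex" where
  "bcoeff \<equiv> \<lambda>(c, m, a). acoeff c m a"

lemma bcoeff_bcls: "\<lbrakk>i \<in> Ix; j \<in> Ix\<rbrakk> \<Longrightarrow> bcoeff i (bcls j) = of_bool (i = j)"
  by (auto simp: Ix_def word_coeff_bword)

lemma cls_word_span:
  assumes "x \<noteq> []"
  shows "\<exists>s. \<exists>i\<in>Ix. cls (word c x) = s \<star> bcls i"
proof -
  interpret S: square_pair A "cls [(0, c)]" "cls [(1, 1 + c)]" N L "twist c 1"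
    by (rule square_pair_suzuki)
  have "list_mult A (map (\<lambda>y. cls [y]) (word c x)) = cls (word c x)"
    by (simp add: cls_list_mult[of "word c x"])
  moreover have "set (map (\<lambda>y. cls [y]) (word c x)) \<subseteq> {cls [(0, c)], cls [(1, 1 + c)]}"
    unfolding word_def using cls_letter by auto
  ultimately obtain s a j where aj: "a < L" "j > 0" "cls (word c x) = s \<star> S.W a j"
    using S.list_mult_bounded_normal_form[of "map (\<lambda>y. cls [y]) (word c x)"] assms
    by (auto simp: word_def)
  have W: "S.W a j = cls (word c (concat (replicate a [0, 1]) @ replicate j 0))" for a j
  proof -
    have "(cls [(0, c)] \<cdot> cls [(1, 1 + c)]) [^]\<^bsub>A\<^esub> a = cls (word c (concat (replicate a [0, 1])))" for a
    proof (induction a)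
      case (Suc a)
      have *: "word c (concat (replicate (Suc a) [0, 1])) =
          word c (concat (replicate a [0, 1])) @ ([(0, c)] @ [(1, 1 + c)])"
        by (simp flip: replicate_append_same)
      show ?case unfolding * cls_append A.nat_pow_Suc Suc ..
    qed (simp add: cls_Nil)
    moreover have "word c (replicate j 0) = replicate j (0, c)" by (simp add: word_def)
    ultimately show ?thesis
      by (simp add: S.W_def cls_append cls_replicate)
  qed
  \<comment> \<open>\<open>S.W a j\<close> is a word of length j + 2a, and m records the length
    modulo 2N.\<close>
  let ?m = "(j + 2 * a) mod (2 * N)"
  have pos: "?m + 2 * N * (a + 1) - 2 * a > 0" using double_le[of a] by simp
  have "S.W a j = S.W a (?m + 2 * N * (a + 1) - 2 * a)"
  proof (rule S.W_cong[OF aj(2) pos])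
    have eq: "?m + 2 * N * (a + 1) - 2 * a + 2 * a = ?m + 2 * N * (a + 1)"
      using double_le[of a] by simp
    have "(?m + 2 * N * (a + 1) - 2 * a + 2 * a) mod (2 * N) = (j + 2 * a) mod (2 * N)"
      by (simp only: eq mod_mult_self2 mod_mod_trivial)
    then show "j mod (2 * N) = (?m + 2 * N * (a + 1) - 2 * a) mod (2 * N)"
      by (rule mod_add_right_cancel_nat[symmetric])
  qed
  then have "cls (word c x) = s \<star> bcls (c, ?m, a)"
    using aj(3) by (simp add: W normal_list_def)
  moreover have "(c, ?m, a) \<in> Ix" using aj(1) N by (auto simp: Ix_def)
  ultimately show ?thesis by blast
qed

text \<open>E is linear and fixes the normal forms by duality. Nonempty words of one parity are
  multiples of normal forms, other nonempty words vanish, and so E fixes everything.\<close>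

lemma expansion:
  assumes "X \<in> carrier A"
  shows "X = (\<Oplus>\<^bsub>A\<^esub>i\<in>Ix. bcoeff i X \<star> bcls i)"
proof -
  define E where "E X = (\<Oplus>\<^bsub>A\<^esub>i\<in>Ix. bcoeff i X \<star> bcls i)" for X
  have cl: "bcls i \<in> carrier A" for i by (cases i) simp
  have "linear_map A A E"
  proof
    fix X Y k assume X: "X \<in> carrier A" and Y: "Y \<in> carrier A"
    show "E X \<in> carrier A" unfolding E_def using cl by (intro A.finsum_closed) auto
    have "E (X \<boxplus> Y) = (\<Oplus>\<^bsub>A\<^esub>i\<in>Ix. bcoeff i X \<star> bcls i \<boxplus> bcoeff i Y \<star> bcls i)"
      unfolding E_def using X Y cl
      by (intro A.finsum_cong') (auto simp: acoeff_add A.smult_add_left)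
    also have "\<dots> = E X \<boxplus> E Y"
      unfolding E_def using cl by (intro A.finsum_addf) auto
    finally show "E (X \<boxplus> Y) = E X \<boxplus> E Y" .
    have "E (k \<star> X) = (\<Oplus>\<^bsub>A\<^esub>i\<in>Ix. k \<star> (bcoeff i X \<star> bcls i))"
      unfolding E_def using X cl by (intro A.finsum_cong') (auto simp: acoeff_smult A.smult_smult)
    also have "\<dots> = k \<star> E X"
      unfolding E_def using cl by (intro A.smult_finsum[symmetric]) auto
    finally show "E (k \<star> X) = k \<star> E X" .
  qed
  then interpret E: linear_map A A E .
  have basis: "E (bcls j) = bcls j" if "j \<in> Ix" for j
  proof -
    have "E (bcls j) = (\<Oplus>\<^bsub>A\<^esub>i\<in>Ix. if j = i then bcls i else \<zero>\<^bsub>A\<^esub>)"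
      unfolding E_def
    proof (rule A.finsum_cong')
      fix i assume "i \<in> Ix"
      then show "bcoeff i (bcls j) \<star> bcls i = (if j = i then bcls i else \<zero>\<^bsub>A\<^esub>)"
        using bcoeff_bcls[OF _ that, of i] cl[of i] by auto
    qed (use cl in auto)
    also have "\<dots> = bcls j" by (rule A.add.finprod_singleton) (use that cl in auto)
    finally show ?thesis .
  qed
  have word: "E (cls (word c x)) = cls (word c x)" if x: "x \<noteq> []" for c x
  proof -
    obtain s i where "i \<in> Ix" "cls (word c x) = s \<star> bcls i" using cls_word_span[OF x] by blast
    then show ?thesis using E.map_smult[OF cl, of s i] basis by simp
  qed
  have cls: "E (cls w) = cls w" for w
  proof (cases "w = []")
    case True
    \<comment> \<open>The unit is no multiple of a single normal form; it is split into the two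
      parity units, which are nonempty words.\<close>
    have "cls [] = cls (word 0 (replicate (2 * N) 0)) \<boxplus> cls (word 1 (replicate (2 * N) 0))"
      using cls_unit by (simp add: cls_Nil word_def)
    then show ?thesis using True E.map_add word N by simp
  next
    case False
    show ?thesis
    proof (cases "\<exists>c. pure c w")
      case True
      then obtain c where "w = word c (map fst w)" using pure_iff_word by blast
      then show ?thesis using word[of "map fst w" c] False by simp
    next
      case nonpure: False
      then show ?thesis using cls_not_pure[of w] by simp
    qed
  qed
  obtain p where p: "X = proj p" using assms carrier_A by auto
  have "E (proj p) = proj p"
    using subset_UNIV[of "keys p"]
  proof (induction p rule: poly_mapping_span_induct)
    case zero
    have "proj 0 = \<zero>\<^bsub>A\<^esub>" using proj.map_zero by (simp del: proj.map_zero)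
    then show ?case by simp
  next
    case (add p q)
    then show ?case by (simp add: proj_add E.map_add)
  next
    case (single w k)
    show ?case using E.map_smult[of "cls w" k] cls by (simp add: proj_single)
  qed
  then show ?thesis using p by (simp add: E_def)
qed

lemma A_eqI:
  assumes "X \<in> carrier A" "Y \<in> carrier A" "\<And>i. i \<in> Ix \<Longrightarrow> bcoeff i X = bcoeff i Y"
  shows "X = Y"
proof -
  have "X = (\<Oplus>\<^bsub>A\<^esub>i\<in>Ix. bcoeff i X \<star> bcls i)" by (rule expansion) fact
  also have "\<dots> = (\<Oplus>\<^bsub>A\<^esub>i\<in>Ix. bcoeff i Y \<star> bcls i)"
    using assms(3) by (intro A.finsum_cong') auto
  also have "\<dots> = Y" by (rule expansion[symmetric]) fact
  finally show ?thesis .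
qed

section \<open>The regular character, the counit and the integral\<close>

lemma linear_map_left_mult: "h \<in> carrier A \<Longrightarrow> linear_map A A (\<lambda>x. h \<cdot> x)"
  by unfold_locales (auto simp: A.r_distr A.smult_mult_right)

lemma regular_character_eq:
  assumes "h \<in> carrier A"
  shows "regular_character A h = (\<Sum>i\<in>Ix. bcoeff i (h \<cdot> bcls i))"
  unfolding regular_character_def
proof (rule A.endo_trace_dual_family[OF linear_map_left_mult[OF assms] finite_Ix])
  fix i j assume "i \<in> Ix" "j \<in> Ix"
  then show "bcoeff i (bcls j) = of_bool (i = j)" by (rule bcoeff_bcls)
next
  fix X assume "X \<in> carrier A"
  then show "X = (\<Oplus>\<^bsub>A\<^esub>i\<in>Ix. bcoeff i X \<star> bcls i)" by (rule expansion)
qed (auto simp: linear_map_acoeff)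

lemma linear_map_regular_character: "linear_map A complex_numbers (regular_character A)"
  by (intro linear_map.intro linear_map_axioms.intro A.complex_space_axioms
      complex_space_complex_numbers)
    (auto simp: regular_character_eq A.l_distr A.smult_mult_left acoeff_add acoeff_smult
      sum.distrib sum_distrib_left case_prod_unfold)

text \<open>Left multiplication by the word translates the normal forms of its own parity, up to
  scalars, and kills the others. A diagonal entry is nonzero only if the word is a multiple of its
  parity unit, and then all 2NL entries agree.\<close>

lemma regular_character_word:
  assumes "x \<noteq> []"
  shows "regular_character A (cls (word c x)) =
    (if 2 * N dvd length x \<and> int L dvd alt x then of_nat (2 * N * L) * twist c (alt x div int L) else 0)"
proof -
  have summand: "bcoeff (c', m, a) (cls (word c x) \<cdot> bcls (c', m, a)) =
      (if c' = c \<and> 2 * N dvd length x \<and> int L dvd alt x then twist c (alt x div int L) else 0)" for c' m a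
  proof -
    have "2 * int N dvd int (length (x @ normal_list m a)) - int m \<longleftrightarrow> 2 * N dvd length x"
    proof -
      have "int (length (x @ normal_list m a)) - int m = int (length x) + int (a + 1) * (2 * int N)"
        by (simp add: length_normal_list algebra_simps)
      then show ?thesis
        by (simp only: dvd_add_times_triv_right_iff)
          (metis int_dvd_int_iff of_nat_mult of_nat_numeral)
    qed
    \<comment> \<open>Divisibility by 2N makes the length even, so the word passes the exponent a
      without a sign and a cancels.\<close>
    moreover have "alt (x @ normal_list m a) - int a = alt x" if "2 * N dvd length x"
    proof -
      have "even (length x)" using that by (meson dvd_trans dvd_triv_left)
      then show ?thesis by (simp add: alt_append alt_normal_list)
    qed
    moreover have "cls (word c x) \<cdot> bcls (c, m, a) = cls (word c (x @ normal_list m a))"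
      by (simp add: cls_append)
    moreover have "word_coeff c' (int m) (int a) (word c x @ bword c' m a) = 0" if "c \<noteq> c'"
      using assms that by (auto simp: word_coeff_def pure_word)
    ultimately show ?thesis
      using word_coeff_word[of "x @ normal_list m a" c "int m" "int a" c]
      by (cases "c' = c") (auto simp: cls_append[symmetric] simp del: word_simps(3))
  qed
  have "regular_character A (cls (word c x)) =
      (\<Sum>c'\<in>{0, 1}. \<Sum>m<2 * N. \<Sum>a<L. bcoeff (c', m, a) (cls (word c x) \<cdot> bcls (c', m, a)))"
    unfolding regular_character_eq[OF cls_closed] Ix_def by (simp add: sum.cartesian_product case_prod_unfold)
  also have "\<dots> = (if 2 * N dvd length x \<and> int L dvd alt x then of_nat (2 * N * L) * twist c (alt x div int L) else 0)"
    unfolding summand by (cases "c = 0") auto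
  finally show ?thesis .
qed

text \<open>Two-sided translation invariance of the sum over the group of parity 0. For fixed m' the
  exponent a' enters with coefficient 1 or -1, so one a' is hit; after that one m' remains.\<close>

lemma sum_word_coeff_bword:
  "(\<Sum>m'<2 * N. \<Sum>a'<L. word_coeff c m a (u @ bword 0 m' a' @ v)) =
    of_bool (c = 0 \<and> pure 0 u \<and> pure 0 v)"
proof (cases "c = 0 \<and> pure 0 u \<and> pure 0 v")
  case True
  have "word_coeff c m a (u @ bword 0 m' a' @ v) =
      of_bool (int (2 * N) dvd 1 * int m' + (int (length u) + int (length v) - m)) *
      of_bool (int L dvd (- 1) ^ length u * int a' +
        (alt (map fst u) + (- 1) ^ (length u + m') * alt (map fst v) - a))" for m' a'
  proof -
    have "int (length (u @ bword 0 m' a' @ v)) - m =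
        1 * int m' + (int (length u) + int (length v) - m) + int (a' + 1) * int (2 * N)"
      by (simp add: length_normal_list algebra_simps)
    then have 1: "2 * int N dvd int (length (u @ bword 0 m' a' @ v)) - m \<longleftrightarrow>
        int (2 * N) dvd 1 * int m' + (int (length u) + int (length v) - m)"
      by (simp only: dvd_add_times_triv_right_iff of_nat_mult of_nat_numeral)
    have "((- 1) ^ length (normal_list m' a') :: int) = (- 1) ^ m'"
      by (simp add: length_normal_list minus_one_power_iff)
    then have 2: "alt (map fst (u @ bword 0 m' a' @ v)) - a = (- 1) ^ length u * int a' +
        (alt (map fst u) + (- 1) ^ (length u + m') * alt (map fst v) - a)"
      by (simp add: alt_append alt_normal_list power_add algebra_simps)
    show ?thesis
      unfolding word_coeff_def 1 2 using True by (simp add: pure_word)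
  qed
  then have "(\<Sum>m'<2 * N. \<Sum>a'<L. word_coeff c m a (u @ bword 0 m' a' @ v)) =
      (\<Sum>m'<2 * N. of_bool (int (2 * N) dvd 1 * int m' + (int (length u) + int (length v) - m)) *
        (\<Sum>a'<L. of_bool (int L dvd (- 1) ^ length u * int a' +
        (alt (map fst u) + (- 1) ^ (length u + m') * alt (map fst v) - a))))"
    by (simp only: sum_distrib_left)
  also have "\<dots> = (\<Sum>m'<2 * N. of_bool (int (2 * N) dvd 1 * int m' + (int (length u) + int (length v) - m)))"
    using L by (subst sum_of_bool_dvd) (auto simp: minus_one_power_iff)
  also have "\<dots> = 1" using N by (intro sum_of_bool_dvd) auto
  finally show ?thesis using True by simp
next
  case False
  then have "word_coeff c m a (u @ bword 0 m' a' @ v) = 0" for m' a'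
    by (auto simp: word_coeff_def pure_word)
  then show ?thesis using False by simp
qed

abbreviation eps :: "suzuki_elem \<Rightarrow> complex" where "eps \<equiv> suzuki_counit N L 1 \<beta>"

lemma prod_list_pure: "(\<Prod>(i, j)\<leftarrow>w. if i = j then 1 else 0) = (of_bool (pure 0 w) :: complex)"
  by (induction w) auto

text \<open>A word of parity 0 has exactly one nonzero coefficient of parity 0, and it equals 1. The
  counit is thus a sum of functionals already known to kill the ideal.\<close>

lemma sum_word_coeff: "(\<Sum>m<2 * N. \<Sum>a<L. word_coeff 0 (int m) (int a) w) = of_bool (pure 0 w)"
proof (cases "pure 0 w")
  case True
  have "word_coeff 0 (int m) (int a) w =
      of_bool (int (2 * N) dvd - 1 * int m + int (length w)) * of_bool (int L dvd - 1 * int a + alt (map fst w))" for m a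
    using True by (simp add: word_coeff_def)
  then have "(\<Sum>m<2 * N. \<Sum>a<L. word_coeff 0 (int m) (int a) w) =
      (\<Sum>m<2 * N. of_bool (int (2 * N) dvd - 1 * int m + int (length w)) *
        (\<Sum>a<L. of_bool (int L dvd - 1 * int a + alt (map fst w))))"
    by (simp only: sum_distrib_left)
  also have "\<dots> = (\<Sum>m<2 * N. of_bool (int (2 * N) dvd - 1 * int m + int (length w)))"
    using L by (subst sum_of_bool_dvd) auto
  also have "\<dots> = 1" using N by (intro sum_of_bool_dvd) auto
  finally show ?thesis using True by simp
qed (simp add: word_coeff_def)

lemma
  shows linear_map_eps: "linear_map A complex_numbers eps"
    and eps_cls: "eps (cls w) = of_bool (pure 0 w)"
proof -
  let ?e = "lin_ext complex_numbers (\<lambda>w. of_bool (pure 0 w))"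
  have eps: "eps = descend ?e"
    unfolding suzuki_counit_def prod_list_pure lin_ext_def by simp
  have lin: "linear_map F complex_numbers ?e"
    unfolding free_algebra_eq
    by (rule complex_space.linear_map_lin_ext[OF complex_space_complex_numbers monoid_lists]) simp
  have e: "?e p = (\<Sum>m<2 * N. \<Sum>a<L. coeff 0 (int m) (int a) p)" for p
    using subset_UNIV[of "keys p"]
  proof (induction p rule: poly_mapping_span_induct)
    case zero
    show ?case using linear_map.map_zero[OF lin] by simp
  next
    case (add p q)
    then show ?case using linear_map.map_add[OF lin, of p q] by (simp add: coeff_add sum.distrib)
  next
    case (single w k)
    show ?case
      by (simp add: complex_space.lin_ext_single[OF complex_space_complex_numbers]
          sum_word_coeff[symmetric] sum_distrib_left)
  qed
  have ker: "?e p = \<zero>\<^bsub>complex_numbers\<^esub>" if "p \<in> I" for p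
    using coeff_ideal[OF that] by (simp add: e)
  show "linear_map A complex_numbers eps"
    unfolding eps suzuki_algebra_def by (rule I.linear_map_descend[OF lin ker])
  have "eps (cls w) = ?e (mon w)"
    unfolding eps cls_def proj_def by (rule I.descend_coset[OF lin ker]) simp_all
  then show "eps (cls w) = of_bool (pure 0 w)"
    by (simp add: complex_space.lin_ext_single[OF complex_space_complex_numbers])
qed

definition integral :: suzuki_elem where
  "integral = (1 / of_nat (2 * N * L)) \<star> (\<Oplus>\<^bsub>A\<^esub>i\<in>{..<2 * N} \<times> {..<L}. cls (bword 0 (fst i) (snd i)))"

lemma integral_closed [simp, intro]: "integral \<in> carrier A"
  unfolding integral_def by (intro A.smult_closed A.finsum_closed) auto

lemma acoeff_cls_integral:
  "acoeff c m a (cls u \<cdot> integral \<cdot> cls v) = of_bool (c = 0 \<and> pure 0 u \<and> pure 0 v) / of_nat (2 * N * L)"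
proof -
  let ?S = "{..<2 * N} \<times> {..<L}"
  have "(\<lambda>x. cls u \<cdot> x \<cdot> cls v) (\<Oplus>\<^bsub>A\<^esub>i\<in>?S. cls (bword 0 (fst i) (snd i))) =
      (\<Oplus>\<^bsub>A\<^esub>i\<in>?S. cls (u @ bword 0 (fst i) (snd i) @ v))"
  proof -
    interpret l: linear_map A A "\<lambda>x. cls u \<cdot> x \<cdot> cls v"
      by unfold_locales (auto simp: A.r_distr A.l_distr A.smult_mult_right A.smult_mult_left)
    show ?thesis
      by (subst l.map_finsum) (auto simp: cls_append A.m_assoc case_prod_unfold)
  qed
  then have "cls u \<cdot> integral \<cdot> cls v =
      (1 / of_nat (2 * N * L)) \<star> (\<Oplus>\<^bsub>A\<^esub>i\<in>?S. cls (u @ bword 0 (fst i) (snd i) @ v))"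
    unfolding integral_def
    by (subst A.smult_mult_right; (subst A.smult_mult_left)?) (auto intro!: A.finsum_closed)
  then have "acoeff c m a (cls u \<cdot> integral \<cdot> cls v) =
      (1 / of_nat (2 * N * L)) * (\<Sum>(m', a')\<in>?S. word_coeff c (int m) (int a) (u @ bword 0 m' a' @ v))"
    by (subst acoeff_smult[symmetric] | simp add: acoeff_smult acoeff_finsum case_prod_unfold)+
  then show ?thesis
    using sum_word_coeff_bword[of c "int m" "int a" u v] by (simp add: sum.cartesian_product)
qed

lemma cls_integral: "cls u \<cdot> integral \<cdot> cls v = (eps (cls u) * eps (cls v)) \<star> integral"
proof (rule A_eqI)
  fix i assume "i \<in> Ix"
  have "acoeff c m a integral = of_bool (c = 0) / of_nat (2 * N * L)" for c m a
    using acoeff_cls_integral[of c m a "[]" "[]"] by (simp add: cls_Nil)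
  then show "bcoeff i (cls u \<cdot> integral \<cdot> cls v) =
      bcoeff i ((eps (cls u) * eps (cls v)) \<star> integral)"
    using N L by (cases i) (auto simp: acoeff_cls_integral acoeff_smult eps_cls)
qed auto

lemma integral_absorbs:
  assumes "h \<in> carrier A"
  shows "h \<cdot> integral = eps h \<star> integral" "integral \<cdot> h = eps h \<star> integral"
proof -
  interpret e: linear_map A complex_numbers eps by (rule linear_map_eps)
  obtain p where p: "h = proj p" using assms carrier_A by auto
  have "proj p \<cdot> integral = eps (proj p) \<star> integral \<and>
      integral \<cdot> proj p = eps (proj p) \<star> integral"
    using subset_UNIV[of "keys p"]
  proof (induction p rule: poly_mapping_span_induct)
    case zero
    have "proj 0 = \<zero>\<^bsub>A\<^esub>" using proj.map_zero by (simp del: proj.map_zero)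
    then show ?case using e.map_zero by simp
  next
    case (add p q)
    then show ?case
      using e.map_add[of "proj p" "proj q"]
      by (simp add: proj_add A.l_distr A.r_distr A.smult_add_left)
  next
    case (single w k)
    have "cls w \<cdot> integral = eps (cls w) \<star> integral"
      "integral \<cdot> cls w = eps (cls w) \<star> integral"
      using cls_integral[of w "[]"] cls_integral[of "[]" w] eps_cls[of "[]"] by (simp_all add: cls_Nil)
    then show ?case
      using e.map_smult[of "cls w" k]
      by (simp add: proj_single A.smult_mult_left A.smult_mult_right A.smult_smult)
  qed
  then show "h \<cdot> integral = eps h \<star> integral" "integral \<cdot> h = eps h \<star> integral"
    by (simp_all add: p)
qed

lemma eps_integral: "eps integral = 1"
proof -
  interpret e: linear_map A complex_numbers eps by (rule linear_map_eps)
  have "eps integral = (1 / of_nat (2 * N * L)) * (\<Sum>(m, a)\<in>{..<2 * N} \<times> {..<L}. eps (cls (bword 0 m a)))"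
    unfolding integral_def
    by (subst e.map_smult; (subst e.map_finsum)?) (auto simp: case_prod_unfold)
  also have "\<dots> = 1" using N L by (simp add: eps_cls pure_word case_prod_unfold)
  finally show ?thesis .
qed

end

section \<open>The Hopf algebra structure\<close>

lemma complex_algebra_more_cong:
  assumes "complex_algebra R" "carrier S = carrier R" "mult S = mult R" "one S = one R"
    "zero S = zero R" "add S = add R" "smult S = smult R"
  shows "complex_algebra S"
proof -
  interpret R: complex_algebra R by fact
  have ring: "ring S" by (rule ring_more_cong[OF R.ring_axioms assms(2-6)])
  then interpret S: ring S .
  show ?thesis
    by unfold_locales
      (simp_all add: assms R.smult_add_left R.smult_add_right R.smult_smult
        R.smult_mult_left R.smult_mult_right)
qed

lemma finsum_more_cong:
  assumes "abelian_group R" "abelian_group S" "carrier S = carrier R" "zero S = zero R" "add S = add R"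
    and f: "f \<in> X \<rightarrow> carrier R"
  shows "finsum S f X = finsum R f X"
proof -
  interpret R: abelian_group R by fact
  interpret S: abelian_group S by fact
  show ?thesis using f
    by (induction X rule: infinite_finite_induct)
      (simp_all add: R.finsum_infinite S.finsum_infinite assms(3-5) Pi_iff)
qed

lemma linear_map_more_cong:
  assumes "linear_map V W f" "complex_space V'" "carrier V' = carrier V" "add V' = add V" "smult V' = smult V"
  shows "linear_map V' W f"
proof -
  interpret f: linear_map V W f by fact
  interpret V': complex_space V' by fact
  show ?thesis
    by unfold_locales (simp_all add: assms f.map_add f.map_smult)
qed

context complex_algebra
begin

abbreviation tensor2 :: "'a \<Rightarrow> 'a \<Rightarrow> 'a tensor" where
  "tensor2 a b \<equiv> pure_tensor V [a, b]"

abbreviation T2 where "T2 \<equiv> tensor_power V 2"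

lemma tensor2_closed [simp, intro]:
  "\<lbrakk>a \<in> carrier V; b \<in> carrier V\<rbrakk> \<Longrightarrow> tensor2 a b \<in> carrier T2"
  by (rule pure_tensor_closed) auto

lemma
  assumes "a \<in> carrier V" "b \<in> carrier V" "c \<in> carrier V"
  shows tensor2_add_left: "tensor2 (a \<oplus> b) c = tensor2 a c \<oplus>\<^bsub>T2\<^esub> tensor2 b c"
    and tensor2_add_right: "tensor2 c (a \<oplus> b) = tensor2 c a \<oplus>\<^bsub>T2\<^esub> tensor2 c b"
proof -
  note add = multilinear_pure_tensor[of 2, unfolded multilinear_def, THEN conjunct2, THEN conjunct1, rule_format]
  show "tensor2 (a \<oplus> b) c = tensor2 a c \<oplus>\<^bsub>T2\<^esub> tensor2 b c"
    using add[of "[]" "[c]" a b] assms by simp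
  show "tensor2 c (a \<oplus> b) = tensor2 c a \<oplus>\<^bsub>T2\<^esub> tensor2 c b"
    using add[of "[c]" "[]" a b] assms by simp
qed

lemma
  assumes "a \<in> carrier V" "b \<in> carrier V"
  shows tensor2_smult_left: "tensor2 (k \<odot> a) b = k \<odot>\<^bsub>T2\<^esub> tensor2 a b"
    and tensor2_smult_right: "tensor2 b (k \<odot> a) = k \<odot>\<^bsub>T2\<^esub> tensor2 b a"
proof -
  note smult = multilinear_pure_tensor[of 2, unfolded multilinear_def, THEN conjunct2, THEN conjunct2, rule_format]
  show "tensor2 (k \<odot> a) b = k \<odot>\<^bsub>T2\<^esub> tensor2 a b"
    using smult[of "[]" "[b]" a k] assms by simp
  show "tensor2 b (k \<odot> a) = k \<odot>\<^bsub>T2\<^esub> tensor2 b a"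
    using smult[of "[b]" "[]" a k] assms by simp
qed

lemma tensor2_mult:
  "\<lbrakk>a \<in> carrier V; b \<in> carrier V; c \<in> carrier V; d \<in> carrier V\<rbrakk> \<Longrightarrow>
    tensor2 a b \<otimes>\<^bsub>T2\<^esub> tensor2 c d = tensor2 (a \<otimes> c) (b \<otimes> d)"
  using pure_tensor_mult[of "[a, b]" 2 "[c, d]"] by simp

lemma tensor2_one: "\<one>\<^bsub>T2\<^esub> = tensor2 \<one> \<one>"
  using one_tensor_power[of 2] by (simp add: numeral_2_eq_2)

lemma tensor2_zero:
  assumes "a \<in> carrier V"
  shows "tensor2 \<zero> a = \<zero>\<^bsub>T2\<^esub>" "tensor2 a \<zero> = \<zero>\<^bsub>T2\<^esub>"
proof -
  interpret T: complex_algebra T2 by (rule complex_algebra_tensor_power)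
  show "tensor2 \<zero> a = \<zero>\<^bsub>T2\<^esub>" using tensor2_smult_left[of \<zero> a 0] assms by simp
  show "tensor2 a \<zero> = \<zero>\<^bsub>T2\<^esub>" using tensor2_smult_right[of \<zero> a 0] assms by simp
qed

end

section \<open>The coproduct of a word and its well-definedness\<close>

context suzuki
begin

abbreviation T where "T \<equiv> tensor_power A 2"
abbreviation P where "P a b \<equiv> pure_tensor A [a, b]"

sublocale T: complex_algebra T
  by (rule A.complex_algebra_tensor_power)

definition gen_comult :: "gen \<Rightarrow> suzuki_elem tensor" where
  "gen_comult = (\<lambda>(i, j). P (cls [(i, 0)]) (cls [(0, j)]) \<oplus>\<^bsub>T\<^esub> P (cls [(i, 1)]) (cls [(1, j)]))"

definition word_comult :: "gen list \<Rightarrow> suzuki_elem tensor" where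
  "word_comult w = list_mult T (map gen_comult w)"

lemma suzuki_comult_eq: "suzuki_comult N L 1 \<beta> = descend (lin_ext T word_comult)"
proof -
  have gen: "suzuki_gen N L 1 \<beta> i j = cls [(i, j)]" for i j
    by (simp add: suzuki_gen_def cls_def proj_def)
  show ?thesis
    by (simp add: suzuki_comult_def Let_def gen word_comult_def[abs_def] gen_comult_def)
qed

lemma gen_comult_closed [simp, intro]: "gen_comult x \<in> carrier T"
  unfolding gen_comult_def by (cases x) auto

lemma word_comult_closed [simp, intro]: "word_comult w \<in> carrier T"
  unfolding word_comult_def by (rule T.list_mult_closed) auto

lemma word_comult_append: "word_comult (u @ v) = word_comult u \<otimes>\<^bsub>T\<^esub> word_comult v"
  unfolding word_comult_def map_append by (rule T.list_mult_append) auto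

text \<open>The intermediate index of the coproduct of x_ij is written as i + d. In this
  parametrisation all left factors with the same d have the same parity d, whatever i is;
  \<open>rword\<close> gives the matching right factor.\<close>

definition lword :: "bit \<Rightarrow> gen list \<Rightarrow> gen list" where
  "lword d = map (\<lambda>(i, j). (i, i + d))"

definition rword :: "bit \<Rightarrow> gen list \<Rightarrow> gen list" where
  "rword d = map (\<lambda>(i, j). (i + d, j))"

lemma lrword_simps [simp]: "lword d [] = []" "rword d [] = []"
  "lword d (x # w) = (fst x, fst x + d) # lword d w" "rword d (x # w) = (fst x + d, snd x) # rword d w"
  by (auto simp: lword_def rword_def case_prod_unfold)

lemma gen_comult_eq: "gen_comult (i, j) = P (cls (lword 0 [(i, j)])) (cls (rword 0 [(i, j)])) \<oplus>\<^bsub>T\<^esub>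
    P (cls (lword 1 [(i, j)])) (cls (rword 1 [(i, j)]))"
  by (cases "i = 0") (simp_all add: gen_comult_def T.a_comm)

text \<open>Choosing d for each letter gives 2^length terms. Those in which d changes have a left
  factor of mixed parity and vanish. The empty word is different, its coproduct being the single
  term 1 \<otimes> 1.\<close>

lemma word_comult_eq:
  assumes "w \<noteq> []"
  shows "word_comult w = P (cls (lword 0 w)) (cls (rword 0 w)) \<oplus>\<^bsub>T\<^esub> P (cls (lword 1 w)) (cls (rword 1 w))"
  using assms
proof (induction w rule: list_nonempty_induct)
  case (single x)
  then show ?case using gen_comult_eq[of "fst x" "snd x"] by (simp add: word_comult_def del: lrword_simps)
next
  case (cons x w)
  let ?l = "\<lambda>d. cls (lword d [x])" and ?r = "\<lambda>d. cls (rword d [x])"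
  let ?l' = "\<lambda>d. cls (lword d w)" and ?r' = "\<lambda>d. cls (rword d w)"
  have l: "?l d \<cdot> ?l' d = cls (lword d (x # w))" "?r d \<cdot> ?r' d = cls (rword d (x # w))" for d
    by (simp_all flip: cls_append)
  have cross: "?l d \<cdot> ?l' d' = \<zero>\<^bsub>A\<^esub>" if "d \<noteq> d'" for d d'
  proof -
    obtain y v where w: "w = y # v" using cons(1) by (cases w) auto
    have "\<not> pure c (lword d [x] @ lword d' w)" for c
      using that by (auto simp: w)
    then show ?thesis unfolding cls_append[symmetric] by (rule cls_not_pure)
  qed
  have "word_comult (x # w) = gen_comult x \<otimes>\<^bsub>T\<^esub> word_comult w"
    by (simp add: word_comult_def)
  also have "gen_comult x = P (?l 0) (?r 0) \<oplus>\<^bsub>T\<^esub> P (?l 1) (?r 1)"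
    using gen_comult_eq[of "fst x" "snd x"] by (simp del: lrword_simps)
  also have "(P (?l 0) (?r 0) \<oplus>\<^bsub>T\<^esub> P (?l 1) (?r 1)) \<otimes>\<^bsub>T\<^esub> word_comult w =
      (P (?l 0) (?r 0) \<otimes>\<^bsub>T\<^esub> P (?l' 0) (?r' 0) \<oplus>\<^bsub>T\<^esub> P (?l 1) (?r 1) \<otimes>\<^bsub>T\<^esub> P (?l' 0) (?r' 0)) \<oplus>\<^bsub>T\<^esub>
      (P (?l 0) (?r 0) \<otimes>\<^bsub>T\<^esub> P (?l' 1) (?r' 1) \<oplus>\<^bsub>T\<^esub> P (?l 1) (?r 1) \<otimes>\<^bsub>T\<^esub> P (?l' 1) (?r' 1))"
    unfolding cons(2) by (simp only: T.l_distr T.r_distr A.tensor2_closed cls_closed T.a_closed)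
  also have "\<dots> = P (?l 0 \<cdot> ?l' 0) (?r 0 \<cdot> ?r' 0) \<oplus>\<^bsub>T\<^esub> P (?l 1 \<cdot> ?l' 1) (?r 1 \<cdot> ?r' 1)"
    using cross[of 0 1] cross[of 1 0]
    by (simp add: A.tensor2_mult A.tensor2_zero del: lrword_simps)
  finally show ?case by (simp only: l)
qed

lemma lrword_alternating [simp]:
  "lword d (alternating x y n) = alternating (fst x, fst x + d) (fst y, fst y + d) n"
  "rword d (alternating x y n) = alternating (fst x + d, snd x) (fst y + d, snd y) n"
  by (simp_all add: lword_def rword_def case_prod_unfold)

lemma lrword_replicate [simp]:
  "lword d (replicate n x) = replicate n (fst x, fst x + d)"
  "rword d (replicate n x) = replicate n (fst x + d, snd x)"
  by (simp_all add: lword_def rword_def case_prod_unfold)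

lemma cls_squares_shift: "cls [(d, c + d), (d, c + d)] = cls [(0, c), (0, c)]"
  by (cases "d = 0") (use cls_squares[of c] in \<open>auto simp: add.commute\<close>)

lemma bit_double [simp]: "(d :: bit) + (d + x) = x"
  by (cases "d = 0"; cases "x = 0") auto

text \<open>Shifting all indices by 1 swaps the two sides of the relation. The relation survives
  because its scalar is its own inverse.\<close>

lemma cls_alternating_shift:
  "cls (alternating (d, c + d) (1 + d, 1 + c + d) L) =
    twist c 1 \<star> cls (alternating (1 + d, 1 + c + d) (d, c + d) L)"
proof (cases "d = 0")
  case True
  then show ?thesis using cls_alternating[of c] by simp
next
  case False
  then have d: "d = 1" by simp
  have *: "twist c 1 \<star> cls (alternating (0, c) (1, 1 + c) L) =
      (twist c 1 * twist c 1) \<star> cls (alternating (1, 1 + c) (0, c) L)"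
    by (subst cls_alternating) (simp add: A.smult_smult del: twist_square)
  have bits: "c + 1 = 1 + c" "1 + c + 1 = c" "1 + 1 = (0 :: bit)"
    by (cases "c = 0"; simp)+
  show ?thesis unfolding d bits using *[symmetric] by simp
qed

lemma cls_replicate_shift: "cls (replicate (2 * n) (d, c + d)) = cls (replicate (2 * n) (0, c))"
proof (induction n)
  case (Suc n)
  have "cls (replicate (2 * Suc n) (d, c + d)) = cls [(d, c + d), (d, c + d)] \<cdot> cls (replicate (2 * n) (d, c + d))"
    by (simp flip: cls_append)
  also have "\<dots> = cls ([(0, c), (0, c)] @ replicate (2 * n) (0, c))"
    by (simp only: cls_squares_shift Suc cls_append)
  finally show ?case by simp
qed simp

lemma word_comult_squares: "word_comult [(0, c), (0, c)] = word_comult [(1, 1 + c), (1, 1 + c)]"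
proof -
  have "cls (lword d [(0, c), (0, c)]) = cls (lword d [(1, 1 + c), (1, 1 + c)])" for d
    using cls_squares[of d] by simp
  moreover have "cls (rword d [(0, c), (0, c)]) = cls (rword d [(1, 1 + c), (1, 1 + c)])" for d
    using cls_squares_shift[of d "c + d"] cls_squares_shift[of "1 + d" "c + d"]
    by (simp add: add.commute add.left_commute)
  ultimately show ?thesis by (simp only: word_comult_eq list.distinct not_False_eq_True)
qed

lemma word_comult_alternating:
  "word_comult (alternating (0, c) (1, 1 + c) L) =
    twist c 1 \<odot>\<^bsub>T\<^esub> word_comult (alternating (1, 1 + c) (0, c) L)"
proof -
  let ?w = "alternating (0, c) (1, 1 + c) L" and ?w' = "alternating (1, 1 + c) (0, c) L"
  have ne: "?w \<noteq> []" "?w' \<noteq> []" using L by (metis length_alternating list.size(3) not_numeral_le_zero)+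
  have l: "cls (lword d ?w) = twist d 1 \<star> cls (lword d ?w')" for d
    using cls_alternating[of d] by simp
  have r: "cls (rword d ?w) = twist (c + d) 1 \<star> cls (rword d ?w')" for d
    using cls_alternating_shift[of d "c + d"] by (simp add: add.commute add.left_commute)
  \<comment> \<open>The left factor has parity d and the right one parity c + d. The factors \<beta>
    they contribute combine to the scalar of parity c, as \<beta>^2 = 1.\<close>
  have "twist d 1 * twist (c + d) 1 = twist c 1" for d
    by (cases "d = 0"; cases "c = 0") auto
  then have "P (cls (lword d ?w)) (cls (rword d ?w)) = twist c 1 \<odot>\<^bsub>T\<^esub> P (cls (lword d ?w')) (cls (rword d ?w'))" for d
    unfolding l r by (simp add: A.tensor2_smult_left A.tensor2_smult_right T.smult_smult mult.commute)
  then show ?thesis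
    by (simp only: word_comult_eq[OF ne(1)] word_comult_eq[OF ne(2)] T.smult_add_right A.tensor2_closed cls_closed)
qed

text \<open>With e_c the parity units, the coproduct of e_0 is e_0 \<otimes> e_0 + e_1 \<otimes> e_1
  and that of e_1 is e_0 \<otimes> e_1 + e_1 \<otimes> e_0. Together these are the expansion of (e_0
  + e_1) \<otimes> (e_0 + e_1).\<close>

lemma word_comult_unit:
  "word_comult (replicate (2 * N) (0, 0)) \<oplus>\<^bsub>T\<^esub> word_comult (replicate (2 * N) (0, 1)) = \<one>\<^bsub>T\<^esub>"
proof -
  have e [simp]: "parity_unit c \<in> carrier A" for c by (simp add: parity_unit_def)
  have ne: "replicate (2 * N) x \<noteq> []" for x :: gen using N by simp
  have l: "cls (lword d (replicate (2 * N) (0, c))) = parity_unit d" for c d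
    by (simp add: parity_unit_def)
  have r: "cls (rword d (replicate (2 * N) (0, c))) = parity_unit (c + d)" for c d
    using cls_replicate_shift[of N d "c + d"] by (simp add: parity_unit_def add.commute add.left_commute)
  have sum: "parity_unit 0 \<boxplus> parity_unit 1 = \<one>\<^bsub>A\<^esub>"
    using cls_unit by (simp add: parity_unit_def)
  have "word_comult (replicate (2 * N) (0, 0)) \<oplus>\<^bsub>T\<^esub> word_comult (replicate (2 * N) (0, 1)) =
      (P (parity_unit 0) (parity_unit 0) \<oplus>\<^bsub>T\<^esub> P (parity_unit 1) (parity_unit 1)) \<oplus>\<^bsub>T\<^esub>
      (P (parity_unit 0) (parity_unit 1) \<oplus>\<^bsub>T\<^esub> P (parity_unit 1) (parity_unit 0))"
    by (simp add: word_comult_eq[OF ne] l r del: lrword_replicate)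
  also have "\<dots> = (P (parity_unit 0) (parity_unit 0) \<oplus>\<^bsub>T\<^esub> P (parity_unit 1) (parity_unit 0)) \<oplus>\<^bsub>T\<^esub>
      (P (parity_unit 0) (parity_unit 1) \<oplus>\<^bsub>T\<^esub> P (parity_unit 1) (parity_unit 1))"
    by (simp add: T.a_ac)
  also have "\<dots> = P (parity_unit 0 \<boxplus> parity_unit 1) (parity_unit 0 \<boxplus> parity_unit 1)"
    by (simp add: A.tensor2_add_left A.tensor2_add_right)
  finally show ?thesis by (simp add: sum A.tensor2_one)
qed

lemma word_comult_mixed: "i - j \<noteq> k - l \<Longrightarrow> word_comult [(i, j), (k, l)] = \<zero>\<^bsub>T\<^esub>"
proof -
  assume ne: "i - j \<noteq> k - l"
  have "cls (rword d [(i, j), (k, l)]) = \<zero>\<^bsub>A\<^esub>" for d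
    using ne cls_mixed_pair[of "i + d" j "k + d" l] by (simp add: algebra_simps)
  then show "word_comult [(i, j), (k, l)] = \<zero>\<^bsub>T\<^esub>"
    by (simp add: word_comult_eq A.tensor2_zero del: lrword_simps)
qed

lemma lin_ext_word_comult_ideal:
  assumes "p \<in> I"
  shows "lin_ext T word_comult p = \<zero>\<^bsub>T\<^esub>"
proof -
  have lin: "linear_map F T (lin_ext T word_comult)"
    unfolding free_algebra_eq by (rule T.linear_map_lin_ext[OF monoid_lists]) simp
  interpret l: linear_map F T "lin_ext T word_comult" by (rule lin)
  have add: "lin_ext T word_comult (p + q) = lin_ext T word_comult p \<oplus>\<^bsub>T\<^esub> lin_ext T word_comult q" for p q
    using l.map_add[of p q] by simp
  have diff: "lin_ext T word_comult (p - q) = lin_ext T word_comult p \<ominus>\<^bsub>T\<^esub> lin_ext T word_comult q" for p q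
    using l.map_minus[of p q] complex_space_minus_monoid_algebra[OF monoid_lists, of p q]
    by (simp add: free_algebra_eq)
  have mult: "lin_ext T word_comult (p \<bullet> q) = lin_ext T word_comult p \<otimes>\<^bsub>T\<^esub> lin_ext T word_comult q" for p q
    unfolding free_algebra_eq
    by (rule T.lin_ext_mult[OF monoid_lists]) (auto simp: word_comult_append)
  have cl: "lin_ext T word_comult p \<in> carrier T" for p using l.map_closed[of p] by simp
  have one: "word_comult [] = \<one>\<^bsub>T\<^esub>" by (simp add: word_comult_def)
  have rel: "lin_ext T word_comult r = \<zero>\<^bsub>T\<^esub>" if "r \<in> suzuki_relations N L 1 \<beta>" for r
    using that word_comult_squares[of 0] word_comult_squares[of 1] word_comult_alternating[of 0]
      word_comult_alternating[of 1] word_comult_unit word_comult_mixed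
    unfolding suzuki_relations_def by (auto simp: diff add one a_minus_def T.r_neg)
  show ?thesis
    using genideal_free_algebra_zero[OF lin, where S = "suzuki_relations N L 1 \<beta>" and p = p] assms
    by (simp add: mult rel cl suzuki_ideal_def)
qed

abbreviation Delta where "Delta \<equiv> suzuki_comult N L 1 \<beta>"

lemma
  shows linear_map_Delta: "linear_map A T Delta"
    and Delta_cls: "Delta (cls w) = word_comult w"
proof -
  have lin: "linear_map F T (lin_ext T word_comult)"
    unfolding free_algebra_eq by (rule T.linear_map_lin_ext[OF monoid_lists]) simp
  note ker = lin_ext_word_comult_ideal
  show "linear_map A T Delta"
    unfolding suzuki_comult_eq using I.linear_map_descend[OF lin ker] by (simp add: suzuki_algebra_def)
  show "Delta (cls w) = word_comult w"
    unfolding suzuki_comult_eq cls_def proj_def using I.descend_coset[OF lin ker, of "mon w"] by simp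
qed

section \<open>The Hopf record, its character and its normalized integral\<close>

abbreviation H where "H \<equiv> suzuki_hopf N L 1 \<beta>"

lemma suzuki_hopf_simps [simp]:
  "carrier H = carrier A" "mult H = mult A" "one H = one A" "zero H = zero A" "add H = add A"
  "smult H = smult A" "comult H = Delta" "counit H = eps"
  by (simp_all add: suzuki_hopf_def module.defs hopf.defs)

lemma complex_algebra_H: "complex_algebra H"
  by (rule complex_algebra_more_cong[OF A.complex_algebra_axioms]) simp_all

lemma tensor_H: "tensor_power H n = tensor_power A n" "pure_tensor H = pure_tensor A"
  by (rule tensor_power_more_cong; simp)+

sublocale H: comultiplicative H
proof -
  interpret H: complex_algebra H by (rule complex_algebra_H)
  have "linear_map H T Delta"
    by (rule linear_map_more_cong[OF linear_map_Delta H.complex_space_axioms]) simp_all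
  then show "comultiplicative H"
    by (simp add: comultiplicative_def comultiplicative_axioms_def H.complex_algebra_axioms tensor_H)
qed

text \<open>Sums and the basis selected for the trace refer to the record, so the two characters are
  not the same term. Both are evaluated on the dual family of normal forms.\<close>

lemma regular_character_H:
  assumes "h \<in> carrier A"
  shows "regular_character H h = regular_character A h"
proof -
  have fs: "finsum H f S = finsum A f S" if "f \<in> S \<rightarrow> carrier A" for f :: "'i \<Rightarrow> suzuki_elem" and S
    using that by (intro finsum_more_cong A.abelian_group_axioms H.abelian_group_axioms) auto
  have cl: "bcls i \<in> carrier A" for i by (cases i) simp
  have "regular_character H h = (\<Sum>i\<in>Ix. bcoeff i (h \<cdot> bcls i))"
    unfolding regular_character_def suzuki_hopf_simps
  proof (rule H.endo_trace_dual_family[OF _ finite_Ix])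
    show "linear_map H H (\<lambda>x. h \<cdot> x)"
      using assms by unfold_locales (auto simp: A.r_distr A.smult_mult_right)
    fix i assume "i \<in> Ix"
    show "linear_map H complex_numbers (bcoeff i)"
      by (cases i) (auto intro!: linear_map_more_cong[OF linear_map_acoeff H.complex_space_axioms])
  next
    fix i j assume "i \<in> Ix" "j \<in> Ix"
    then show "bcoeff i (bcls j) = of_bool (i = j)" by (rule bcoeff_bcls)
  next
    fix X assume "X \<in> carrier H"
    then have "X = (\<Oplus>\<^bsub>A\<^esub>i\<in>Ix. bcoeff i X \<star> bcls i)" using expansion by simp
    also have "\<dots> = (\<Oplus>\<^bsub>H\<^esub>i\<in>Ix. bcoeff i X \<star> bcls i)" using cl by (intro fs[symmetric]) auto
    finally show "X = (\<Oplus>\<^bsub>H\<^esub>i\<in>Ix. bcoeff i X \<odot>\<^bsub>H\<^esub> bcls i)" by simp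
  qed (use cl in auto)
  then show ?thesis by (simp add: regular_character_eq[OF assms])
qed

lemma normalized_integral_eq: "normalized_integral H = integral"
  unfolding normalized_integral_def suzuki_hopf_simps
proof (rule the_equality)
  show "integral \<in> carrier A \<and>
    (\<forall>h\<in>carrier A. h \<cdot> integral = eps h \<star> integral \<and> integral \<cdot> h = eps h \<star> integral) \<and>
    eps integral = 1"
    using integral_absorbs eps_integral by auto
  fix X assume X: "X \<in> carrier A \<and>
    (\<forall>h\<in>carrier A. h \<cdot> X = eps h \<star> X \<and> X \<cdot> h = eps h \<star> X) \<and> eps X = 1"
  then have "X = integral \<cdot> X" by (simp add: eps_integral)
  also have "\<dots> = integral" using X integral_absorbs(2)[of X] by simp
  finally show "X = integral" .
qed

end

section \<open>Sweedler powers of words\<close>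

definition bitlists :: "nat \<Rightarrow> bit list set" where
  "bitlists n = {ks. length ks = n}"

lemma bitlists_0 [simp]: "bitlists 0 = {[]}"
  by (simp add: bitlists_def)

lemma bitlists_Suc: "bitlists (Suc n) = Cons 0 ` bitlists n \<union> Cons 1 ` bitlists n"
proof -
  have "k = 0 \<or> k = 1" for k :: bit by auto
  then show ?thesis by (fastforce simp: bitlists_def length_Suc_conv)
qed

lemma finite_bitlists [simp]: "finite (bitlists n)"
  by (induction n) (simp_all add: bitlists_Suc)

lemma (in abelian_group) finsum_bitlists_Suc:
  assumes "f \<in> bitlists (Suc n) \<rightarrow> carrier G"
  shows "(\<Oplus>ks\<in>bitlists (Suc n). f ks) =
    (\<Oplus>ks\<in>bitlists n. f (0 # ks)) \<oplus> (\<Oplus>ks\<in>bitlists n. f (1 # ks))"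
proof -
  have "(\<Oplus>ks\<in>bitlists (Suc n). f ks) = (\<Oplus>ks\<in>Cons 0 ` bitlists n. f ks) \<oplus> (\<Oplus>ks\<in>Cons 1 ` bitlists n. f ks)"
    unfolding bitlists_Suc by (rule finsum_Un_disjoint) (use assms in \<open>auto simp: bitlists_Suc\<close>)
  then show ?thesis using assms by (simp add: finsum_reindex bitlists_Suc Pi_iff)
qed

context suzuki
begin

declare mult_bit_eq_and [simp del]

text \<open>
  With \<open>d = k - l\<close> the word with row indices \<open>x + k\<close> and column indices \<open>x + l\<close> has parity \<open>d\<close>;
  the iterated coproduct of such a word is the sum over all chains of intermediate shifts.
\<close>

definition slot :: "bit list \<Rightarrow> bit \<Rightarrow> bit \<Rightarrow> suzuki_elem" where
  "slot x k l = cls (map (\<lambda>i. (i + k, i + l)) x)"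

lemma slot_closed [simp, intro]: "slot x k l \<in> carrier A"
  by (simp add: slot_def)

fun chain :: "bit list \<Rightarrow> bit \<Rightarrow> bit list \<Rightarrow> bit \<Rightarrow> suzuki_elem list" where
  "chain x k [] c = [slot x k c]"
| "chain x k (l # ks) c = slot x k l # chain x l ks c"

lemma length_chain [simp]: "length (chain x k ks c) = Suc (length ks)"
  by (induction ks arbitrary: k) auto

lemma set_chain: "set (chain x k ks c) \<subseteq> carrier A"
  by (induction ks arbitrary: k) auto

text \<open>The starting shift occurs only in the first slot. The remaining slots can therefore be
  kept as v when the first one is comultiplied.\<close>

lemma chain_head: "\<exists>l v. (\<forall>k. chain x k ks c = slot x k l # v) \<and> set v \<subseteq> carrier A \<and> length v = length ks"
  by (cases ks) (use set_chain in auto)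

lemma slot_eq: "slot x k l = cls (word (k + l) (map (\<lambda>i. i + k) x))"
  by (simp add: slot_def word_def comp_def add.assoc)

lemma Delta_slot:
  assumes "x \<noteq> []"
  shows "Delta (slot x 0 l) = P (slot x 0 0) (slot x 0 l) \<oplus>\<^bsub>T\<^esub> P (slot x 0 1) (slot x 1 l)"
  using assms
  by (simp add: slot_def Delta_cls word_comult_eq lword_def rword_def comp_def case_prod_unfold)

text \<open>Comultiplying the first slot, from 0 to l, inserts an intermediate shift d: it becomes a
  slot from 0 to d followed by one from d to l. On chains this prepends d to the list of
  shifts.\<close>

lemma iter_comult_slot:
  assumes "x \<noteq> []"
  shows "iter_comult H (Suc n) (slot x 0 c) =
    (\<Oplus>\<^bsub>tensor_power H (Suc n)\<^esub>ks\<in>bitlists n. pure_tensor H (chain x 0 ks c))"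
proof (induction n)
  case 0
  interpret TH: complex_algebra "tensor_power H (Suc 0)" by (rule H.complex_algebra_tensor_power)
  have "pure_tensor H [slot x 0 c] \<in> carrier (tensor_power H (Suc 0))"
    by (rule H.pure_tensor_closed) auto
  then show ?case by (simp del: iter_comult.simps(3))
next
  case (Suc n)
  let ?T = "tensor_power H (Suc (Suc n))"
  interpret TH: complex_algebra ?T by (rule H.complex_algebra_tensor_power)
  interpret cf: linear_map "tensor_power H (Suc n)" ?T "comult_first H (Suc n)"
    using H.linear_map_comult_first[of n] by simp
  have pure: "pure_tensor H (chain x k ks c) \<in> carrier (tensor_power H m)" if "Suc (length ks) = m" for k ks m
    using that set_chain by (intro H.pure_tensor_closed) auto
  have pure': "pure_tensor H (chain x 0 (d # ks) c) \<in> carrier (?T)"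
    if "ks \<in> bitlists n" for d ks
    using that by (intro pure) (simp add: bitlists_def)
  have step: "comult_first H (Suc n) (pure_tensor H (chain x 0 ks c)) =
      pure_tensor H (chain x 0 (0 # ks) c) \<oplus>\<^bsub>?T\<^esub> pure_tensor H (chain x 0 (1 # ks) c)"
    if ks: "ks \<in> bitlists n" for ks
  proof -
    obtain l v where lv: "\<And>k. chain x k ks c = slot x k l # v" "set v \<subseteq> carrier A" "length v = length ks"
      using chain_head by blast
    have n: "length v = n" using ks lv(3) by (simp add: bitlists_def)
    interpret j: linear_map "tensor_power H 2" "tensor_power H (2 + length v)" "H.juxtapose 2 v"
      using lv(2) by (intro H.linear_map_juxtapose) simp
    have "comult_first H (Suc n) (pure_tensor H (chain x 0 ks c)) = H.juxtapose 2 v (Delta (slot x 0 l))"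
      using H.comult_first_pure[of "slot x 0 l" v n] lv n by simp
    also have "\<dots> = H.juxtapose 2 v (pure_tensor H [slot x 0 0, slot x 0 l]) \<oplus>\<^bsub>tensor_power H (2 + length v)\<^esub>
        H.juxtapose 2 v (pure_tensor H [slot x 0 1, slot x 1 l])"
      unfolding Delta_slot[OF assms] using j.map_add[OF H.tensor2_closed H.tensor2_closed] by (simp add: tensor_H)
    also have "H.juxtapose 2 v (pure_tensor H [slot x 0 0, slot x 0 l]) = pure_tensor H (chain x 0 (0 # ks) c)"
      using lv by (subst H.juxtapose_pure) auto
    also have "H.juxtapose 2 v (pure_tensor H [slot x 0 1, slot x 1 l]) = pure_tensor H (chain x 0 (1 # ks) c)"
      using lv by (subst H.juxtapose_pure) auto
    finally show ?thesis by (simp add: n add.commute)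
  qed
  have "iter_comult H (Suc (Suc n)) (slot x 0 c) =
      comult_first H (Suc n) (\<Oplus>\<^bsub>tensor_power H (Suc n)\<^esub>ks\<in>bitlists n. pure_tensor H (chain x 0 ks c))"
    using Suc by simp
  also have "\<dots> = (\<Oplus>\<^bsub>?T\<^esub>ks\<in>bitlists n. comult_first H (Suc n) (pure_tensor H (chain x 0 ks c)))"
    by (rule cf.map_finsum) (auto intro!: pure simp: bitlists_def)
  also have "\<dots> = (\<Oplus>\<^bsub>?T\<^esub>ks\<in>bitlists n.
      pure_tensor H (chain x 0 (0 # ks) c) \<oplus>\<^bsub>?T\<^esub> pure_tensor H (chain x 0 (1 # ks) c))"
    by (rule TH.finsum_cong') (auto intro!: pure' TH.a_closed simp: step simp del: chain.simps)
  also have "\<dots> = (\<Oplus>\<^bsub>?T\<^esub>ks\<in>bitlists n. pure_tensor H (chain x 0 (0 # ks) c)) \<oplus>\<^bsub>?T\<^esub>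
      (\<Oplus>\<^bsub>?T\<^esub>ks\<in>bitlists n. pure_tensor H (chain x 0 (1 # ks) c))"
    by (rule TH.finsum_addf) (auto intro!: pure' simp del: chain.simps)
  also have "\<dots> = (\<Oplus>\<^bsub>?T\<^esub>ks\<in>bitlists (Suc n). pure_tensor H (chain x 0 ks c))"
    by (rule TH.finsum_bitlists_Suc[symmetric]) (auto intro!: pure simp: bitlists_def)
  finally show ?case by simp
qed

text \<open>Row indices of the product along the chain k, k + d, k + 2d, ...; the argument n counts
  intermediate shifts, so there are n + 1 copies of x.\<close>

fun rows :: "bit list \<Rightarrow> nat \<Rightarrow> bit \<Rightarrow> bit \<Rightarrow> bit list" where
  "rows x 0 k d = map (\<lambda>i. i + k) x"
| "rows x (Suc n) k d = map (\<lambda>i. i + k) x @ rows x n (k + d) d"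

text \<open>The condition says that n + 1 steps of size d lead from k to c; in \<open>bit\<close>
  the difference of c and k is their sum.\<close>

definition chain_product :: "bit list \<Rightarrow> nat \<Rightarrow> bit \<Rightarrow> bit \<Rightarrow> bit \<Rightarrow> suzuki_elem" where
  "chain_product x n k c d =
    (if of_nat (Suc n) * d = c + k then cls (word d (rows x n k d)) else \<zero>\<^bsub>A\<^esub>)"

lemma chain_product_closed [simp, intro]: "chain_product x n k c d \<in> carrier A"
  by (simp add: chain_product_def)

lemma list_mult_H: "list_mult H = list_mult A"
  by (simp add: list_mult_def fun_eq_iff)

lemma rows_nonempty: "x \<noteq> [] \<Longrightarrow> rows x n k d \<noteq> []"
  by (cases n) auto

text \<open>Only the chains with constant increment \<open>d\<close> contribute, since mixed products vanish.\<close>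

lemma slot_mult_rows:
  assumes "x \<noteq> []"
  shows "slot x k l \<cdot> cls (word d (rows x n l d)) =
    (if l = k + d then cls (word d (rows x (Suc n) k d)) else \<zero>\<^bsub>A\<^esub>)"
proof (cases "l = k + d")
  case True
  then show ?thesis by (simp add: slot_eq cls_append)
next
  case False
  then have "k + l \<noteq> d" by (cases "k = 0"; cases "l = 0"; cases "d = 0") auto
  then have "\<not> pure c (word (k + l) (map (\<lambda>i. i + k) x) @ word d (rows x n l d))" for c
    using assms rows_nonempty[OF assms] by (auto simp: pure_word)
  then show ?thesis
    unfolding slot_eq cls_append[symmetric] using cls_not_pure False by auto
qed

text \<open>Among all chains from k to c only those with constant increment have a nonzero product,
  and such a chain is determined by its increment d. Splitting off the first step turns this into a
  recursion in k.\<close>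

lemma sum_list_mult_chain:
  assumes "x \<noteq> []"
  shows "(\<Oplus>\<^bsub>A\<^esub>ks\<in>bitlists n. list_mult A (chain x k ks c)) =
    chain_product x n k c 0 \<boxplus> chain_product x n k c 1"
proof (induction n arbitrary: k)
  case 0
  have "slot x k c = chain_product x 0 k c 0 \<boxplus> chain_product x 0 k c 1"
    by (cases "k = 0"; cases "c = 0") (simp_all add: slot_eq chain_product_def)
  then show ?case by simp
next
  case (Suc n)
  have lm: "list_mult A (chain x k ks c) \<in> carrier A" for k ks
    using set_chain by (intro A.list_mult_closed)
  have inner: "(\<Oplus>\<^bsub>A\<^esub>ks\<in>bitlists n. list_mult A (chain x k (l # ks) c)) =
      slot x k l \<cdot> chain_product x n l c 0 \<boxplus> slot x k l \<cdot> chain_product x n l c 1" for l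
  proof -
    have "(\<Oplus>\<^bsub>A\<^esub>ks\<in>bitlists n. list_mult A (chain x k (l # ks) c)) =
        slot x k l \<cdot> (\<Oplus>\<^bsub>A\<^esub>ks\<in>bitlists n. list_mult A (chain x l ks c))"
      using lm by (simp add: A.finsum_rdistr Pi_iff)
    then show ?thesis by (simp add: Suc A.r_distr)
  qed
  have mult: "slot x k l \<cdot> chain_product x n l c d =
      (if l = k + d then chain_product x (Suc n) k c d else \<zero>\<^bsub>A\<^esub>)" for l d
  proof -
    have eq: "of_nat (Suc n) * d = c + (k + d) \<longleftrightarrow> of_nat (Suc (Suc n)) * d = c + k"
      by (cases "d = 0"; cases "k = 0"; cases "c = 0"; cases "of_nat n = (0 :: bit)") simp_all
    show ?thesis
    proof (cases "l = k + d")
      case True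
      show ?thesis
        unfolding True chain_product_def eq using slot_mult_rows[OF assms, of k "k + d" d n]
        by (cases "of_nat (Suc (Suc n)) * d = c + k") (simp_all del: rows.simps of_nat_Suc)
    next
      case False
      then show ?thesis
        by (simp add: chain_product_def slot_mult_rows[OF assms] del: rows.simps of_nat_Suc)
    qed
  qed
  have "(\<Oplus>\<^bsub>A\<^esub>ks\<in>bitlists (Suc n). list_mult A (chain x k ks c)) =
      (slot x k 0 \<cdot> chain_product x n 0 c 0 \<boxplus> slot x k 0 \<cdot> chain_product x n 0 c 1) \<boxplus>
      (slot x k 1 \<cdot> chain_product x n 1 c 0 \<boxplus> slot x k 1 \<cdot> chain_product x n 1 c 1)"
    unfolding A.finsum_bitlists_Suc[OF funcsetI[OF lm]] inner ..
  also have "\<dots> = chain_product x (Suc n) k c 0 \<boxplus> chain_product x (Suc n) k c 1"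
    unfolding mult by (cases "k = 0") (simp_all add: A.a_comm)
  finally show ?case .
qed

lemma sweedler_power_word:
  assumes "x \<noteq> []"
  shows "sweedler_power H (Suc n) (cls (word 0 x)) =
    cls (word 0 (rows x n 0 0)) \<boxplus> (if odd n then cls (word 1 (rows x n 0 1)) else \<zero>\<^bsub>A\<^esub>)"
proof -
  interpret TH: complex_algebra "tensor_power H (Suc n)" by (rule H.complex_algebra_tensor_power)
  interpret s: linear_map "tensor_power H (Suc n)" H "descend (lin_ext H (list_mult H))"
    by (rule H.linear_map_sweedler_mult)
  have lm: "list_mult A (chain x k ks c) \<in> carrier A" for k ks c
    using set_chain by (intro A.list_mult_closed)
  have "cls (word 0 x) = slot x 0 0" by (simp add: slot_eq)
  then have "sweedler_power H (Suc n) (cls (word 0 x)) = descend (lin_ext H (list_mult H))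
      (\<Oplus>\<^bsub>tensor_power H (Suc n)\<^esub>ks\<in>bitlists n. pure_tensor H (chain x 0 ks 0))"
    unfolding sweedler_power_def by (simp only: iter_comult_slot[OF assms])
  also have "\<dots> = (\<Oplus>\<^bsub>H\<^esub>ks\<in>bitlists n. descend (lin_ext H (list_mult H)) (pure_tensor H (chain x 0 ks 0)))"
  proof (rule s.map_finsum, rule funcsetI)
    fix ks assume "ks \<in> bitlists n"
    then show "pure_tensor H (chain x 0 ks 0) \<in> carrier (tensor_power H (Suc n))"
      by (intro H.pure_tensor_closed) (simp_all add: bitlists_def set_chain)
  qed
  also have "\<dots> = (\<Oplus>\<^bsub>H\<^esub>ks\<in>bitlists n. list_mult A (chain x 0 ks 0))"
  proof (rule H.finsum_cong')
    fix ks assume "ks \<in> bitlists n"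
    then show "descend (lin_ext H (list_mult H)) (pure_tensor H (chain x 0 ks 0)) = list_mult A (chain x 0 ks 0)"
      using H.sweedler_mult_pure[of "chain x 0 ks 0" "Suc n"] set_chain
      by (simp add: bitlists_def list_mult_H)
  qed (use lm in auto)
  also have "\<dots> = (\<Oplus>\<^bsub>A\<^esub>ks\<in>bitlists n. list_mult A (chain x 0 ks 0))"
    using lm by (intro finsum_more_cong A.abelian_group_axioms H.abelian_group_axioms) auto
  also have "\<dots> = chain_product x n 0 0 0 \<boxplus> chain_product x n 0 0 1"
    by (rule sum_list_mult_chain[OF assms])
  also have "\<dots> = cls (word 0 (rows x n 0 0)) \<boxplus> (if odd n then cls (word 1 (rows x n 0 1)) else \<zero>\<^bsub>A\<^esub>)"
  proof -
    \<comment> \<open>An even number of steps of size 1 is needed to return to the shift 0.\<close>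
    have "(of_nat (Suc n) :: bit) = 0 \<longleftrightarrow> odd n"
      by (induction n) auto
    then show ?thesis by (simp add: chain_product_def del: of_nat_Suc)
  qed
  finally show ?thesis .
qed

section \<open>Alternating sums of the products and the indicator as a finite sum\<close>

lemma length_rows [simp]: "length (rows x n k d) = Suc n * length x"
  by (induction n arbitrary: k) auto

lemma alt_complement: "alt (map (\<lambda>i. i + 1) x) = - of_bool (odd (length x)) - alt x"
proof (induction x)
  case (Cons i x)
  then show ?case by (cases "i = 0") auto
qed simp

text \<open>The n + 1 copies of x enter with signs given by the powers of (-1)^length: they add up
  for even length and cancel in pairs for odd length.\<close>

lemma alt_rows_0:
  "alt (rows x n 0 0) =
    (if even (length x) then int (Suc n) * alt x else if even n then alt x else 0)"
  by (induction n) (auto simp: alt_append algebra_simps)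

text \<open>The copies alternate between x and its complement. Each such pair has even total length
  and contributes 0 if x has even length, and 2 alt x + 1 if it has odd length.\<close>

lemma alt_rows_1:
  "alt (rows x (Suc (2 * q)) 0 1) = (if even (length x) then 0 else int (Suc q) * (2 * alt x + 1))"
  by (induction q) (auto simp: alt_append alt_complement algebra_simps)

text \<open>The share of the group element (m, a) in the indicator of index n + 1. The factor 2NL of
  the regular character has already been cancelled against the normalisation of the
  integral.\<close>

definition trace_term :: "nat \<Rightarrow> nat \<Rightarrow> nat \<Rightarrow> complex" where
  "trace_term n m a = of_bool (2 * N dvd Suc n * m) *
    (of_bool (int L dvd (if even m then int (Suc n) * int a else if even n then int a else 0)) +
     of_bool (odd n) * of_bool (int L dvd alt (rows (normal_list m a) n 0 1)) *
       twist 1 (alt (rows (normal_list m a) n 0 1) div int L))"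

lemma fs_indicator_sum:
  "fs_indicator H (Suc n) = (\<Sum>m<2 * N. \<Sum>a<L. trace_term n m a)"
proof -
  interpret s: linear_map H H "sweedler_power H (Suc n)" by (rule H.linear_map_sweedler_power)
  interpret chi: linear_map A complex_numbers "regular_character A" by (rule linear_map_regular_character)
  have s_closed: "sweedler_power H (Suc n) X \<in> carrier A" if "X \<in> carrier A" for X
    using s.map_closed[of X] that by simp
  have s_lin: "linear_map A A (sweedler_power H (Suc n))"
    using s.map_add s.map_smult s_closed by unfold_locales auto
  interpret t: linear_map A complex_numbers "\<lambda>X. regular_character A (sweedler_power H (Suc n) X)"
    by (rule linear_map_compose[OF s_lin linear_map_regular_character])
  have summand: "regular_character A (sweedler_power H (Suc n) (cls (bword 0 m a))) = of_nat (2 * N * L) * trace_term n m a" for m a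
  proof -
    let ?x = "normal_list m a"
    have len: "2 * N dvd Suc n * length ?x \<longleftrightarrow> 2 * N dvd Suc n * m"
    proof -
      have "Suc n * length ?x = Suc n * m + (Suc n * (a + 1)) * (2 * N)"
        by (simp add: length_normal_list algebra_simps)
      then show ?thesis by (simp only: dvd_add_times_triv_right_iff)
    qed
    have par: "even (length ?x) \<longleftrightarrow> even m" by (simp add: length_normal_list)
    have alt0: "alt (rows ?x n 0 0) = (if even m then int (Suc n) * int a else if even n then int a else 0)"
      by (simp only: alt_rows_0 par alt_normal_list)
    have chi0: "regular_character A (cls (word 0 (rows ?x n 0 0))) = of_nat (2 * N * L) *
        (of_bool (2 * N dvd Suc n * m) *
         of_bool (int L dvd (if even m then int (Suc n) * int a else if even n then int a else 0)))"
      using regular_character_word[OF rows_nonempty[OF normal_list_nonempty], of 0 m a n 0 0]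
      by (simp only: length_rows len alt0 twist_simps) (simp del: of_nat_Suc mult_Suc)
    have chi1: "regular_character A (cls (word 1 (rows ?x n 0 1))) = of_nat (2 * N * L) *
        (of_bool (2 * N dvd Suc n * m) * of_bool (int L dvd alt (rows ?x n 0 1)) *
         twist 1 (alt (rows ?x n 0 1) div int L))"
      using regular_character_word[OF rows_nonempty[OF normal_list_nonempty], of 1 m a n 0 1]
      by (simp only: length_rows len) (simp del: of_nat_Suc mult_Suc)
    show ?thesis
    proof (cases "odd n")
      case True
      then show ?thesis
        using chi.map_add[OF cls_closed cls_closed, of "word 0 (rows ?x n 0 0)" "word 1 (rows ?x n 0 1)"]
        unfolding sweedler_power_word[OF normal_list_nonempty] trace_term_def
        by (simp only: if_True complex_numbers_simps chi0 chi1 simp_thms of_bool_eq distrib_left mult.assoc mult_1)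
    next
      case False
      then show ?thesis
        unfolding sweedler_power_word[OF normal_list_nonempty] trace_term_def
        by (simp only: if_False A.r_zero cls_closed chi0 of_bool_eq mult_zero_left add_0_right)
    qed
  qed
  have "fs_indicator H (Suc n) = regular_character A (sweedler_power H (Suc n) integral)"
    unfolding fs_indicator_def normalized_integral_eq by (rule regular_character_H[OF s_closed]) simp
  also have "\<dots> = (1 / of_nat (2 * N * L)) *
      (\<Sum>i\<in>{..<2 * N} \<times> {..<L}. regular_character A (sweedler_power H (Suc n) (cls (bword 0 (fst i) (snd i)))))"
    unfolding integral_def
    by (subst t.map_smult; (subst t.map_finsum)?) (auto intro!: A.finsum_closed)
  also have "\<dots> = (\<Sum>i\<in>{..<2 * N} \<times> {..<L}. (1 / of_nat (2 * N * L)) *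
      regular_character A (sweedler_power H (Suc n) (cls (bword 0 (fst i) (snd i)))))"
    by (rule sum_distrib_left)
  also have "\<dots> = (\<Sum>(m, a)\<in>{..<2 * N} \<times> {..<L}. trace_term n m a)"
  proof (rule sum.cong)
    fix i :: "nat \<times> nat" 
    have ne: "(of_nat (2 * N * L) :: complex) \<noteq> 0" using N L by simp
    have cancel: "1 / K * (K * y) = y" if "K \<noteq> 0" for K y :: complex using that by simp
    show "1 / of_nat (2 * N * L) * regular_character A (sweedler_power H (Suc n) (cls (bword 0 (fst i) (snd i)))) =
      (case i of (m, a) \<Rightarrow> trace_term n m a)"
      unfolding summand case_prod_unfold by (rule cancel[OF ne])
  qed simp
  finally show ?thesis by (simp only: sum.cartesian_product)
qed

end

section \<open>Counting solutions\<close>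

lemma b2_odd: "n > 0 \<Longrightarrow> odd n \<longleftrightarrow> b2 n = 0"
  by (auto simp: b2_def multiplicity_eq_zero_iff)

lemma b2_mult: "\<lbrakk>m > 0; n > 0\<rbrakk> \<Longrightarrow> b2 (m * n) = b2 m + b2 n"
  by (simp add: b2_def prime_elem_multiplicity_mult_distrib)

lemma b2_nonneg: "b2 n \<ge> 0"
  by (simp add: b2_def)

text \<open>After division by the gcd at most one of the cofactors is even, and the 2-adic
  valuations decide which.\<close>

lemma gcd_factor:
  fixes K q :: nat
  assumes "K > 0" "q > 0"
  obtains g K' q' where "gcd K q = g" "K = g * K'" "q = g * q'" "coprime q' K'" "g > 0" "K' > 0" "q' > 0"
    "odd K' \<longleftrightarrow> b2 q \<ge> b2 K" "odd K' \<Longrightarrow> odd q' \<longleftrightarrow> b2 q = b2 K"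
proof -
  define g K' q' where "g = gcd K q" and "K' = K div g" and "q' = q div g"
  have f: "K = g * K'" "q = g * q'" by (simp_all add: g_def K'_def q'_def)
  then have pos: "g > 0" "K' > 0" "q' > 0" using assms by (auto intro!: gr0I)
  have "coprime K' q'" unfolding g_def K'_def q'_def using assms by (intro div_gcd_coprime) simp
  then have cop: "coprime q' K'" by (simp only: coprime_commute)
  have b2: "b2 K = b2 g + b2 K'" "b2 q = b2 g + b2 q'"
    unfolding f using pos by (simp_all add: b2_mult)
  have "odd K' \<or> odd q'" using cop by (auto simp: coprime_def)
  then have "b2 K' = 0 \<or> b2 q' = 0" using b2_odd pos by blast
  then have "odd K' \<longleftrightarrow> b2 q \<ge> b2 K" "odd K' \<Longrightarrow> odd q' \<longleftrightarrow> b2 q = b2 K"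
    using b2 b2_odd[OF pos(2)] b2_odd[OF pos(3)] b2_nonneg[of K'] b2_nonneg[of q'] by auto
  then show ?thesis by (rule that[OF g_def[symmetric] f cop pos])
qed

text \<open>Dividing by g = gcd K q leaves a congruence modulo K' with the invertible coefficient
  q', and the range consists of g periods.\<close>

lemma sum_dvd_mult:
  assumes "K > 0" "q > 0"
  shows "(\<Sum>a<K. of_bool (int K dvd int q * int a)) = (of_nat (gcd K q) :: complex)"
proof -
  obtain g K' q' where f: "gcd K q = g" "K = g * K'" "q = g * q'" "coprime q' K'" "g > 0" "K' > 0"
    by (rule gcd_factor[OF assms]) (rule that; assumption)
  have dvd_iff: "int K dvd int q * int a \<longleftrightarrow> int K' dvd int q' * int a + 0" for a
  proof -
    have "K dvd q * a \<longleftrightarrow> g * K' dvd g * (q' * a)"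
      unfolding f(2,3) by (simp only: mult.assoc)
    also have "\<dots> \<longleftrightarrow> K' dvd q' * a" using f(5) by simp
    finally show ?thesis by (simp flip: of_nat_mult)
  qed
  have "(\<Sum>a<K. of_bool (int K dvd int q * int a)) = (\<Sum>a<g * K'. of_bool (int K' dvd int q' * int a + 0) :: complex)"
    unfolding dvd_iff by (simp only: f(2)[symmetric])
  also have "\<dots> = of_nat g"
    using f(4) by (intro sum_coprime_dvd_linear[OF f(6)]) simp
  finally show ?thesis by (simp only: f(1))
qed

text \<open>Dividing by the gcd and dropping the coprime q' leaves K' dvd 2a + 1. This is solvable
  only for odd K', that is b2 q \<ge> b2 K, and then there is one solution in each of the g periods.
  The quotient by K is q' times an odd number, so its parity, and with it the power of \<beta>, is
  that of q'.\<close>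

lemma sum_dvd_mult_odd:
  fixes \<beta> :: complex
  assumes K: "K > 0" and q: "q > 0" and \<beta>: "\<beta> \<in> {1, - 1}"
  shows "(\<Sum>a<K. of_bool (int K dvd int q * (2 * int a + 1)) *
      (if odd ((int q * (2 * int a + 1)) div int K) then \<beta> else 1)) =
    of_bool (b2 q \<ge> b2 K) * \<beta> ^ of_bool (b2 q = b2 K) * of_nat (gcd K q)"
proof -
  obtain g K' q' where g: "gcd K q = g" and Kq: "K = g * K'" "q = g * q'" and cop: "coprime q' K'"
    and pos: "g > 0" "K' > 0" "q' > 0"
    and b2: "odd K' \<longleftrightarrow> b2 q \<ge> b2 K" "odd K' \<Longrightarrow> odd q' \<longleftrightarrow> b2 q = b2 K"
    by (rule gcd_factor[OF K q]) (rule that; assumption)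
  have dvd_iff: "int K dvd int q * (2 * int a + 1) \<longleftrightarrow> int K' dvd 2 * int a + 1" for a
  proof -
    have "K dvd q * (2 * a + 1) \<longleftrightarrow> g * K' dvd g * (q' * (2 * a + 1))"
      unfolding Kq by (simp only: mult.assoc)
    also have "\<dots> \<longleftrightarrow> K' dvd 2 * a + 1"
      using pos coprime_dvd_mult_right_iff[of K' q' "2 * a + 1"] coprime_commute[of q' K'] cop by simp
    finally have "int K dvd int (q * (2 * a + 1)) \<longleftrightarrow> int K' dvd int (2 * a + 1)"
      by (simp only: int_dvd_int_iff)
    then show ?thesis by (simp add: algebra_simps)
  qed
  show ?thesis
  proof (cases "odd K'")
    case True
    have sgn: "odd ((int q * (2 * int a + 1)) div int K) \<longleftrightarrow> odd q'" if dv: "int K' dvd 2 * int a + 1" for a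
    proof -
      obtain t where t: "2 * int a + 1 = int K' * t" using dv by (rule dvdE)
      have "odd (int K' * t)" unfolding t[symmetric] by simp
      then have "odd t" by simp
      have "int q * (2 * int a + 1) = int K * (int q' * t)"
        unfolding t Kq by simp
      then have "(int q * (2 * int a + 1)) div int K = int q' * t" using K by simp
      then show ?thesis using \<open>odd t\<close> by simp
    qed
    have "(\<Sum>a<K. of_bool (int K dvd int q * (2 * int a + 1)) *
        (if odd ((int q * (2 * int a + 1)) div int K) then \<beta> else 1)) =
      (\<Sum>a<K. of_bool (int K' dvd 2 * int a + 1) * (if odd q' then \<beta> else 1))"
      by (intro sum.cong) (auto simp: dvd_iff sgn)
    also have "\<dots> = (\<Sum>a<g * K'. of_bool (int K' dvd 2 * int a + 1)) * (if odd q' then \<beta> else 1)"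
      unfolding Kq(1) by (rule sum_distrib_right[symmetric])
    also have "(\<Sum>a<g * K'. of_bool (int K' dvd 2 * int a + 1)) = (of_nat g :: complex)"
      using True by (intro sum_coprime_dvd_linear[OF pos(2)]) simp
    finally show ?thesis using True b2 by (simp add: g)
  next
    case False
    have "\<not> int K' dvd 2 * int a + 1" for a
    proof
      assume "int K' dvd 2 * int a + 1"
      moreover have "2 dvd int K'" using False by simp
      ultimately have "2 dvd 2 * int a + 1" by (rule dvd_trans[rotated])
      then show False by simp
    qed
    then show ?thesis using False b2 by (simp add: dvd_iff)
  qed
qed

lemma sum_dvd_mult_odd_card:
  assumes "K > 0" "q > 0"
  shows "(\<Sum>a<K. of_bool (int K dvd int q * (2 * int a + 1))) = (of_bool (b2 q \<ge> b2 K) * of_nat (gcd K q) :: complex)"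
  using sum_dvd_mult_odd[OF assms, of 1] by simp

text \<open>Under the hypothesis on valuations the cofactor of K is odd, so doubling q adds no
  common factor.\<close>

lemma gcd_double:
  assumes "K > 0" "q > 0" "b2 q \<ge> b2 K"
  shows "gcd K (2 * q) = gcd K q"
proof -
  obtain g K' q' where g: "gcd K q = g" and Kq: "K = g * K'" "q = g * q'" and cop: "coprime q' K'"
    and "odd K' \<longleftrightarrow> b2 q \<ge> b2 K"
    by (rule gcd_factor[OF assms(1,2)]) (rule that; assumption)
  then have "coprime (2 * q') K'" using cop assms(3) by simp
  then have "gcd K' (2 * q') = 1" by (simp add: gcd.commute coprime_iff_gcd_eq_1)
  then have "gcd (g * K') (g * (2 * q')) = g"
    using gcd_mult_distrib_nat[of g K' "2 * q'"] by simp
  moreover have "gcd K (2 * q) = gcd (g * K') (g * (2 * q'))" unfolding Kq by (simp add: mult.left_commute)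
  ultimately show ?thesis by (simp add: g)
qed

lemma sum_even_odd: "(\<Sum>m<2 * (K :: nat). f m) = (\<Sum>k<K. f (2 * k)) + (\<Sum>k<K. f (2 * k + 1) :: 'a :: comm_monoid_add)"
  by (induction K) (simp_all add: algebra_simps)

theorem theorem5p14:
  fixes N L n :: nat and \<beta> :: complex
  assumes "N \<ge> 1" and "L \<ge> 2" and "even N" and "\<beta> \<in> {1, - 1}" and "n \<ge> 1"
  shows "fs_indicator (suzuki_hopf N L 1 \<beta>) n =
      of_nat (gcd N n * gcd L n)
    + of_bool (b2 n - 1 \<ge> 0) * of_nat (L * gcd N n)
    + of_bool (b2 n - 1 \<ge> b2 N) * of_nat (L * gcd N n)
    + of_bool (b2 n - 1 \<ge> b2 N \<and> b2 n - 1 \<ge> b2 L) *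
        suzuki_sign L \<beta> n * of_nat (gcd N n * gcd L n)"
proof -
  interpret suzuki N L \<beta> using assms by unfold_locales
  obtain n' where n': "n = Suc n'" using assms(5) by (cases n) auto
  have N0: "N > 0" and L0: "L > 0" and n0: "n > 0" using assms(1,2,5) by simp_all
  have b2N: "b2 N \<ge> 1" using b2_odd[OF N0] assms(3) b2_nonneg[of N] by simp
  \<comment> \<open>\<open>c\<close> is the contribution of parity 0 and \<open>d\<close> that of
    parity 1. The residue m has the parity of the length of the row sequence, so the sum over m is
    split into even and odd values.\<close>
  define c where "c m a = (of_bool (int L dvd (if even m then int n * int a else if odd n then int a else 0)) :: complex)"
    for m a :: nat
  define d where "d m a = of_bool (even n) * of_bool (int L dvd alt (rows (normal_list m a) n' 0 1)) *
    twist 1 (alt (rows (normal_list m a) n' 0 1) div int L)" for m a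
  have fs: "fs_indicator H n = (\<Sum>m<2 * N. of_bool (2 * N dvd n * m) * (\<Sum>a<L. c m a + d m a))"
    unfolding n' fs_indicator_sum trace_term_def c_def d_def sum_distrib_left by (simp only: even_Suc not_not)
  have c_even: "(\<Sum>a<L. c (2 * k) a) = of_nat (gcd L n)" for k
    using sum_dvd_mult[OF L0 n0] by (simp add: c_def)
  have even_dvd: "2 * N dvd n * (2 * k) \<longleftrightarrow> int N dvd int n * int k" for k
  proof -
    have "2 * N dvd n * (2 * k) \<longleftrightarrow> 2 * N dvd 2 * (n * k)" by (simp add: mult.left_commute)
    also have "\<dots> \<longleftrightarrow> N dvd n * k" by (rule dvd_times_left_cancel_iff) simp
    finally show ?thesis by (simp flip: of_nat_mult)
  qed
  have even_count: "(\<Sum>k<N. of_bool (2 * N dvd n * (2 * k))) = (of_nat (gcd N n) :: complex)"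
    unfolding even_dvd by (rule sum_dvd_mult[OF N0 n0])
  show ?thesis
  proof (cases "even n")
    case False
    have d0: "d m a = 0" for m a using False by (simp add: d_def)
    have odd_zero: "\<not> 2 * N dvd n * (2 * k + 1)" for k
    proof
      assume "2 * N dvd n * (2 * k + 1)"
      then have "even (n * (2 * k + 1))" by (meson dvd_trans dvd_triv_left)
      then show False using False by simp
    qed
    have "fs_indicator H n = (\<Sum>k<N. of_bool (2 * N dvd n * (2 * k)) * of_nat (gcd L n))"
      unfolding fs sum_even_odd by (simp only: odd_zero d0 add_0_right c_even) simp
    also have "\<dots> = of_nat (gcd N n) * of_nat (gcd L n)"
      unfolding sum_distrib_right[symmetric] even_count ..
    finally show ?thesis
      using False b2_odd[of n] assms(5) b2N by simp
  next
    case True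
    then obtain q where q: "n = 2 * q" by blast
    have q0: "q > 0" using q assms(5) by simp
    have b2n: "b2 n = b2 q + 1"
      unfolding q using b2_mult[of 2 q] q0 by (simp add: b2_def)
    have n'q: "n' = Suc (2 * (q - 1))" using q n' q0 by simp
    have alt1: "alt (rows (normal_list m a) n' 0 1) = (if even m then 0 else int q * (2 * int a + 1))" for m a
      using q0 unfolding n'q alt_rows_1 by (simp add: length_normal_list alt_normal_list)
    \<comment> \<open>The alternating sum is 0 here, so all L values of a count, each with
      \<open>twist\<close> equal to 1. The same happens in parity 0 for odd m, where the even number
      of copies cancels.\<close>
    have d_even: "(\<Sum>a<L. d (2 * k) a) = of_nat L" for k
      using True by (simp add: d_def alt1)
    have c_odd: "(\<Sum>a<L. c (2 * k + 1) a) = of_nat L" for k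
      using True by (simp add: c_def)
    define S where "S = of_bool (b2 q \<ge> b2 L) * \<beta> ^ of_bool (b2 q = b2 L) * (of_nat (gcd L q) :: complex)"
    have d_odd: "(\<Sum>a<L. d (2 * k + 1) a) = S" for k
      using sum_dvd_mult_odd[OF L0 q0 assms(4)] True by (simp add: d_def alt1 twist_def S_def)
    have odd_dvd: "2 * N dvd n * (2 * k + 1) \<longleftrightarrow> int N dvd int q * (2 * int k + 1)" for k
    proof -
      have "2 * N dvd n * (2 * k + 1) \<longleftrightarrow> 2 * N dvd 2 * (q * (2 * k + 1))" unfolding q by (simp only: mult.assoc)
      also have "\<dots> \<longleftrightarrow> N dvd q * (2 * k + 1)" by (rule dvd_times_left_cancel_iff) simp
      also have "\<dots> \<longleftrightarrow> int N dvd int (q * (2 * k + 1))" by (simp only: int_dvd_int_iff)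
      finally show ?thesis by (simp add: algebra_simps)
    qed
    have odd_count: "(\<Sum>k<N. of_bool (2 * N dvd n * (2 * k + 1))) = (of_bool (b2 q \<ge> b2 N) * of_nat (gcd N q) :: complex)"
      unfolding odd_dvd by (rule sum_dvd_mult_odd_card[OF N0 q0])
    \<comment> \<open>The four products yield the terms of the formula in its order: m even with
      parities 0 and 1, then m odd with parities 0 and 1.\<close>
    have "fs_indicator H n = (\<Sum>k<N. of_bool (2 * N dvd n * (2 * k)) * (of_nat (gcd L n) + of_nat L)) +
        (\<Sum>k<N. of_bool (2 * N dvd n * (2 * k + 1)) * (of_nat L + S))"
      unfolding fs sum_even_odd sum.distrib c_even d_even c_odd d_odd ..
    also have "\<dots> = of_nat (gcd N n) * (of_nat (gcd L n) + of_nat L) +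
        of_bool (b2 q \<ge> b2 N) * of_nat (gcd N q) * (of_nat L + S)"
      unfolding sum_distrib_right[symmetric] even_count odd_count ..
    finally have fs': "fs_indicator H n = of_nat (gcd N n) * (of_nat (gcd L n) + of_nat L) +
        of_bool (b2 q \<ge> b2 N) * of_nat (gcd N q) * (of_nat L + S)" .
    \<comment> \<open>Counting for odd m produces gcds with q = n / 2. Under the valuation
      conditions that accompany them they equal the gcds with n.\<close>
    have gN: "gcd N q = gcd N n" if "b2 q \<ge> b2 N"
      using gcd_double[OF N0 q0 that] by (simp add: q)
    have gL: "gcd L q = gcd L n" if "b2 q \<ge> b2 L"
      using gcd_double[OF L0 q0 that] by (simp add: q)
    \<comment> \<open>Since N is even, b2 q \<ge> b2 N \<ge> 1 gives b2 n \<ge> 2, so the factor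
      (-1)^[b_2(n) = 1] is 1.\<close>
    have sign: "suzuki_sign L \<beta> n = \<beta> ^ of_bool (b2 q = b2 L)" if "b2 q \<ge> b2 N"
      using that b2N b2n by (simp add: suzuki_sign_def)
    show ?thesis
    proof (cases "b2 q \<ge> b2 N")
      case True
      then show ?thesis
        unfolding fs' using b2n b2_nonneg[of q] gN[OF True] sign[OF True] gL
        by (cases "b2 q \<ge> b2 L") (simp_all add: S_def algebra_simps)
    next
      case False
      then show ?thesis
        unfolding fs' using b2n b2_nonneg[of q] by (simp add: algebra_simps)
    qed
  qed
qed

end
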